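(* Let $\Omega$ be a bounded Lipschitz domain and $1<p<\infty$. There is $C>0$ independent of $\varepsilon$ such that for every $u\in W^{1,p}_{\phi_\varepsilon,0}(\Omega_\varepsilon)$, $$\|u\|_{L^p(\Omega_\varepsilon)}\le C\|\phi_\varepsilon\nabla u\|_{L^p(\Omega_\varepsilon)}.$$
   Context: Let $Y=(-1/2,1/2)^d$ and $\tau_1,\dots,\tau_m\subset Y$ mutually disjoint open sets with smooth connected boundaries, $\mathrm{dist}(\tau_i,\partial Y)\ge c_0$, $\mathrm{dist}(\tau_i,\tau_j)\ge c_0$; $T=\bigcup_i\overline{\tau_i}$, $T_\varepsilon=\bigcup_{z\in\mathbb Z^d}\varepsilon(z+T)$, $\Omega_\varepsilon=\Omega\setminus T_\varepsilon$ ($0<\varepsilon<1$), with $\mathrm{dist}(\partial\Omega,\partial T_\varepsilon)\ge c_0\varepsilon$. Extended holes: smooth open $\tau_i'\supset\tau_i$ with $\mathrm{dist}(\tau_i',\tau_j')\ge c_0/4$, $\mathrm{dist}(\tau_i',\partial Y)\ge c_0/4$, $\mathrm{dist}(\partial\tau_i',\tau_i)\ge c_0/4$; $T'=\bigcup_i\overline{\tau_i'}$; it is assumed that the sets $\varepsilon(z+T')$, $z\in\mathbb Z^d$, do not intersect $\partial\Omega$. The weight $\phi>0$ is $\mathbb Z^d$-periodic on $\mathbb R^d\setminus\bigcup_z(z+T)$ with $c\,\mathrm{dist}(y,T)\le\phi(y)\le C\,\mathrm{dist}(y,T)$ on $Y$, $\phi\in C^{1,\alpha}(\overline{Y\setminus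 T})$; $\phi_\varepsilon(x)=\phi(x/\varepsilon)$. $W^{1,p}_{\phi_\varepsilon}(\Omega_\varepsilon)=\{v\in L^1_{loc}(\Omega_\varepsilon):\phi_\varepsilon v\in L^p,\ \phi_\varepsilon\nabla v\in L^p\}$, and $W^{1,p}_{\phi_\varepsilon,0}(\Omega_\varepsilon)$ is its subspace of functions vanishing on $\partial\Omega$. *)

theory Defs
  imports "HOL-Analysis.Analysis"
begin

definition cube_Y :: "'a::euclidean_space set" where
  "cube_Y = {x. \<forall>b\<in>Basis. \<bar>x \<bullet> b\<bar> < 1/2}"

definition int_lattice :: "'a::euclidean_space set" where
  "int_lattice = {z. \<forall>b\<in>Basis. z \<bullet> b \<in> \<int>}"

definition periodize :: "real \<Rightarrow> 'a::euclidean_space set \<Rightarrow> 'a set" where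
  "periodize eps A = (\<Union>z\<in>int_lattice. (\<lambda>y. eps *\<^sub>R (z + y)) ` A)"

text \<open>C^k functions on a set S (meant for open S), via partial derivatives.\<close>
fun Ck_on :: "nat \<Rightarrow> 'a::euclidean_space set \<Rightarrow> ('a \<Rightarrow> real) \<Rightarrow> bool" where
  "Ck_on 0 S f = continuous_on S f"
| "Ck_on (Suc k) S f =
     ((\<forall>x\<in>S. f differentiable (at x)) \<and>
      (\<forall>b\<in>Basis. Ck_on k S (\<lambda>x. frechet_derivative f (at x) b)))"

definition smooth_on :: "'a::euclidean_space set \<Rightarrow> ('a \<Rightarrow> real) \<Rightarrow> bool" where
  "smooth_on S f \<longleftrightarrow> (\<forall>k. Ck_on k S f)"

definition smooth_boundary :: "'a::euclidean_space set \<Rightarrow> bool" where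
  "smooth_boundary U \<longleftrightarrow>
     (\<forall>x\<in>frontier U. \<exists>r>0. \<exists>g. smooth_on (ball x r) g \<and>
        (\<forall>y\<in>ball x r. frechet_derivative g (at y) \<noteq> (\<lambda>v. 0)) \<and>
        U \<inter> ball x r = {y\<in>ball x r. g y < 0})"

definition lipschitz_domain :: "'a::euclidean_space set \<Rightarrow> bool" where
  "lipschitz_domain \<Omega> \<longleftrightarrow> open \<Omega> \<and> connected \<Omega> \<and> \<Omega> \<noteq> {} \<and>
     (\<forall>x\<in>frontier \<Omega>. \<exists>r>0. \<exists>e h L. norm e = 1 \<and>
        lipschitz_on L {v. v \<bullet> e = 0} h \<and>
        \<Omega> \<inter> ball x r = {y\<in>ball x r. y \<bullet> e < h (y - (y \<bullet> e) *\<^sub>R e)})"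

text \<open>C^{1,alpha}(closure S) for a bounded open S: C^1 on S, with f and Df bounded
  and Df uniformly alpha-Hoelder on S (hence extending to the closure).\<close>
definition C1_alpha_on :: "real \<Rightarrow> 'a::euclidean_space set \<Rightarrow> ('a \<Rightarrow> real) \<Rightarrow> bool" where
  "C1_alpha_on \<alpha> S f \<longleftrightarrow>
     (\<exists>Df M B. (\<forall>x\<in>S. (f has_derivative Df x) (at x)) \<and>
        bounded (f ` S) \<and> (\<forall>x\<in>S. onorm (Df x) \<le> B) \<and>
        (\<forall>x\<in>S. \<forall>y\<in>S. onorm (\<lambda>v. Df x v - Df y v) \<le> M * dist x y powr \<alpha>))"

definition test_fn :: "'a::euclidean_space set \<Rightarrow> ('a \<Rightarrow> real) \<Rightarrow> bool" where
  "test_fn U \<psi> \<longleftrightarrow> smooth_on UNIV \<psi> \<and> compact (closure (support_on UNIV \<psi>)) \<and>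
     closure (support_on UNIV \<psi>) \<subseteq> U"

definition loc_integrable ::
  "'a::euclidean_space set \<Rightarrow> ('a \<Rightarrow> 'b::{banach,second_countable_topology}) \<Rightarrow> bool" where
  "loc_integrable U f \<longleftrightarrow> (\<forall>K. compact K \<and> K \<subseteq> U \<longrightarrow> integrable (lebesgue_on K) f)"

definition weak_gradient :: "'a::euclidean_space set \<Rightarrow> ('a \<Rightarrow> real) \<Rightarrow> ('a \<Rightarrow> 'a) \<Rightarrow> bool" where
  "weak_gradient U v g \<longleftrightarrow> loc_integrable U v \<and> loc_integrable U g \<and>
     (\<forall>\<psi>. test_fn U \<psi> \<longrightarrow> (\<forall>b\<in>Basis.
        (LINT x|lebesgue. v x * frechet_derivative \<psi> (at x) b) =
        - (LINT x|lebesgue. (g x \<bullet> b) * \<psi> x)))"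

definition Lp_pow :: "real \<Rightarrow> 'a::euclidean_space set \<Rightarrow> ('a \<Rightarrow> real) \<Rightarrow> ennreal" where
  "Lp_pow p U f = (\<integral>\<^sup>+ x\<in>U. ennreal (\<bar>f x\<bar> powr p) \<partial>lebesgue)"

definition in_Lp :: "real \<Rightarrow> 'a::euclidean_space set \<Rightarrow> ('a \<Rightarrow> real) \<Rightarrow> bool" where
  "in_Lp p U f \<longleftrightarrow> f \<in> borel_measurable (lebesgue_on U) \<and> Lp_pow p U f < \<infinity>"

definition wsob :: "real \<Rightarrow> ('a::euclidean_space \<Rightarrow> real) \<Rightarrow> 'a set \<Rightarrow> ('a \<Rightarrow> real) \<Rightarrow> ('a \<Rightarrow> 'a) \<Rightarrow> bool" where
  "wsob p w U v g \<longleftrightarrow> weak_gradient U v g \<and>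
     in_Lp p U (\<lambda>x. w x * v x) \<and> in_Lp p U (\<lambda>x. w x * norm (g x))"

definition wsob0 :: "real \<Rightarrow> ('a::euclidean_space \<Rightarrow> real) \<Rightarrow> 'a set \<Rightarrow> 'a set \<Rightarrow>
    ('a \<Rightarrow> real) \<Rightarrow> ('a \<Rightarrow> 'a) \<Rightarrow> bool" where
  "wsob0 p w U B u g \<longleftrightarrow> wsob p w U u g \<and>
     (\<exists>vs hs. (\<forall>n. wsob p w U (vs n) (hs n) \<and>
                   (\<exists>N. open N \<and> B \<subseteq> N \<and> (\<forall>x\<in>U \<inter> N. vs n x = 0))) \<and>
        (\<lambda>n. Lp_pow p U (\<lambda>x. w x * (vs n x - u x))) \<longlonglongrightarrow> 0 \<and>
        (\<lambda>n. Lp_pow p U (\<lambda>x. w x * norm (hs n x - g x))) \<longlonglongrightarrow> 0)"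

end

theory Submission
  imports Defs
begin

text \<open>The proof integrates along segments and never uses an extension operator. A weak gradient \<open>h\<close> of
  \<open>v\<close> satisfies, for each vector \<open>w\<close> and almost every \<open>x\<close> whose segment to \<open>x + w\<close> avoids the holes,
  \<open>\<bar>v (x + w) - v x\<bar> \<le> \<integral>\<^sub>0\<^sup>1 \<bar>w\<bar> \<bar>h (x + t w)\<bar> dt\<close>; for functions that vanish near the outer boundary this
  survives extension by zero, and after rescaling by \<open>\<epsilon>\<close> everything takes place in one periodic set.

  If \<open>\<delta>\<close>, the distance from the holes, grows linearly along \<open>w\<close>, then by Hoelder's inequality with a
  power weight the \<open>L\<^sup>p\<close> norm on a set \<open>A\<close> is bounded by the one on \<open>A + w\<close> plus \<open>\<parallel>\<delta> h\<parallel>\<close>. This covers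
  both small translations away from the holes and the Hardy inequality at their smooth boundary, so by
  compactness and connectedness the norm on all of the perforated space is bounded by the norm on slabs
  around the cell walls. On the slabs, a single translation parallel to the wall, longer than the
  diameter of \<open>\<Omega>\<close>, gives the Poincare inequality. This needs dimension at least two, which is forced
  by the connectedness of the boundaries of the holes.\<close>

text \<open>Nothing is prescribed on the boundaries of the holes, so the Hardy estimate must run
  outward, from points near a hole to points at distance of order one from it. It can do so because
  the gradient carries the weight \<delta> to the power p, which lies above the critical exponent p
  - 1. This power is reached as (p - 1/2) + 1/2: Hoelder along the segment produces the first
  exponent together with a singularity \<delta> to the -1/2, and integrating that singularity along
  the backward orbit returns the second.

  The constant is uniform in \<epsilon> because the two halves scale differently. The passage to the
  slabs takes place in the unit cell and costs a fixed constant. The long translation has length of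
  order 1/\<epsilon> in rescaled variables and costs \<epsilon> to the -p, which the chain rule
  repays on the gradient.

  Convergence in the weighted space does not control the unweighted norm near the holes. Hence the
  full estimate is first proved for the approximating functions, and only then is the limit
  taken.\<close>

section \<open>Smooth bump functions\<close>

lemma Ck_on_SucI:
  assumes "\<And>x. (f has_derivative f' x) (at x)" "\<And>b. b \<in> Basis \<Longrightarrow> Ck_on k UNIV (\<lambda>x. f' x b)"
  shows "Ck_on (Suc k) UNIV f"
proof -
  have "frechet_derivative f (at x) = f' x" for x
    using frechet_derivative_at[OF assms(1)] by simp
  then show ?thesis
    using assms by (auto simp: differentiable_def)
qed

lemma Ck_on_has_derivative:
  assumes "Ck_on (Suc k) S f" "x \<in> S"
  shows "(f has_derivative frechet_derivative f (at x)) (at x)"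
  using assms by (auto simp: frechet_derivative_works[symmetric])

lemma Ck_on_lower: "Ck_on (Suc k) S f \<Longrightarrow> Ck_on k S f"
proof (induction k arbitrary: f)
  case 0
  then show ?case
    by (auto intro!: continuous_at_imp_continuous_on differentiable_imp_continuous_within)
next
  case (Suc k)
  then show ?case by simp
qed

lemma Ck_on_const: "Ck_on k UNIV (\<lambda>x. c)"
proof (induction k arbitrary: c)
  case (Suc k)
  then show ?case by (intro Ck_on_SucI[where f' = "\<lambda>x v. 0"]) auto
qed auto

lemma Ck_on_add: "Ck_on k UNIV f \<Longrightarrow> Ck_on k UNIV g \<Longrightarrow> Ck_on k UNIV (\<lambda>x. f x + g x)"
proof (induction k arbitrary: f g)
  case 0
  then show ?case by (auto intro: continuous_intros)
next
  case (Suc k)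
  show ?case
    by (rule Ck_on_SucI[where f' = "\<lambda>x v. frechet_derivative f (at x) v + frechet_derivative g (at x) v"])
      (use Suc in \<open>auto intro!: has_derivative_add Ck_on_has_derivative\<close>)
qed

lemma Ck_on_mult: "Ck_on k UNIV f \<Longrightarrow> Ck_on k UNIV g \<Longrightarrow> Ck_on k UNIV (\<lambda>x. f x * g x)"
proof (induction k arbitrary: f g)
  case 0
  then show ?case by (auto intro: continuous_intros)
next
  case (Suc k)
  have "Ck_on k UNIV (\<lambda>x. f x * frechet_derivative g (at x) b + frechet_derivative f (at x) b * g x)"
    if "b \<in> Basis" for b
    using Suc.prems that by (intro Ck_on_add Suc.IH) (auto intro: Ck_on_lower[of k _ f] Ck_on_lower[of k _ g])
  then show ?case
    by (intro Ck_on_SucI[where f' = "\<lambda>x v. f x * frechet_derivative g (at x) v + frechet_derivative f (at x) v * g x"])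
      (use Suc in \<open>auto intro!: has_derivative_mult Ck_on_has_derivative\<close>)
qed

lemma Ck_on_prod: "(\<And>i. i \<in> I \<Longrightarrow> Ck_on k UNIV (f i)) \<Longrightarrow> Ck_on k UNIV (\<lambda>x. \<Prod>i\<in>I. f i x)"
  by (induction I rule: infinite_finite_induct) (auto intro: Ck_on_const Ck_on_mult)

text \<open>Smoothness in one variable is carried as a tower \<open>D 0\<close>, \<open>D 1\<close>,
  ... of successive derivatives, so that the induction on \<open>k\<close> can pass from
  \<open>D n\<close> to \<open>D (Suc n)\<close>.\<close>

lemma Ck_on_compose_affine:
  fixes D :: "nat \<Rightarrow> real \<Rightarrow> real" and a :: "'a::euclidean_space"
  assumes "\<And>n t. (D n has_real_derivative D (Suc n) t) (at t)"
  shows "Ck_on k UNIV (\<lambda>x. D n (x \<bullet> a + c))"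
proof (induction k arbitrary: n)
  case 0
  have "continuous_on UNIV (D n)"
    using assms by (intro continuous_at_imp_continuous_on) (auto intro: DERIV_isCont)
  then have "continuous_on UNIV (\<lambda>x. D n (x \<bullet> a + c))"
    by (rule continuous_on_compose2) (intro continuous_intros, simp)
  then show ?case by simp
next
  case (Suc k)
  have "((\<lambda>x. D n (x \<bullet> a + c)) has_derivative (\<lambda>v. (v \<bullet> a) * D (Suc n) (x \<bullet> a + c))) (at x)" for x
    by (rule has_derivative_eq_rhs,
        rule DERIV_compose_FDERIV[where f = "D n" and g = "\<lambda>x. x \<bullet> a + c", OF assms])
      (auto intro!: derivative_eq_intros)
  then show ?case
    by (rule Ck_on_SucI) (auto intro!: Ck_on_mult Ck_on_const Suc)
qed

definition exp_bump :: "real \<Rightarrow> real" where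
  "exp_bump t = (if t > 0 then exp (- (1 / t)) else 0)"

lemma poly_exp_tendsto_0: "((\<lambda>s::real. poly q s / exp s) \<longlongrightarrow> 0) at_top"
proof -
  have "((\<lambda>s::real. \<Sum>i\<le>degree q. coeff q i * (s ^ i / exp s)) \<longlongrightarrow> (\<Sum>i\<le>degree q. coeff q i * 0)) at_top"
    by (intro tendsto_sum tendsto_mult tendsto_const tendsto_power_div_exp_0)
  then show ?thesis by (simp add: poly_altdef sum_divide_distrib)
qed

text \<open>The functions q(1/t) exp(-1/t), with q a polynomial, extended by 0 to t <= 0, are closed
  under differentiation: the chain rule turns q into X^2 (q - q'), and at 0 the substitution s = 1/t
  leaves a polynomial divided by \<open>exp s\<close>. Iteration from q = 1 gives all derivatives of
  \<open>exp_bump\<close>.\<close>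

lemma poly_exp_bump_deriv:
  fixes q :: "real poly"
  defines "F \<equiv> \<lambda>q t. if t > 0 then poly q (1 / t) * exp (- (1 / t)) else (0::real)"
  shows "(F q has_real_derivative F ([:0, 0, 1:] * (q - pderiv q)) t) (at t)"
proof (cases "t = 0")
  case False
  show ?thesis
  proof (cases "t > 0")
    case True
    have "((\<lambda>t. poly q (1 / t) * exp (- (1 / t))) has_real_derivative
        F ([:0, 0, 1:] * (q - pderiv q)) t) (at t)"
      unfolding F_def using True
      by (auto intro!: derivative_eq_intros poly_DERIV[THEN DERIV_chain2]
          simp: field_simps power2_eq_square)
    moreover have "\<forall>\<^sub>F x in nhds t. F q x = poly q (1 / x) * exp (- (1 / x))"
      using eventually_nhds_in_open[of "{0<..}" t] True by (auto simp: F_def elim: eventually_mono)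
    ultimately show ?thesis by (subst DERIV_cong_ev) auto
  next
    case f: False
    have "((\<lambda>t. 0) has_real_derivative F ([:0, 0, 1:] * (q - pderiv q)) t) (at t)"
      using f by (simp add: F_def)
    moreover have "\<forall>\<^sub>F x in nhds t. F q x = 0"
      using eventually_nhds_in_open[of "{..<0}" t] False f by (auto simp: F_def elim: eventually_mono)
    ultimately show ?thesis by (subst DERIV_cong_ev) auto
  qed
next
  case True
  \<comment> \<open>\<open>pCons 0 q\<close> is X q; the additional factor is the 1/h of the
    difference quotient.\<close>
  have "((\<lambda>s. poly (pCons 0 q) s / exp s) \<longlongrightarrow> 0) at_top"
    by (rule poly_exp_tendsto_0)
  then have "((\<lambda>h. poly (pCons 0 q) (inverse h) / exp (inverse h)) \<longlongrightarrow> 0) (at_right 0)"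
    by (rule filterlim_compose[OF _ filterlim_inverse_at_top_right])
  then have "((\<lambda>h. F q h / h) \<longlongrightarrow> 0) (at_right 0)"
    by (rule Lim_transform_eventually)
      (auto simp: F_def exp_minus divide_inverse eventually_at_filter)
  moreover have "((\<lambda>h. F q h / h) \<longlongrightarrow> 0) (at_left 0)"
    by (rule Lim_transform_eventually[of "\<lambda>h. 0"]) (auto simp: F_def eventually_at_filter)
  ultimately have "((\<lambda>h. F q h / h) \<longlongrightarrow> 0) (at 0)"
    by (rule filterlim_split_at_real[rotated])
  then show ?thesis
    unfolding DERIV_def using True by (auto simp: F_def cong: if_cong)
qed

lemma exp_bump_derivs:
  "\<exists>D. D 0 = exp_bump \<and> (\<forall>n t. (D n has_real_derivative D (Suc n) t) (at t))"
proof -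
  define F where "F = (\<lambda>q t. if t > 0 then poly q (1 / t) * exp (- (1 / t)) else (0::real))"
  define p where "p n = ((\<lambda>q. [:0, 0, 1:] * (q - pderiv q)) ^^ n) (1 :: real poly)" for n
  have "(F (p n) has_real_derivative F (p (Suc n)) t) (at t)" for n t
    using poly_exp_bump_deriv[of "p n" t] unfolding F_def p_def funpow.simps o_apply .
  moreover have "F (p 0) = exp_bump"
    by (auto simp: F_def p_def exp_bump_def)
  ultimately show ?thesis by (intro exI[of _ "\<lambda>n. F (p n)"]) auto
qed

text \<open>The factor \<open>n\<close> sharpens the bump: \<open>exp_bump (n * s)\<close> tends to
  1 for s > 0 and is 0 otherwise, so these smooth functions tend pointwise to the indicator of the
  open box and are dominated by 1.\<close>

definition box_bump :: "nat \<Rightarrow> 'a::euclidean_space \<Rightarrow> 'a \<Rightarrow> 'a \<Rightarrow> real" where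
  "box_bump n a b x =
     (\<Prod>i\<in>Basis. exp_bump (real n * (x \<bullet> i - a \<bullet> i)) * exp_bump (real n * (b \<bullet> i - x \<bullet> i)))"

lemma exp_bump_bounds: "0 \<le> exp_bump t" "exp_bump t \<le> 1"
  by (auto simp: exp_bump_def)

lemma box_bump_bounds: "0 \<le> box_bump n a b x" "box_bump n a b x \<le> 1"
  unfolding box_bump_def
  by (auto intro!: prod_nonneg prod_le_1 mult_nonneg_nonneg mult_le_one exp_bump_bounds)

lemma box_bump_eq_0: "x \<notin> box a b \<Longrightarrow> box_bump n a b x = 0"
  by (force simp: box_bump_def mem_box exp_bump_def zero_less_mult_iff)

lemma box_bump_shift: "box_bump n (a + w) (b + w) x = box_bump n a b (x - w)"
  by (simp add: box_bump_def inner_diff_left inner_add_left algebra_simps)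

lemma box_bump_tendsto: "(\<lambda>n. box_bump n a b x) \<longlonglongrightarrow> indicator (box a b) x"
proof (cases "x \<in> box a b")
  case True
  have *: "(\<lambda>n. exp_bump (real n * s)) \<longlonglongrightarrow> 1" if "s > 0" for s
  proof -
    have "(\<lambda>n. exp (- (1 / s * inverse (real n)))) \<longlonglongrightarrow> exp (- (1 / s * 0))"
      by (intro tendsto_intros lim_inverse_n)
    then have "(\<lambda>n. exp (- (1 / s * inverse (real n)))) \<longlonglongrightarrow> 1" by simp
    then show ?thesis
      by (rule Lim_transform_eventually)
        (use that in \<open>auto simp: exp_bump_def field_simps intro!: eventually_sequentiallyI[of 1]\<close>)
  qed
  have "(\<lambda>n. box_bump n a b x) \<longlonglongrightarrow> (\<Prod>i\<in>(Basis::'a set). 1 * 1)"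
    unfolding box_bump_def
    by (intro tendsto_prod tendsto_mult *) (use True in \<open>auto simp: mem_box\<close>)
  then show ?thesis using True by simp
qed (simp add: box_bump_eq_0)

lemma box_bump_Ck: "Ck_on k UNIV (box_bump n a b :: 'a::euclidean_space \<Rightarrow> real)"
proof -
  obtain D where D: "D 0 = exp_bump" "\<And>n t. (D n has_real_derivative D (Suc n) t) (at t)"
    using exp_bump_derivs by blast
  have eq: "box_bump n a b = (\<lambda>x. \<Prod>i\<in>Basis. D 0 (x \<bullet> (real n *\<^sub>R i) + (- real n * (a \<bullet> i))) *
      D 0 (x \<bullet> ((- real n) *\<^sub>R i) + real n * (b \<bullet> i)))"
    by (auto simp: box_bump_def D(1) algebra_simps)
  show ?thesis unfolding eq
    by (intro Ck_on_prod Ck_on_mult Ck_on_compose_affine D(2))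
qed

lemma box_bump_test_fn:
  assumes "cbox a b \<subseteq> U"
  shows "test_fn U (box_bump n a b)"
proof -
  have "closure (support_on UNIV (box_bump n a b)) \<subseteq> cbox a b"
    using box_subset_cbox[of a b]
    by (intro closure_minimal) (auto simp: support_on_def subset_iff intro: ccontr[of "_ \<in> cbox a b"] dest: box_bump_eq_0)
  then show ?thesis
    using assms bounded_subset[OF bounded_cbox]
    by (auto simp: test_fn_def smooth_on_def box_bump_Ck compact_eq_bounded_closed)
qed

section \<open>The fundamental lemma of the calculus of variations\<close>

text \<open>Boxes are an intersection-stable generator of the Borel sets. Hence the positive and the
  negative part of \<open>f\<close> on the box, used as densities, define the same finite measure
  and agree almost everywhere.\<close>

lemma AE_zero_if_box_integrals_zero:
  fixes f :: "'a::euclidean_space \<Rightarrow> real"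
  assumes f: "integrable lborel f"
    and box: "\<And>a b. cbox a b \<subseteq> cbox l r \<Longrightarrow> (LINT x|lborel. f x * indicator (box a b) x) = 0"
  shows "AE x in lborel. x \<in> box l r \<longrightarrow> f x = 0"
proof -
  have [measurable]: "f \<in> borel_measurable borel" using f by auto
  \<comment> \<open>Since \<open>ennreal\<close> truncates negative numbers to 0, \<open>p 1\<close>
    and \<open>p (-1)\<close> are the positive and the negative part of \<open>f\<close> on the
    box.\<close>
  define p where "p s x = ennreal (s * f x * indicator (box l r) x)" for s x
  have [measurable]: "p s \<in> borel_measurable lborel" for s unfolding p_def by measurable
  have fin: "(\<integral>\<^sup>+x. p s x \<partial>lborel) < \<infinity>" if "s \<in> {1, -1}" for s
  proof -
    have "(\<integral>\<^sup>+x. p s x \<partial>lborel) \<le> (\<integral>\<^sup>+x. ennreal (norm (f x)) \<partial>lborel)"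
      unfolding p_def using that
      by (intro nn_integral_mono ennreal_leI) (auto simp: indicator_def)
    also have "\<dots> < \<infinity>" using f by (simp add: integrable_iff_bounded)
    finally show ?thesis .
  qed
  have eqbox: "emeasure (density lborel (p 1)) X = emeasure (density lborel (p (-1))) X"
    if "X \<in> range (\<lambda>(a, b). box a b)" for X
  proof -
    from that obtain a b where X: "X = box a b" by auto
    obtain a' b' where int: "box a b \<inter> box l r = box a' b'"
      by (auto simp: box_Int_box)
    have zero: "(LINT x|lborel. f x * indicator (box a' b') x) = 0"
    proof (cases "box a' b' = {}")
      case False
      have "closure (box a' b') \<subseteq> closure (box l r)"
        using int by (intro closure_mono) auto
      moreover have "box l r \<noteq> {}" using int False by auto
      ultimately have "cbox a' b' \<subseteq> cbox l r"
        using False by (simp add: closure_box)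
      then show ?thesis by (rule box)
    qed simp
    have ib: "integrable lborel (\<lambda>x. f x * indicator (box a' b') x)"
      using integrable_mult_indicator[OF _ f, of "box a' b'"] by (simp add: mult.commute)
    have em: "emeasure (density lborel (p s)) X = (\<integral>\<^sup>+x. ennreal (s * (f x * indicator (box a' b') x)) \<partial>lborel)" for s
      unfolding X p_def using int[symmetric]
      by (subst emeasure_density) (auto intro!: nn_integral_cong simp: indicator_def p_def)
    define J where "J s = (\<integral>\<^sup>+x. ennreal (s * (f x * indicator (box a' b') x)) \<partial>lborel)" for s
    have en: "enn2real (J 1) = enn2real (J (-1))"
      using zero unfolding real_lebesgue_integral_def[OF ib] J_def by simp
    have fJ: "J s < top" if "s \<in> {1,-1}" for s
    proof -
      have "(\<integral>\<^sup>+x. ennreal (s * (f x * indicator (box a' b') x)) \<partial>lborel) \<le> (\<integral>\<^sup>+x. p s x \<partial>lborel)"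
        using int[symmetric] unfolding p_def
        by (intro nn_integral_mono) (auto simp: indicator_def)
      also have "\<dots> < top" using fin[OF that] by simp
      finally show ?thesis unfolding J_def .
    qed
    have "J 1 < top" "J (-1) < top" by (auto intro!: fJ)
    then have "J 1 = J (-1)" using en by (metis ennreal_enn2real)
    then show ?thesis unfolding em J_def .
  qed
  have "density lborel (p 1) = density lborel (p (-1))"
  proof (rule measure_eqI_generator_eq)
    let ?E = "range (\<lambda>(a, b). box a b :: 'a set)"
    show "Int_stable ?E"
      by (auto simp: Int_stable_def box_Int_box)
    show "?E \<subseteq> Pow UNIV" "sets (density lborel (p 1)) = sigma_sets UNIV ?E"
      "sets (density lborel (p (-1))) = sigma_sets UNIV ?E"
      by (simp_all add: borel_eq_box)
    let ?A = "\<lambda>n::nat. box (- (real n *\<^sub>R One)) (real n *\<^sub>R One) :: 'a set"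
    show "range ?A \<subseteq> ?E" "(\<Union>i. ?A i) = UNIV"
      unfolding UN_box_eq_UNIV by auto
    show "emeasure (density lborel (p 1)) (?A i) \<noteq> \<infinity>" for i
    proof -
      have "emeasure (density lborel (p 1)) (?A i) \<le> (\<integral>\<^sup>+x. p 1 x \<partial>lborel)"
        by (subst emeasure_density) (auto intro!: nn_integral_mono simp: indicator_def)
      then show ?thesis using fin[of 1] by (auto simp: top_unique)
    qed
  qed (rule eqbox)
  then have "AE x in lborel. p 1 x = p (-1) x"
    using fin[of 1] by (subst (asm) finite_density_unique) auto
  then show ?thesis
  proof eventually_elim
    case (elim x)
    show ?case
    proof
      assume "x \<in> box l r"
      \<comment> \<open>One of the two sides is 0 by truncation, hence so is the other.\<close>
      then have "ennreal (f x) = ennreal (- f x)" using elim by (simp add: p_def)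
      then show "f x = 0"
        by (smt (verit) ennreal_eq_0_iff)
    qed
  qed
qed

section \<open>Translation invariance of Lebesgue measure\<close>

lemma lborel_integral_shift:
  fixes f :: "'a::euclidean_space \<Rightarrow> 'b::{banach,second_countable_topology}"
  assumes [measurable]: "f \<in> borel_measurable borel"
  shows "(LINT x|lborel. f (x + w)) = (LINT x|lborel. f x)"
proof -
  have "(LINT x|lborel. f x) = (LINT x|distr lborel borel ((+) w). f x)"
    unfolding lborel_distr_plus ..
  also have "\<dots> = (LINT x|lborel. f (w + x))"
    by (subst integral_distr) auto
  finally show ?thesis by (simp add: add.commute)
qed

lemma nn_integral_lborel_shift:
  fixes f :: "'a::euclidean_space \<Rightarrow> ennreal"
  assumes [measurable]: "f \<in> borel_measurable borel"
  shows "(\<integral>\<^sup>+x. f (x + w) \<partial>lborel) = (\<integral>\<^sup>+x. f x \<partial>lborel)"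
proof -
  have "(\<integral>\<^sup>+x. f x \<partial>lborel) = (\<integral>\<^sup>+x. f x \<partial>distr lborel borel ((+) w))"
    unfolding lborel_distr_plus ..
  also have "\<dots> = (\<integral>\<^sup>+x. f (w + x) \<partial>lborel)"
    by (subst nn_integral_distr) auto
  finally show ?thesis by (simp add: add.commute)
qed

lemma lborel_integrable_shift:
  fixes f :: "'a::euclidean_space \<Rightarrow> 'b::{banach,second_countable_topology}"
  assumes "integrable lborel f"
  shows "integrable lborel (\<lambda>x. f (x + w))"
proof -
  have "integrable (distr lborel borel ((+) w)) f" using assms unfolding lborel_distr_plus .
  then have "integrable lborel (\<lambda>x. f (w + x))" by (subst (asm) integrable_distr_eq) (use assms in auto)
  then show ?thesis by (simp add: add.commute)
qed

lemma AE_lborel_shift: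
  fixes Q :: "'a::euclidean_space \<Rightarrow> bool"
  assumes "AE x in lborel. Q x"
  shows "AE x in lborel. Q (x + w)"
proof -
  have "AE x in distr lborel borel ((+) w). Q x" using assms unfolding lborel_distr_plus .
  then have "AE x in lborel. Q (w + x)" by (rule AE_distrD[rotated]) simp
  then show ?thesis by (simp add: add.commute)
qed

section \<open>Weak gradients along segments\<close>

text \<open>This supplies the integrability for Fubini: translation invariance makes the inner norm
  the same for every t, and t ranges over an interval of length 1.\<close>

lemma integrable_segment_product:
  fixes f :: "'a::euclidean_space \<Rightarrow> real" and b :: "real \<Rightarrow> 'a \<Rightarrow> real"
  assumes f: "integrable lborel f" and [measurable]: "(\<lambda>(t, x). b t x) \<in> borel_measurable (lborel \<Otimes>\<^sub>M lborel)"
    and b: "\<And>t x. \<bar>b t x\<bar> \<le> B"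
  shows "integrable (lborel \<Otimes>\<^sub>M lborel) (\<lambda>(t::real, x). f (x + t *\<^sub>R a) * b t x * indicator {0..1} t)"
proof (rule integrableI_bounded)
  have [measurable]: "f \<in> borel_measurable borel" using f by auto
  show "(\<lambda>(t, x). f (x + t *\<^sub>R a) * b t x * indicator {0..1} t) \<in> borel_measurable (lborel \<Otimes>\<^sub>M lborel)"
    by measurable
  have B: "B \<ge> 0" using b[of 0 0] by linarith
  have "(\<integral>\<^sup>+tx. norm (case tx of (t, x) \<Rightarrow> f (x + t *\<^sub>R a) * b t x * indicator {0..1} t) \<partial>(lborel \<Otimes>\<^sub>M lborel))
    \<le> (\<integral>\<^sup>+tx. ennreal \<bar>f (snd tx + fst tx *\<^sub>R a)\<bar> * (ennreal B * indicator {0..1} (fst tx)) \<partial>(lborel \<Otimes>\<^sub>M lborel))"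
    using b B by (intro nn_integral_mono)
      (auto simp: indicator_def abs_mult ennreal_mult[symmetric] intro!: ennreal_leI mult_left_mono)
  also have "\<dots> = (\<integral>\<^sup>+t. (\<integral>\<^sup>+x. ennreal \<bar>f (x + t *\<^sub>R a)\<bar> * (ennreal B * indicator {0..1} t) \<partial>lborel) \<partial>lborel)"
    by (subst lborel.nn_integral_fst[symmetric]) auto
  also have "\<dots> = (\<integral>\<^sup>+x. ennreal \<bar>f x\<bar> \<partial>lborel) * ennreal B"
    using nn_integral_lborel_shift[of "\<lambda>x. ennreal \<bar>f x\<bar>"]
    by (simp add: nn_integral_multc nn_integral_cmult mult.assoc)
  also have "\<dots> < \<infinity>" using f by (simp add: ennreal_mult_less_top integrable_iff_bounded)
  finally show "(\<integral>\<^sup>+tx. norm (case tx of (t, x) \<Rightarrow> f (x + t *\<^sub>R a) * b t x * indicator {0..1} t) \<partial>(lborel \<Otimes>\<^sub>M lborel)) < \<infinity>" .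
qed

text \<open>Translation invariance moves the increment from \<open>v\<close> to the test function,
  where the fundamental theorem of calculus applies; the weak identity for the shifted test
  functions and Fubini carry the result back. Here \<open>s\<close> stands for the component of the
  weak gradient along \<open>w\<close>.\<close>

lemma weak_identity_along_segment:
  fixes v s :: "'a::euclidean_space \<Rightarrow> real"
  assumes v: "integrable lborel v" and s: "integrable lborel s"
    and \<psi>: "\<And>x. (\<psi> has_derivative D x) (at x)" "\<And>x. \<bar>\<psi> x\<bar> \<le> B"
    and D: "continuous_on UNIV (\<lambda>x. D x w)" "\<And>x. \<bar>D x w\<bar> \<le> B"
    and weak: "\<And>t. t \<in> {0..1} \<Longrightarrow>
      (LINT x|lborel. v x * D (x - t *\<^sub>R w) w) = - (LINT x|lborel. s x * \<psi> (x - t *\<^sub>R w))"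
  shows "(LINT x|lborel. (v (x + w) - v x) * \<psi> x) =
    (LINT x|lborel. \<psi> x * (LINT t|lborel. indicator {0..1} t * s (x + t *\<^sub>R w)))"
proof -
  have [measurable]: "v \<in> borel_measurable borel" "s \<in> borel_measurable borel" using v s by auto
  have "continuous_on UNIV \<psi>"
    by (intro continuous_at_imp_continuous_on ballI has_derivative_continuous[OF \<psi>(1)])
  then have [measurable]: "\<psi> \<in> borel_measurable borel" by (rule borel_measurable_continuous_onI)
  define d where "d x = D x w" for x
  have [measurable]: "d \<in> borel_measurable borel"
    unfolding d_def using D(1) by (rule borel_measurable_continuous_onI)
  have B: "B \<ge> 0" using \<psi>(2)[of 0] by linarith
  have bounded_mult: "integrable lborel (\<lambda>x. f x * \<psi> (x - y))" if "integrable lborel f" for f y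
    by (rule Bochner_Integration.integrable_bound[OF integrable_mult_left[OF that, of B]])
      (use that \<psi>(2) B in \<open>auto simp: abs_mult intro!: mult_left_mono\<close>)
  have ftc: "(LINT t|lborel. d (x - t *\<^sub>R w) * indicator {0..1} t) = \<psi> x - \<psi> (x - w)" for x
  proof -
    have "(LINT t|lborel. - d (x - t *\<^sub>R w) * indicator {0..1} t) = \<psi> (x - 1 *\<^sub>R w) - \<psi> (x - 0 *\<^sub>R w)"
    proof (rule integral_FTC_Icc_real)
      fix t :: real
      have hd: "((\<lambda>t. \<psi> (x - t *\<^sub>R w)) has_derivative (\<lambda>h. D (x - t *\<^sub>R w) (- (h *\<^sub>R w)))) (at t)"
        by (rule has_derivative_compose[where g = \<psi>, OF _ \<psi>(1)]) (auto intro!: derivative_eq_intros)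
      have "D (x - t *\<^sub>R w) (- (h *\<^sub>R w)) = h * - d (x - t *\<^sub>R w)" for h
        using has_derivative_linear[OF \<psi>(1)] by (simp add: linear_neg linear_cmul d_def)
      then show "((\<lambda>t. \<psi> (x - t *\<^sub>R w)) has_real_derivative - d (x - t *\<^sub>R w)) (at t)"
        unfolding has_field_derivative_def by (intro has_derivative_eq_rhs[OF hd]) (auto simp: fun_eq_iff)
      have "continuous_on UNIV (\<lambda>t. - d (x - t *\<^sub>R w))"
        unfolding d_def by (intro continuous_on_minus continuous_on_compose2[OF D(1)] continuous_intros) auto
      then show "isCont (\<lambda>t. - d (x - t *\<^sub>R w)) t"
        by (simp add: continuous_on_eq_continuous_at)
    qed simp
    then show ?thesis by simp
  qed
  have int1: "integrable (lborel \<Otimes>\<^sub>M lborel) (\<lambda>(t::real, x). v x * d (x - t *\<^sub>R w) * indicator {0..1} t)"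
  proof -
    have "(\<lambda>(t, x). d (x - t *\<^sub>R w)) \<in> borel_measurable (lborel \<Otimes>\<^sub>M lborel)" by measurable
    from integrable_segment_product[OF v this, of B 0] show ?thesis using D(2) by (simp add: d_def)
  qed
  have int2: "integrable (lborel \<Otimes>\<^sub>M lborel) (\<lambda>(t::real, x). s (x + t *\<^sub>R w) * \<psi> x * indicator {0..1} t)"
    using integrable_segment_product[OF s, of "\<lambda>t x. \<psi> x" B w] \<psi>(2) by simp
  have "(LINT x|lborel. (v (x + w) - v x) * \<psi> x) =
      (LINT x|lborel. v (x + w) * \<psi> x) - (LINT x|lborel. v x * \<psi> x)"
    using bounded_mult[of "\<lambda>x. v (x + w)" 0] bounded_mult[OF v, of 0] lborel_integrable_shift[OF v]
    by (simp add: left_diff_distrib)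
  also have "(LINT x|lborel. v (x + w) * \<psi> x) = (LINT x|lborel. v x * \<psi> (x - w))"
    using lborel_integral_shift[of "\<lambda>x. v x * \<psi> (x - w)" w] by simp
  also have "\<dots> - (LINT x|lborel. v x * \<psi> x) = (LINT x|lborel. v x * \<psi> (x - w) - v x * \<psi> x)"
    using bounded_mult[OF v, of 0] bounded_mult[OF v, of w] by simp
  also have "\<dots> = - (LINT x|lborel. (LINT t|lborel. v x * d (x - t *\<^sub>R w) * indicator {0..1} t))"
  proof (subst integral_minus[symmetric], intro Bochner_Integration.integral_cong refl)
    fix x
    have "(LINT t|lborel. v x * d (x - t *\<^sub>R w) * indicator {0..1} t) = v x * (\<psi> x - \<psi> (x - w))"
      using ftc[of x] by (simp add: mult.assoc)
    then show "v x * \<psi> (x - w) - v x * \<psi> x = - (LINT t|lborel. v x * d (x - t *\<^sub>R w) * indicator {0..1} t)"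
      by (simp add: algebra_simps)
  qed
  also have "\<dots> = - (LINT t|lborel. (LINT x|lborel. v x * d (x - t *\<^sub>R w) * indicator {0..1} t))"
    using lborel_pair.Fubini_integral[OF int1] by simp
  also have "\<dots> = (LINT t|lborel. (LINT x|lborel. s (x + t *\<^sub>R w) * \<psi> x * indicator {0..1} t))"
  proof (subst integral_minus[symmetric], intro Bochner_Integration.integral_cong refl)
    fix t :: real
    have "(LINT x|lborel. s x * \<psi> (x - t *\<^sub>R w)) = (LINT x|lborel. s (x + t *\<^sub>R w) * \<psi> x)"
      using lborel_integral_shift[of "\<lambda>x. s x * \<psi> (x - t *\<^sub>R w)" "t *\<^sub>R w"] by simp
    then show "- (LINT x|lborel. v x * d (x - t *\<^sub>R w) * indicator {0..1} t) =
      (LINT x|lborel. s (x + t *\<^sub>R w) * \<psi> x * indicator {0..1} t)"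
      using weak[of t] by (cases "t \<in> {0..1}") (auto simp: d_def)
  qed
  also have "\<dots> = (LINT x|lborel. (LINT t|lborel. s (x + t *\<^sub>R w) * \<psi> x * indicator {0..1} t))"
    using lborel_pair.Fubini_integral[OF int2] by simp
  also have "\<dots> = (LINT x|lborel. \<psi> x * (LINT t|lborel. indicator {0..1} t * s (x + t *\<^sub>R w)))"
  proof (intro Bochner_Integration.integral_cong refl)
    fix x
    show "(LINT t|lborel. s (x + t *\<^sub>R w) * \<psi> x * indicator {0..1} t) =
      \<psi> x * (LINT t|lborel. indicator {0..1} t * s (x + t *\<^sub>R w))"
      unfolding integral_mult_right_zero[symmetric] by (simp only: mult_ac)
  qed
  finally show ?thesis .
qed

lemma box_bump_abs_le: "\<bar>box_bump n a b x\<bar> \<le> 1"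
  using box_bump_bounds[of n a b x] by simp

lemma box_bump_eq_0_cbox: "x \<notin> cbox a b \<Longrightarrow> box_bump n a b x = 0"
  using box_bump_eq_0 box_subset_cbox by blast

lemma linear_real_basis_expansion:
  fixes f :: "'a::euclidean_space \<Rightarrow> real"
  assumes "linear f"
  shows "f w = (\<Sum>i\<in>Basis. (w \<bullet> i) * f i)"
proof -
  have "f w = f (\<Sum>i\<in>Basis. (w \<bullet> i) *\<^sub>R i)" by (simp add: euclidean_representation)
  also have "\<dots> = (\<Sum>i\<in>Basis. (w \<bullet> i) * f i)"
    by (simp add: linear_sum[OF assms] linear_cmul[OF assms])
  finally show ?thesis .
qed

lemma box_bump_has_derivative:
  "(box_bump n a b has_derivative frechet_derivative (box_bump n a b) (at x)) (at x)"
  by (rule Ck_on_has_derivative[OF box_bump_Ck]) simp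

lemma box_bump_deriv_eq_0:
  assumes "x \<notin> cbox a b"
  shows "frechet_derivative (box_bump n a b) (at x) = (\<lambda>v. 0)"
proof -
  have "\<forall>\<^sub>F y in at x. y \<in> - cbox a b"
    using assms by (intro eventually_at_in_open') auto
  then have ev: "\<forall>\<^sub>F y in at x. 0 = box_bump n a b y"
    by (auto simp: box_bump_eq_0_cbox elim!: eventually_mono)
  have "((\<lambda>y. 0) has_derivative (\<lambda>v. 0)) (at x)" by simp
  then have "(box_bump n a b has_derivative (\<lambda>v. 0)) (at x)"
    by (rule has_derivative_transform_eventually[OF _ ev])
      (use assms in \<open>auto simp: box_bump_eq_0_cbox\<close>)
  then show ?thesis by (metis frechet_derivative_at)
qed

lemma box_bump_deriv_continuous:
  "continuous_on UNIV (\<lambda>x. frechet_derivative (box_bump n a b) (at x) w)"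
proof -
  have eq: "frechet_derivative (box_bump n a b) (at x) w =
      (\<Sum>i\<in>Basis. (w \<bullet> i) * frechet_derivative (box_bump n a b) (at x) i)" for x
    by (rule linear_real_basis_expansion[OF has_derivative_linear[OF box_bump_has_derivative]])
  have "continuous_on UNIV (\<lambda>x. frechet_derivative (box_bump n a b) (at x) i)" if "i \<in> Basis" for i
    using box_bump_Ck[of "Suc 0" n a b] that by simp
  then show ?thesis unfolding eq by (intro continuous_intros)
qed

lemma box_bump_deriv_bounded:
  "\<exists>B. \<forall>x. \<bar>frechet_derivative (box_bump n a b) (at x) w\<bar> \<le> B"
proof -
  have "bounded ((\<lambda>x. frechet_derivative (box_bump n a b) (at x) w) ` cbox a b)"
    by (intro compact_imp_bounded compact_continuous_image
        continuous_on_subset[OF box_bump_deriv_continuous]) auto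
  then obtain B where B: "\<And>x. x \<in> cbox a b \<Longrightarrow> \<bar>frechet_derivative (box_bump n a b) (at x) w\<bar> \<le> B"
    by (auto simp: bounded_iff)
  have "\<bar>frechet_derivative (box_bump n a b) (at x) w\<bar> \<le> max B 0" for x
    using B[of x] box_bump_deriv_eq_0[of x a b n] by (cases "x \<in> cbox a b") auto
  then show ?thesis by blast
qed

lemma box_bump_measurable [measurable]: "box_bump n a b \<in> borel_measurable borel"
  using box_bump_Ck[of 0 n a b] by (intro borel_measurable_continuous_onI) simp

text \<open>Stated in \<open>ennreal\<close>, so that a line on which \<open>k\<close> is not
  integrable satisfies it trivially.\<close>

abbreviation segment_bound :: "('a::euclidean_space \<Rightarrow> real) \<Rightarrow> ('a \<Rightarrow> real) \<Rightarrow> 'a \<Rightarrow> 'a \<Rightarrow> bool" where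
  "segment_bound v k x w \<equiv>
     ennreal \<bar>v (x + w) - v x\<bar> \<le> (\<integral>\<^sup>+t\<in>{0..1}. ennreal (norm w * k (x + t *\<^sub>R w)) \<partial>lborel)"

text \<open>\<open>k\<close> acts as an upper gradient on straight segments: only the norm of a weak
  gradient survives. The exceptional null set may depend on \<open>w\<close>, since the fundamental
  lemma is applied to one direction at a time.\<close>

definition line_bounded :: "'a::euclidean_space set \<Rightarrow> ('a \<Rightarrow> real) \<Rightarrow> ('a \<Rightarrow> real) \<Rightarrow> bool" where
  "line_bounded W v k \<longleftrightarrow> v \<in> borel_measurable borel \<and> k \<in> borel_measurable borel \<and> (\<forall>x. 0 \<le> k x) \<and>
     (\<forall>w. AE x in lborel. closed_segment x (x + w) \<subseteq> W \<longrightarrow>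
        segment_bound v k x w)"

text \<open>On a box of starting points all segments sweep a compact subset of \<open>U\<close>.
  Testing against translates of one bump gives the integrated form of the fundamental theorem of
  calculus, and the arbitrariness of the bump makes it hold almost everywhere.\<close>

lemma weak_gradient_box_line_bound:
  fixes v :: "'a::euclidean_space \<Rightarrow> real" and h :: "'a \<Rightarrow> 'a"
  assumes [measurable]: "v \<in> borel_measurable borel" "h \<in> borel_measurable borel"
    and loc: "\<And>K. compact K \<Longrightarrow> K \<subseteq> U \<Longrightarrow> integrable lborel (\<lambda>x. indicator K x * v x)"
      "\<And>K. compact K \<Longrightarrow> K \<subseteq> U \<Longrightarrow> integrable lborel (\<lambda>x. indicator K x *\<^sub>R h x)"
    and weak: "\<And>\<psi> b. test_fn U \<psi> \<Longrightarrow> b \<in> Basis \<Longrightarrow>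
      (LINT x|lborel. v x * frechet_derivative \<psi> (at x) b) = - (LINT x|lborel. (h x \<bullet> b) * \<psi> x)"
    and lr: "\<And>x. x \<in> cbox l r \<Longrightarrow> closed_segment x (x + w) \<subseteq> U"
  shows "AE x in lborel. x \<in> box l r \<longrightarrow>
    segment_bound v (\<lambda>x. norm (h x)) x w"
proof -
  \<comment> \<open>The swept compact set. Cutting \<open>v\<close> and \<open>h\<close> to it makes
    them integrable on the whole space and keeps all values on the segments.\<close>
  define K where "K = (\<lambda>(x, t). x + t *\<^sub>R w) ` (cbox l r \<times> {0..1::real})"
  have K: "compact K"
    unfolding K_def case_prod_beta by (intro compact_continuous_image continuous_intros compact_Times) auto
  then have [measurable]: "K \<in> sets borel" by (simp add: borel_compact)
  have KI: "x + t *\<^sub>R w \<in> K" if "x \<in> cbox l r" "t \<in> {0..1}" for x t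
    using that by (force simp: K_def)
  have KU: "K \<subseteq> U"
  proof
    fix y assume "y \<in> K"
    then obtain x t where xt: "x \<in> cbox l r" "t \<in> {0..1}" "y = x + t *\<^sub>R w" by (auto simp: K_def)
    then have "y \<in> closed_segment x (x + w)"
      by (auto simp: in_segment algebra_simps intro!: exI[of _ t])
    then show "y \<in> U" using lr[OF xt(1)] by auto
  qed
  define vK where "vK x = indicator K x * v x" for x
  define hK where "hK x = indicator K x *\<^sub>R h x" for x
  define s where "s x = hK x \<bullet> w" for x
  have iv: "integrable lborel vK" unfolding vK_def by (rule loc(1)[OF K KU])
  have ih: "integrable lborel hK" unfolding hK_def by (rule loc(2)[OF K KU])
  have is_s: "integrable lborel s" unfolding s_def using ih by simp
  have [measurable]: "vK \<in> borel_measurable borel" "s \<in> borel_measurable borel" using iv is_s by auto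
  \<comment> \<open>The defect in the fundamental theorem of calculus along the segment; it is shown
    to vanish almost everywhere on the box.\<close>
  define f where "f x = vK (x + w) - vK x - (LINT t|lborel. indicator {0..1} t * s (x + t *\<^sub>R w))" for x
  have iL: "integrable lborel (\<lambda>x. LINT t|lborel. indicator {0..1::real} t * s (x + t *\<^sub>R w))"
    using lborel_pair.integrable_snd[OF integrable_segment_product[OF is_s, of "\<lambda>t x. 1" 1 w]]
    by (simp add: mult.commute)
  have if_f: "integrable lborel f"
    unfolding f_def using lborel_integrable_shift[OF iv] iv iL by simp
  then have [measurable]: "f \<in> borel_measurable borel" by auto
  have bump_mult: "integrable lborel (\<lambda>x. g x * box_bump n a b (x - y))" if "integrable lborel g"
    for g :: "'a \<Rightarrow> real" and n a b y
    by (rule Bochner_Integration.integrable_bound[OF that])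
      (use that box_bump_bounds in \<open>auto simp: abs_mult intro!: mult_left_le box_bump_abs_le\<close>)
  have "AE x in lborel. x \<in> box l r \<longrightarrow> f x = 0"
  proof (rule AE_zero_if_box_integrals_zero[OF if_f])
    fix a b assume ab: "cbox a b \<subseteq> cbox l r"
    have zero: "(LINT x|lborel. f x * box_bump n a b x) = 0" for n
    proof -
      let ?\<psi> = "box_bump n a b"
      let ?D = "\<lambda>x. frechet_derivative ?\<psi> (at x)"
      have "\<exists>B. \<forall>x. \<bar>?D x c\<bar> \<le> B" for c by (rule box_bump_deriv_bounded)
      then obtain B where B: "\<And>c x. \<bar>?D x c\<bar> \<le> B c" by metis
      have D_borel [measurable]: "(\<lambda>x. ?D x c) \<in> borel_measurable borel" for c
        by (intro borel_measurable_continuous_onI box_bump_deriv_continuous)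
      have seg: "(LINT x|lborel. vK x * ?D (x - t *\<^sub>R w) w) = - (LINT x|lborel. s x * ?\<psi> (x - t *\<^sub>R w))"
        if t: "t \<in> {0..1}" for t
      proof -
        \<comment> \<open>A translated bump is again a box bump, and its closed box lies in
          \<open>K\<close>, hence in \<open>U\<close>; so it is an admissible test function.\<close>
        let ?\<psi>t = "box_bump n (a + t *\<^sub>R w) (b + t *\<^sub>R w)"
        have sub: "x - t *\<^sub>R w \<in> cbox a b \<Longrightarrow> x \<in> K" for x
          using KI[of "x - t *\<^sub>R w" t] ab t by auto
        have "cbox (a + t *\<^sub>R w) (b + t *\<^sub>R w) \<subseteq> U"
        proof
          fix x assume "x \<in> cbox (a + t *\<^sub>R w) (b + t *\<^sub>R w)"
          then have "x - t *\<^sub>R w \<in> cbox a b"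
            by (auto simp: mem_box inner_diff_left inner_add_left algebra_simps)
          then show "x \<in> U" using sub KU by auto
        qed
        then have test: "test_fn U ?\<psi>t" by (rule box_bump_test_fn)
        have Dt: "frechet_derivative ?\<psi>t (at x) = ?D (x - t *\<^sub>R w)" for x
        proof -
          have "((\<lambda>x. ?\<psi> (x - t *\<^sub>R w)) has_derivative (\<lambda>h. ?D (x - t *\<^sub>R w) h)) (at x)"
            by (rule has_derivative_compose[where g = ?\<psi>, OF _ box_bump_has_derivative])
              (auto intro!: derivative_eq_intros)
          then show ?thesis
            unfolding box_bump_shift[symmetric] by (metis frechet_derivative_at eta_contract_eq)
        qed
        have i1: "integrable lborel (\<lambda>x. vK x * ?D (x - t *\<^sub>R w) i)" for i
          by (rule Bochner_Integration.integrable_bound[OF integrable_mult_left[OF iv, of "B i"]])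
            (auto simp: abs_mult intro!: mult_left_mono order_trans[OF B abs_ge_self])
        \<comment> \<open>The weak identity is given in basis directions only, so the derivative
          along \<open>w\<close> is expanded.\<close>
        have "?D y w = (\<Sum>i\<in>Basis. (w \<bullet> i) * ?D y i)" for y
          by (rule linear_real_basis_expansion[OF has_derivative_linear[OF box_bump_has_derivative]])
        then have "(LINT x|lborel. vK x * ?D (x - t *\<^sub>R w) w) =
          (LINT x|lborel. (\<Sum>i\<in>Basis. (w \<bullet> i) * (vK x * ?D (x - t *\<^sub>R w) i)))"
          by (simp add: sum_distrib_left mult_ac)
        also have "\<dots> = (\<Sum>i\<in>Basis. (w \<bullet> i) * (LINT x|lborel. vK x * ?D (x - t *\<^sub>R w) i))"
          using i1 by simp
        also have "\<dots> = (\<Sum>i\<in>Basis. (w \<bullet> i) * - (LINT x|lborel. (hK x \<bullet> i) * ?\<psi> (x - t *\<^sub>R w)))"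
        proof (intro sum.cong refl arg_cong2[where f = "(*)"])
          fix i :: 'a assume i: "i \<in> Basis"
          have "(LINT x|lborel. vK x * ?D (x - t *\<^sub>R w) i) = (LINT x|lborel. v x * frechet_derivative ?\<psi>t (at x) i)"
          proof (intro Bochner_Integration.integral_cong refl)
            fix x
            show "vK x * ?D (x - t *\<^sub>R w) i = v x * frechet_derivative ?\<psi>t (at x) i"
              unfolding Dt using sub[of x] box_bump_deriv_eq_0[of "x - t *\<^sub>R w" a b n]
              by (cases "x \<in> K"; cases "x - t *\<^sub>R w \<in> cbox a b") (auto simp: vK_def)
          qed
          also have "\<dots> = - (LINT x|lborel. (h x \<bullet> i) * ?\<psi>t x)"
            by (rule weak[OF test i])
          also have "(LINT x|lborel. (h x \<bullet> i) * ?\<psi>t x) = (LINT x|lborel. (hK x \<bullet> i) * ?\<psi> (x - t *\<^sub>R w))"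
          proof (intro Bochner_Integration.integral_cong refl)
            fix x
            show "(h x \<bullet> i) * ?\<psi>t x = (hK x \<bullet> i) * ?\<psi> (x - t *\<^sub>R w)"
              unfolding box_bump_shift
              using sub[of x] box_bump_eq_0[of "x - t *\<^sub>R w" a b n] box_subset_cbox[of a b]
              by (cases "x \<in> K") (auto simp: hK_def)
          qed
          finally show "(LINT x|lborel. vK x * ?D (x - t *\<^sub>R w) i) = - (LINT x|lborel. (hK x \<bullet> i) * ?\<psi> (x - t *\<^sub>R w))" .
        qed
        also have "\<dots> = - (LINT x|lborel. (\<Sum>i\<in>Basis. (w \<bullet> i) * ((hK x \<bullet> i) * ?\<psi> (x - t *\<^sub>R w))))"
          using bump_mult[of "\<lambda>x. hK x \<bullet> _"] ih by (simp add: sum_negf)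
        also have "(\<lambda>x. \<Sum>i\<in>Basis. (w \<bullet> i) * ((hK x \<bullet> i) * ?\<psi> (x - t *\<^sub>R w))) = (\<lambda>x. s x * ?\<psi> (x - t *\<^sub>R w))"
          unfolding s_def euclidean_inner[of "hK _" w] by (auto simp: sum_distrib_left sum_distrib_right mult_ac)
        finally show ?thesis .
      qed
      have "(LINT x|lborel. (vK (x + w) - vK x) * ?\<psi> x) =
        (LINT x|lborel. ?\<psi> x * (LINT t|lborel. indicator {0..1} t * s (x + t *\<^sub>R w)))"
        by (rule weak_identity_along_segment[OF iv is_s box_bump_has_derivative _ box_bump_deriv_continuous,
              where B = "max 1 (B w)"])
          (use box_bump_bounds[of n a b] B[of _ w] seg in \<open>auto simp: le_max_iff_disj\<close>)
      moreover have "(LINT x|lborel. f x * ?\<psi> x) = (LINT x|lborel. (vK (x + w) - vK x) * ?\<psi> x) -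
        (LINT x|lborel. ?\<psi> x * (LINT t|lborel. indicator {0..1} t * s (x + t *\<^sub>R w)))"
      proof (subst Bochner_Integration.integral_diff[symmetric])
        show "integrable lborel (\<lambda>x. (vK (x + w) - vK x) * ?\<psi> x)"
          using bump_mult[of "\<lambda>x. vK (x + w) - vK x" n a b 0] lborel_integrable_shift[OF iv] iv by simp
        show "integrable lborel (\<lambda>x. ?\<psi> x * (LINT t|lborel. indicator {0..1} t * s (x + t *\<^sub>R w)))"
          using bump_mult[OF iL, of n a b 0] by (simp add: mult.commute)
      qed (simp add: f_def algebra_simps)
      ultimately show ?thesis by simp
    qed
    \<comment> \<open>The smooth bumps give way to the indicator of the box by dominated
      convergence, which is the form that the fundamental lemma asks for.\<close>
    have "(\<lambda>n. LINT x|lborel. f x * box_bump n a b x) \<longlonglongrightarrow> (LINT x|lborel. f x * indicator (box a b) x)"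
      by (rule integral_dominated_convergence[where w = "\<lambda>x. \<bar>f x\<bar>"])
        (use if_f box_bump_bounds in \<open>auto simp: abs_mult intro!: tendsto_mult box_bump_tendsto mult_left_le box_bump_abs_le\<close>)
    then show "(LINT x|lborel. f x * indicator (box a b) x) = 0"
      unfolding zero by (metis LIMSEQ_unique tendsto_const)
  qed
  then show ?thesis
  proof eventually_elim
    case (elim x)
    show ?case
    proof
      assume x: "x \<in> box l r"
      then have xc: "x \<in> cbox l r" using box_subset_cbox by blast
      have "v (x + w) - v x = vK (x + w) - vK x"
        using KI[OF xc, of 0] KI[OF xc, of 1] by (simp add: vK_def)
      also have "\<dots> = (LINT t|lborel. indicator {0..1} t * s (x + t *\<^sub>R w))"
        using elim x by (simp add: f_def)
      finally have "ennreal \<bar>v (x + w) - v x\<bar> = ennreal \<bar>LINT t|lborel. indicator {0..1::real} t * s (x + t *\<^sub>R w)\<bar>"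
        by simp
      \<comment> \<open>If the integrand along the line is not integrable, its Bochner integral is 0
        by convention and the inequality is trivial.\<close>
      also have "\<dots> \<le> (\<integral>\<^sup>+t. ennreal \<bar>indicator {0..1::real} t * s (x + t *\<^sub>R w)\<bar> \<partial>lborel)"
        using integral_norm_bound_ennreal[of lborel "\<lambda>t. indicator {0..1::real} t * s (x + t *\<^sub>R w)"]
        by (cases "integrable lborel (\<lambda>t. indicator {0..1::real} t * s (x + t *\<^sub>R w))")
          (auto simp: not_integrable_integral_eq)
      also have "\<dots> \<le> (\<integral>\<^sup>+t\<in>{0..1}. ennreal (norm w * norm (h (x + t *\<^sub>R w))) \<partial>lborel)"
        using KI[OF xc] Cauchy_Schwarz_ineq2[of "h _" w]
        by (intro nn_integral_mono) (auto simp: indicator_def s_def hK_def mult.commute intro!: ennreal_leI)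
      finally show "segment_bound v (\<lambda>x. norm (h x)) x w" .
    qed
  qed
qed

lemma closed_segment_start: "closed_segment x (x + w) = (\<lambda>t. x + t *\<^sub>R w) ` {0..1}"
  unfolding closed_segment_def by (force simp: algebra_simps)

text \<open>The complement is the Minkowski sum of the closed set \<open>- U\<close> and the compact
  set of the vectors -t w, hence closed.\<close>

lemma open_segment_start_set:
  fixes U :: "'a::euclidean_space set"
  assumes "open U"
  shows "open {x. closed_segment x (x + w) \<subseteq> U}"
proof -
  let ?Z = "(\<lambda>t. - (t *\<^sub>R w)) ` {0..1::real}"
  have "- {x. closed_segment x (x + w) \<subseteq> U} = (\<Union>y\<in>- U. \<Union>z\<in>?Z. {y + z})"
  proof (intro set_eqI iffI)
    fix x assume "x \<in> - {x. closed_segment x (x + w) \<subseteq> U}"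
    then have "\<exists>t\<in>{0..1}. x + t *\<^sub>R w \<notin> U"
      unfolding closed_segment_start by auto
    then obtain t where "0 \<le> t" "t \<le> 1" "x + t *\<^sub>R w \<notin> U" by auto
    moreover from this have "- (t *\<^sub>R w) \<in> ?Z" by auto
    moreover have "x \<in> {x + t *\<^sub>R w + - (t *\<^sub>R w)}" by simp
    ultimately show "x \<in> (\<Union>y\<in>- U. \<Union>z\<in>?Z. {y + z})" by blast
  next
    fix x assume "x \<in> (\<Union>y\<in>- U. \<Union>z\<in>?Z. {y + z})"
    then obtain y t where yt: "y \<notin> U" "0 \<le> t" "t \<le> 1" "x = y - t *\<^sub>R w" by auto
    then have "y \<in> closed_segment x (x + w)"
      by (auto simp: in_segment algebra_simps intro!: exI[of _ t])
    then show "x \<in> - {x. closed_segment x (x + w) \<subseteq> U}" using yt by auto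
  qed
  moreover have "closed (\<Union>y\<in>- U. \<Union>z\<in>?Z. {y + z})"
    using assms by (intro closed_compact_sums compact_continuous_image continuous_intros) auto
  ultimately show ?thesis by (simp add: open_closed)
qed

lemma AE_lborel_in_box: "AE x in lborel. x \<in> cbox l r \<longrightarrow> x \<in> box l (r::'a::euclidean_space)"
proof -
  have "negligible (cbox l r - box l r)" by (rule negligible_frontier_interval)
  then have "cbox l r - box l r \<in> null_sets lborel"
    by (simp add: negligible_iff_null_sets null_sets_completion_iff)
  then show ?thesis by (rule AE_not_in[THEN AE_mp]) auto
qed

text \<open>Countably many closed boxes exhaust the open set of admissible starting points, so the
  null sets of the box version, together with the boundaries of the boxes, add up to a null
  set.\<close>

lemma weak_gradient_line_bounded:
  fixes v :: "'a::euclidean_space \<Rightarrow> real" and h :: "'a \<Rightarrow> 'a"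
  assumes U: "open U" and meas: "v \<in> borel_measurable borel" "h \<in> borel_measurable borel"
    and loc: "\<And>K. compact K \<Longrightarrow> K \<subseteq> U \<Longrightarrow> integrable lborel (\<lambda>x. indicator K x * v x)"
      "\<And>K. compact K \<Longrightarrow> K \<subseteq> U \<Longrightarrow> integrable lborel (\<lambda>x. indicator K x *\<^sub>R h x)"
    and weak: "\<And>\<psi> b. test_fn U \<psi> \<Longrightarrow> b \<in> Basis \<Longrightarrow>
      (LINT x|lborel. v x * frechet_derivative \<psi> (at x) b) = - (LINT x|lborel. (h x \<bullet> b) * \<psi> x)"
  shows "line_bounded U v (\<lambda>x. norm (h x))"
  unfolding line_bounded_def
proof (intro conjI allI)
  fix w :: 'a
  obtain D where D: "countable D" "D \<subseteq> Pow {x. closed_segment x (x + w) \<subseteq> U}"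
      "\<And>X. X \<in> D \<Longrightarrow> \<exists>a b. X = cbox a b" "\<Union>D = {x. closed_segment x (x + w) \<subseteq> U}"
    by (rule open_countable_Union_open_cbox[OF open_segment_start_set[OF U, of w]]) (rule that)
  have "AE x in lborel. x \<in> X \<longrightarrow>
    segment_bound v (\<lambda>x. norm (h x)) x w"
    if X: "X \<in> D" for X
  proof -
    obtain l r where lr: "X = cbox l r" using D(3)[OF X] by auto
    have "AE x in lborel. x \<in> box l r \<longrightarrow>
      segment_bound v (\<lambda>x. norm (h x)) x w"
      by (rule weak_gradient_box_line_bound[OF meas loc weak]) (use D(2) X lr in auto)
    then show ?thesis
      using AE_lborel_in_box[of l r] unfolding lr by eventually_elim blast
  qed
  then have "AE x in lborel. \<forall>X\<in>D. x \<in> X \<longrightarrow>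
    segment_bound v (\<lambda>x. norm (h x)) x w"
    using D(1) by (subst AE_ball_countable) auto
  then show "AE x in lborel. closed_segment x (x + w) \<subseteq> U \<longrightarrow>
    segment_bound v (\<lambda>x. norm (h x)) x w"
    by eventually_elim (use D(4) in blast)
qed (use meas in auto)

lemma nn_integral_Icc_combine:
  fixes f :: "real \<Rightarrow> ennreal"
  assumes [measurable]: "f \<in> borel_measurable borel" and "a \<le> b" "b \<le> c"
  shows "(\<integral>\<^sup>+t\<in>{a..b}. f t \<partial>lborel) + (\<integral>\<^sup>+t\<in>{b..c}. f t \<partial>lborel) = (\<integral>\<^sup>+t\<in>{a..c}. f t \<partial>lborel)"
proof -
  have "(\<integral>\<^sup>+t\<in>{a..b}. f t \<partial>lborel) + (\<integral>\<^sup>+t\<in>{b..c}. f t \<partial>lborel) =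
      (\<integral>\<^sup>+t. f t * indicator {a..b} t + f t * indicator {b..c} t \<partial>lborel)"
    by (rule nn_integral_add[symmetric]) auto
  also have "\<dots> = (\<integral>\<^sup>+t\<in>{a..c}. f t \<partial>lborel)"
    using AE_lborel_singleton[of b] assms(2,3)
    by (intro nn_integral_cong_AE) (auto elim!: eventually_mono simp: indicator_def)
  finally show ?thesis .
qed

lemma closed_segment_on_line:
  assumes "a \<le> (b::real)"
  shows "closed_segment (x + a *\<^sub>R w) (x + b *\<^sub>R w) = (\<lambda>t. x + t *\<^sub>R w) ` {a..b}"
proof -
  have "closed_segment (x + a *\<^sub>R w) (x + b *\<^sub>R w) = (\<lambda>t. x + a *\<^sub>R w + t *\<^sub>R (b - a) *\<^sub>R w) ` {0..1}"
    using closed_segment_start[of "x + a *\<^sub>R w" "(b - a) *\<^sub>R w"] by (simp add: algebra_simps)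
  also have "\<dots> = (\<lambda>t. x + t *\<^sub>R w) ` (\<lambda>t. (b - a) * t + a) ` {0..1}"
    unfolding image_image by (simp add: algebra_simps)
  also have "(\<lambda>t. (b - a) * t + a) ` {0..1} = {a..b}"
    using assms by (simp add: closed_segment_real_eq[symmetric] closed_segment_eq_real_ivl)
  finally show ?thesis .
qed

text \<open>Serves to chain bounds over a subdivision. The direction
  \<open>(b - a) *\<^sub>R w\<close>, a translation by \<open>a *\<^sub>R w\<close> and an affine
  change of the parameter reduce it to the definition.\<close>

lemma line_bounded_segment:
  assumes "line_bounded U v k"
  shows "AE x in lborel. closed_segment (x + a *\<^sub>R w) (x + b *\<^sub>R w) \<subseteq> U \<longrightarrow> a < b \<longrightarrow>
    ennreal \<bar>v (x + b *\<^sub>R w) - v (x + a *\<^sub>R w)\<bar> \<le> (\<integral>\<^sup>+t\<in>{a..b}. ennreal (norm w * k (x + t *\<^sub>R w)) \<partial>lborel)"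
proof (cases "a < b")
  case ab: True
  have [measurable]: "k \<in> borel_measurable borel" using assms by (auto simp: line_bounded_def)
  have k: "k x \<ge> 0" for x using assms by (auto simp: line_bounded_def)
  have "AE x in lborel. closed_segment x (x + (b - a) *\<^sub>R w) \<subseteq> U \<longrightarrow>
        ennreal \<bar>v (x + (b - a) *\<^sub>R w) - v x\<bar>
          \<le> (\<integral>\<^sup>+t\<in>{0..1}. ennreal (norm ((b - a) *\<^sub>R w) * k (x + t *\<^sub>R (b - a) *\<^sub>R w)) \<partial>lborel)"
    using assms unfolding line_bounded_def by blast
  from AE_lborel_shift[OF this, of "a *\<^sub>R w"] show ?thesis
  proof eventually_elim
    case (elim x)
    show ?case
    proof (intro impI)
      assume "closed_segment (x + a *\<^sub>R w) (x + b *\<^sub>R w) \<subseteq> U"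
      moreover have eq: "x + a *\<^sub>R w + (b - a) *\<^sub>R w = x + b *\<^sub>R w" by (simp add: algebra_simps)
      ultimately have "ennreal \<bar>v (x + b *\<^sub>R w) - v (x + a *\<^sub>R w)\<bar>
          \<le> (\<integral>\<^sup>+t\<in>{0..1}. ennreal (norm ((b - a) *\<^sub>R w) * k (x + a *\<^sub>R w + t *\<^sub>R (b - a) *\<^sub>R w)) \<partial>lborel)"
        using elim unfolding eq by blast
      also have "\<dots> = (\<integral>\<^sup>+t\<in>{0..1}. ennreal (norm ((b - a) *\<^sub>R w) * k (x + (a + (b - a) * t) *\<^sub>R w)) \<partial>lborel)"
      proof -
        have "x + a *\<^sub>R w + t *\<^sub>R (b - a) *\<^sub>R w = x + (a + (b - a) * t) *\<^sub>R w" for t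
          by (simp add: algebra_simps)
        then show ?thesis by presburger
      qed
      also have "\<dots> =
          \<bar>b - a\<bar> * (\<integral>\<^sup>+t\<in>{0..1}. ennreal (norm w * k (x + (a + (b - a) * t) *\<^sub>R w)) \<partial>lborel)"
        using k
        by (subst nn_integral_cmult[symmetric])
          (auto intro!: nn_integral_cong simp: ennreal_mult[symmetric] mult.assoc indicator_def)
      also have "\<dots> = \<bar>b - a\<bar> * (\<integral>\<^sup>+t. ennreal (norm w * k (x + (a + (b - a) * t) *\<^sub>R w)) *
          indicator {a..b} (a + (b - a) * t) \<partial>lborel)"
      proof -
        have "(a + (b - a) * t \<in> {a..b}) = (t \<in> {0..1})" for t
        proof -
          have "(b - a) * t \<le> b - a \<longleftrightarrow> t \<le> 1" using ab by simp
          moreover have "0 \<le> (b - a) * t \<longleftrightarrow> 0 \<le> t" using ab by (simp add: zero_le_mult_iff)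
          ultimately show ?thesis by auto
        qed
        then show ?thesis by (simp add: indicator_def)
      qed
      also have "\<dots> = (\<integral>\<^sup>+t\<in>{a..b}. ennreal (norm w * k (x + t *\<^sub>R w)) \<partial>lborel)"
        using ab by (subst nn_integral_real_affine[of _ "b - a" a, symmetric]) auto
      finally show "ennreal \<bar>v (x + b *\<^sub>R w) - v (x + a *\<^sub>R w)\<bar>
        \<le> (\<integral>\<^sup>+t\<in>{a..b}. ennreal (norm w * k (x + t *\<^sub>R w)) \<partial>lborel)" .
    qed
  qed
qed auto

text \<open>A segment in \<^term>\<open>W\<close> splits into finitely many pieces, each of which lies either in
  \<^term>\<open>U\<close> or in the set \<^term>\<open>N\<close> where the function vanishes.\<close>

lemma line_bounded_extend:
  assumes lb: "line_bounded U v k" and "open U" "open N" and W: "W \<subseteq> U \<union> N"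
    and zero: "\<And>x. x \<in> N \<Longrightarrow> v x = 0"
  shows "line_bounded W v k"
  unfolding line_bounded_def
proof (intro conjI allI)
  fix w
  have [measurable]: "v \<in> borel_measurable borel" "k \<in> borel_measurable borel"
    using lb by (auto simp: line_bounded_def)
  \<comment> \<open>All uniform partitions are treated at once, because the mesh needed later
    depends on \<open>x\<close> while the null set must not. For n = 0 both quotients are 0 and the
    premise on them fails.\<close>
  have "AE x in lborel. \<forall>n::nat. \<forall>i::nat. closed_segment (x + (i / n) *\<^sub>R w) (x + (Suc i / n) *\<^sub>R w) \<subseteq> U \<longrightarrow>
      i / n < Suc i / n \<longrightarrow> ennreal \<bar>v (x + (Suc i / n) *\<^sub>R w) - v (x + (i / n) *\<^sub>R w)\<bar>
        \<le> (\<integral>\<^sup>+t\<in>{i / n..Suc i / n}. ennreal (norm w * k (x + t *\<^sub>R w)) \<partial>lborel)"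
    unfolding AE_all_countable using line_bounded_segment[OF lb] by blast
  then show "AE x in lborel. closed_segment x (x + w) \<subseteq> W \<longrightarrow>
      segment_bound v k x w"
  proof eventually_elim
    case (elim x)
    show ?case
    proof
      assume seg: "closed_segment x (x + w) \<subseteq> W"
      define C where "C = (\<lambda>S. (\<lambda>t. x + t *\<^sub>R w) -` S) ` {U, N}"
      have "{0..1} \<subseteq> \<Union>C"
        using seg W unfolding C_def closed_segment_start by auto
      moreover have "open B" if "B \<in> C" for B
      proof -
        have "continuous_on UNIV (\<lambda>t. x + t *\<^sub>R w)" by (intro continuous_intros)
        then show ?thesis
          using that assms(2,3) by (auto simp: C_def intro: open_vimage)
      qed
      \<comment> \<open>A Lebesgue number of the cover of the parameter interval: each piece of a
        sufficiently fine partition lies entirely over \<open>U\<close> or entirely over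
        \<open>N\<close>.\<close>
      ultimately obtain \<delta> where \<delta>: "\<delta> > 0"
        "\<And>T. T \<subseteq> {0..1} \<Longrightarrow> diameter T < \<delta> \<Longrightarrow> \<exists>B\<in>C. T \<subseteq> B"
        using Lebesgue_number_lemma[of "{0..1::real}" C] by (metis compact_Icc empty_iff image_is_empty insert_not_empty C_def)
      obtain n where n: "1 / real (Suc n) < \<delta>" using nat_approx_posE[OF \<delta>(1)] by blast
      define m where "m = Suc n"
      have m: "m > 0" "1 / real m < \<delta>" using n by (auto simp: m_def)
      define g where "g t = ennreal (norm w * k (x + t *\<^sub>R w))" for t
      have [measurable]: "g \<in> borel_measurable borel" unfolding g_def by measurable
      have step: "ennreal \<bar>v (x + (Suc i / m) *\<^sub>R w) - v (x + (i / m) *\<^sub>R w)\<bar> \<le> (\<integral>\<^sup>+t\<in>{i / m..Suc i / m}. g t \<partial>lborel)"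
        if i: "i < m" for i :: nat
      proof -
        have le: "real i / real m \<le> real (Suc i) / real m" by (simp add: divide_right_mono)
        have "diameter {i / m..Suc i / m} = 1 / m"
          using le by (simp add: diameter_closed_interval diff_divide_distrib[symmetric])
        moreover have "{i / m..Suc i / m} \<subseteq> {0..1::real}" using i m(1) by (auto simp: field_simps)
        ultimately obtain B where B: "B \<in> C" "{i / m..Suc i / m} \<subseteq> B"
          using \<delta>(2)[of "{i / m..Suc i / m}"] m(2) by auto
        consider "{i / m..Suc i / m} \<subseteq> (\<lambda>t. x + t *\<^sub>R w) -` U" | "{i / m..Suc i / m} \<subseteq> (\<lambda>t. x + t *\<^sub>R w) -` N"
          using B by (auto simp: C_def)
        then show ?thesis
        proof cases
          case 1
          have "closed_segment (x + (i / m) *\<^sub>R w) (x + (Suc i / m) *\<^sub>R w) = (\<lambda>t. x + t *\<^sub>R w) ` closed_segment (i / m) (Suc i / m)"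
            using le by (simp add: closed_segment_on_line closed_segment_eq_real_ivl)
          also have "\<dots> \<subseteq> U" using 1 le by (auto simp: closed_segment_eq_real_ivl)
          finally show ?thesis using elim m(1) unfolding g_def by (simp add: divide_strict_right_mono)
        next
          case 2
          then have "v (x + (Suc i / m) *\<^sub>R w) = 0" "v (x + (i / m) *\<^sub>R w) = 0"
            using le zero by auto
          then show ?thesis by simp
        qed
      qed
      have tri: "ennreal \<bar>a - c\<bar> \<le> ennreal \<bar>b - c\<bar> + ennreal \<bar>a - b\<bar>" for a b c :: real
        by (simp flip: ennreal_plus)
      have "ennreal \<bar>v (x + (j / m) *\<^sub>R w) - v x\<bar> \<le> (\<integral>\<^sup>+t\<in>{0..j / m}. g t \<partial>lborel)" if "j \<le> m" for j :: nat
        using that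
      proof (induction j)
        case (Suc j)
        have "ennreal \<bar>v (x + (Suc j / m) *\<^sub>R w) - v x\<bar> \<le>
            ennreal \<bar>v (x + (j / m) *\<^sub>R w) - v x\<bar> + ennreal \<bar>v (x + (Suc j / m) *\<^sub>R w) - v (x + (j / m) *\<^sub>R w)\<bar>"
          by (rule tri)
        also have "\<dots> \<le> (\<integral>\<^sup>+t\<in>{0..j / m}. g t \<partial>lborel) + (\<integral>\<^sup>+t\<in>{j / m..Suc j / m}. g t \<partial>lborel)"
          using Suc step[of j] by (intro add_mono) auto
        also have "\<dots> = (\<integral>\<^sup>+t\<in>{0..Suc j / m}. g t \<partial>lborel)"
          by (rule nn_integral_Icc_combine) (auto simp: divide_right_mono)
        finally show ?case .
      qed simp
      from this[of m] show "segment_bound v k x w"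
        using m(1) by (simp add: g_def)
    qed
  qed
qed (use lb in \<open>auto simp: line_bounded_def\<close>)

section \<open>Rescaling\<close>

lemma nn_integral_lborel_scale:
  fixes f :: "'a::euclidean_space \<Rightarrow> ennreal"
  assumes [measurable]: "f \<in> borel_measurable borel" and e: "e > 0"
  shows "(\<integral>\<^sup>+x. f x \<partial>lborel) = ennreal (e ^ DIM('a)) * (\<integral>\<^sup>+x. f (e *\<^sub>R x) \<partial>lborel)"
  using e by (subst lborel_affine[of e 0])
    (simp_all add: nn_integral_density nn_integral_distr nn_integral_cmult)

lemma AE_lborel_scale:
  fixes Q :: "'a::euclidean_space \<Rightarrow> bool"
  assumes "AE x in lborel. Q x" and e: "e > 0"
  shows "AE x in lborel. Q (e *\<^sub>R x)"
proof -
  have "AE x in density (distr lborel borel (\<lambda>x::'a. 0 + e *\<^sub>R x)) (\<lambda>_. \<bar>e\<bar> ^ DIM('a)). Q x"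
    unfolding lborel_affine[OF less_imp_neq[OF e, symmetric], of 0, symmetric] by (rule assms(1))
  then have "AE x in distr lborel borel (\<lambda>x::'a. 0 + e *\<^sub>R x). Q x"
    using e by (subst (asm) AE_density) auto
  then show ?thesis by (auto dest: AE_distrD[rotated])
qed

text \<open>The factor \<open>e\<close> on \<open>k\<close> is the chain rule; it later compensates
  the growth of the rescaled domain.\<close>

lemma line_bounded_scale:
  assumes lb: "line_bounded W v k" and e: "e > 0"
  shows "line_bounded ((\<lambda>y. e *\<^sub>R y) -` W) (\<lambda>y. v (e *\<^sub>R y)) (\<lambda>y. e * k (e *\<^sub>R y))"
  unfolding line_bounded_def
proof (intro conjI allI)
  show "(\<lambda>y. v (e *\<^sub>R y)) \<in> borel_measurable borel" "(\<lambda>y. e * k (e *\<^sub>R y)) \<in> borel_measurable borel"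
    "\<And>y. 0 \<le> e * k (e *\<^sub>R y)"
    using lb e by (auto simp: line_bounded_def)
  fix w
  have "AE x in lborel. closed_segment x (x + e *\<^sub>R w) \<subseteq> W \<longrightarrow>
        ennreal \<bar>v (x + e *\<^sub>R w) - v x\<bar> \<le> (\<integral>\<^sup>+t\<in>{0..1}. ennreal (norm (e *\<^sub>R w) * k (x + t *\<^sub>R e *\<^sub>R w)) \<partial>lborel)"
    using lb unfolding line_bounded_def by blast
  from AE_lborel_scale[OF this e]
  show "AE x in lborel. closed_segment x (x + w) \<subseteq> (\<lambda>y. e *\<^sub>R y) -` W \<longrightarrow>
        ennreal \<bar>v (e *\<^sub>R (x + w)) - v (e *\<^sub>R x)\<bar>
          \<le> (\<integral>\<^sup>+t\<in>{0..1}. ennreal (norm w * (e * k (e *\<^sub>R (x + t *\<^sub>R w)))) \<partial>lborel)"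
  proof eventually_elim
    case (elim x)
    show ?case
    proof
      assume *: "closed_segment x (x + w) \<subseteq> (\<lambda>y. e *\<^sub>R y) -` W"
      have "closed_segment (e *\<^sub>R x) (e *\<^sub>R x + e *\<^sub>R w) \<subseteq> W"
        using * unfolding closed_segment_start
        by (auto simp: image_subset_iff scaleR_add_right mult.commute)
      then show "ennreal \<bar>v (e *\<^sub>R (x + w)) - v (e *\<^sub>R x)\<bar>
          \<le> (\<integral>\<^sup>+t\<in>{0..1}. ennreal (norm w * (e * k (e *\<^sub>R (x + t *\<^sub>R w)))) \<partial>lborel)"
        using elim e by (simp add: algebra_simps)
    qed
  qed
qed

section \<open>A Hardy inequality along translations\<close>

abbreviation Lp_int :: "real \<Rightarrow> 'a::euclidean_space set \<Rightarrow> ('a \<Rightarrow> real) \<Rightarrow> ennreal" where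
  "Lp_int p A v \<equiv> (\<integral>\<^sup>+x\<in>A. ennreal (\<bar>v x\<bar> powr p) \<partial>lborel)"

lemma nn_integral_set_has_integral:
  fixes f :: "real \<Rightarrow> real"
  assumes "f \<in> borel_measurable borel" "S \<in> sets borel" "\<And>x. 0 \<le> f x" "(f has_integral I) S"
  shows "(\<integral>\<^sup>+x\<in>S. ennreal (f x) \<partial>lborel) = ennreal I"
proof -
  have "integral\<^sup>N lborel (\<lambda>x. ennreal (if x \<in> S then f x else 0)) = ennreal I"
    using assms by (intro nn_integral_has_integral_lborel) (auto simp: has_integral_restrict_UNIV)
  moreover have "(\<integral>\<^sup>+x\<in>S. ennreal (f x) \<partial>lborel) = integral\<^sup>N lborel (\<lambda>x. ennreal (if x \<in> S then f x else 0))"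
    by (intro nn_integral_cong) (auto simp: indicator_def)
  ultimately show ?thesis by simp
qed

lemma powr_add_le:
  fixes a b p :: real
  assumes "p > 0"
  shows "\<bar>a + b\<bar> powr p \<le> 2 powr p * (\<bar>a\<bar> powr p + \<bar>b\<bar> powr p)"
proof -
  have "\<bar>a + b\<bar> powr p \<le> (2 * max \<bar>a\<bar> \<bar>b\<bar>) powr p"
    using assms by (intro powr_mono2) auto
  also have "\<dots> = 2 powr p * (max \<bar>a\<bar> \<bar>b\<bar>) powr p" by (simp add: powr_mult)
  also have "\<dots> \<le> 2 powr p * (\<bar>a\<bar> powr p + \<bar>b\<bar> powr p)"
    by (intro mult_left_mono) (auto simp: max_def)
  finally show ?thesis .
qed

text \<open>Jensen's inequality for the measure \<open>m dM\<close>: integrate Young's inequality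
  \<open>F \<le> a (1 - 1/p) + F\<^sup>p / (p a\<^sup>p\<^sup>-\<^sup>1)\<close> and optimise over \<open>a\<close>.\<close>

lemma weighted_power_bound:
  fixes F m :: "'b \<Rightarrow> real"
  assumes [measurable]: "F \<in> borel_measurable M" "m \<in> borel_measurable M"
    and nonneg: "\<And>y. 0 \<le> F y" "\<And>y. 0 \<le> m y"
    and p: "p > 1" and B: "B > 0"
    and x: "ennreal \<bar>x\<bar> \<le> (\<integral>\<^sup>+y. ennreal (F y * m y) \<partial>M)"
    and m: "(\<integral>\<^sup>+y. ennreal (m y) \<partial>M) \<le> ennreal B"
  shows "ennreal (\<bar>x\<bar> powr p) \<le> ennreal (B powr (p - 1)) * (\<integral>\<^sup>+y. ennreal (F y powr p * m y) \<partial>M)"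
proof (cases "(\<integral>\<^sup>+y. ennreal (F y powr p * m y) \<partial>M)")
  case top
  then show ?thesis using B by (simp add: ennreal_mult_top)
next
  case (real J)
  \<comment> \<open>Integrated Young inequality, for every a > 0.\<close>
  have bound: "\<bar>x\<bar> \<le> a * (1 - 1 / p) * B + J / (p * a powr (p - 1))" if a: "a > 0" for a
  proof -
    have young: "F y \<le> a * (1 - 1 / p) + F y powr p / (p * a powr (p - 1))" for y
    proof -
      have "F y / a * 1 \<le> (F y / a) powr p / p + 1 powr (p / (p - 1)) / (p / (p - 1))"
        using p a nonneg by (intro Youngs_inequality) (auto simp: field_simps)
      then have "a * (F y / a) \<le> a * ((F y / a) powr p / p + (1 - 1 / p))"
        using p a by (intro mult_left_mono) (auto simp: field_simps)
      also have "\<dots> = a * (1 - 1 / p) + F y powr p / (p * (a powr p / a))"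
        using a nonneg by (simp add: powr_divide field_simps)
      also have "a powr p / a = a powr (p - 1)" using a by (simp add: powr_diff)
      finally show ?thesis using a by simp
    qed
    have "ennreal \<bar>x\<bar> \<le> (\<integral>\<^sup>+y. ennreal (a * (1 - 1 / p)) * ennreal (m y) +
        ennreal (1 / (p * a powr (p - 1))) * ennreal (F y powr p * m y) \<partial>M)"
    proof (intro order_trans[OF x] nn_integral_mono)
      fix y
      have "F y * m y \<le> a * (1 - 1 / p) * m y + 1 / (p * a powr (p - 1)) * (F y powr p * m y)"
        using mult_right_mono[OF young nonneg(2), of y y] by (simp add: algebra_simps)
      then have "ennreal (F y * m y) \<le> ennreal (a * (1 - 1 / p) * m y + 1 / (p * a powr (p - 1)) * (F y powr p * m y))"
        by (rule ennreal_leI)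
      also have "\<dots> = ennreal (a * (1 - 1 / p) * m y) + ennreal (1 / (p * a powr (p - 1)) * (F y powr p * m y))"
        using p a nonneg by (intro ennreal_plus mult_nonneg_nonneg) auto
      also have "\<dots> = ennreal (a * (1 - 1 / p)) * ennreal (m y) +
          ennreal (1 / (p * a powr (p - 1))) * ennreal (F y powr p * m y)"
        using p a nonneg by (subst (1 2) ennreal_mult) auto
      finally show "ennreal (F y * m y) \<le> ennreal (a * (1 - 1 / p)) * ennreal (m y) +
          ennreal (1 / (p * a powr (p - 1))) * ennreal (F y powr p * m y)" .
    qed
    also have "\<dots> = ennreal (a * (1 - 1 / p)) * (\<integral>\<^sup>+y. ennreal (m y) \<partial>M) +
        ennreal (1 / (p * a powr (p - 1))) * ennreal J"
      by (simp add: nn_integral_add nn_integral_cmult real)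
    also have "\<dots> \<le> ennreal (a * (1 - 1 / p)) * ennreal B + ennreal (1 / (p * a powr (p - 1))) * ennreal J"
      by (intro add_mono mult_left_mono m) auto
    also have "\<dots> = ennreal (a * (1 - 1 / p) * B + 1 / (p * a powr (p - 1)) * J)"
    proof -
      have "0 \<le> a * (1 - 1 / p)" "0 \<le> 1 / (p * a powr (p - 1))" "0 \<le> a * (1 - 1 / p) * B"
          "0 \<le> 1 / (p * a powr (p - 1)) * J" "0 \<le> B"
        using p a B real(1) by auto
      then show ?thesis using real(1) by (simp only: ennreal_mult ennreal_plus)
    qed
    finally show ?thesis
      using p a B real(1) by (subst (asm) ennreal_le_iff) (auto intro!: add_nonneg_nonneg)
  qed
  have "\<bar>x\<bar> powr p \<le> B powr (p - 1) * J"
  \<comment> \<open>For J = 0 there is no positive minimiser; instead a tends to 0.\<close>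
  proof (cases "J = 0")
    case True
    have "\<bar>x\<bar> \<le> 0 + e" if "e > 0" for e
    proof -
      have "\<bar>x\<bar> \<le> e / ((1 - 1 / p) * B) * (1 - 1 / p) * B"
        using bound[of "e / ((1 - 1 / p) * B)"] that p B True by simp
      moreover have "(1 - 1 / p) * B > 0" using p B by simp
      ultimately show ?thesis using p B by (simp add: mult.assoc)
    qed
    then have "\<bar>x\<bar> \<le> 0" by (rule field_le_epsilon)
    then show ?thesis using True by simp
  next
    case False
    then have J: "J > 0" using real(1) by simp
    \<comment> \<open>The minimiser of the right-hand side of \<open>bound\<close>: its derivative
      in a vanishes exactly when a^p = J / B.\<close>
    define a where "a = (J / B) powr (1 / p)"
    have a: "a > 0" "a powr p = J / B" using J B p by (auto simp: a_def powr_powr)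
    have "J / (p * a powr (p - 1)) = a * B / p"
    proof -
      have "a powr (p - 1) = J / B / a" using a by (simp add: powr_diff)
      then show ?thesis using J B a p by (simp add: field_simps)
    qed
    then have "\<bar>x\<bar> \<le> a * B" using bound[OF a(1)] p by (simp add: field_simps)
    then have "\<bar>x\<bar> powr p \<le> (a * B) powr p" using p by (intro powr_mono2) auto
    also have "\<dots> = J / B * B powr p" using a B by (simp add: powr_mult)
    also have "\<dots> = B powr (p - 1) * J" using B by (simp add: powr_diff)
    finally show ?thesis .
  qed
  then show ?thesis
    using B real(1) by (simp add: real ennreal_mult[symmetric] ennreal_leI)
qed

text \<open>Jensen for the measure (s + t)^(-\<beta>) dt. Its total mass is of order s^(1 -
  \<beta>), and the exponent is tuned so that the resulting singularity s^(-1/2) remains integrable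
  when s later runs along an orbit.\<close>

lemma hardy_weight_bound:
  fixes f :: "real \<Rightarrow> real"
  assumes p: "p > 1" and s: "s > 0" and [measurable]: "f \<in> borel_measurable borel"
    and f: "\<And>t. 0 \<le> f t" and x: "ennreal \<bar>x\<bar> \<le> (\<integral>\<^sup>+t\<in>{0..1}. ennreal (f t) \<partial>lborel)"
  shows "ennreal (\<bar>x\<bar> powr p) \<le> ennreal ((2 * (p - 1)) powr (p - 1) * s powr (- 1 / 2)) *
    (\<integral>\<^sup>+t\<in>{0..1}. ennreal (f t powr p * (s + t) powr (p - 1 / 2)) \<partial>lborel)"
proof -
  \<comment> \<open>Solves (1 - \<beta>)(p - 1) = -1/2; the -1/2 could be any number strictly
    between -1 and 0. Then \<beta> > 1, so the weight is integrable at infinity, and the other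
    exponent becomes p - 1/2.\<close>
  define \<beta> where "\<beta> = 1 + 1 / (2 * (p - 1))"
  have \<beta>: "\<beta> > 1" "\<beta> * (p - 1) = p - 1 / 2" "(1 - \<beta>) * (p - 1) = - 1 / 2" "\<beta> - 1 = 1 / (2 * (p - 1))"
    using p by (auto simp: \<beta>_def field_simps)
  define m where "m t = indicator {0..1} t * (s + t) powr (- \<beta>)" for t :: real
  define F where "F t = f t * indicator {0..1} t * (s + t) powr \<beta>" for t :: real
  define B where "B = 2 * (p - 1) * s powr (1 - \<beta>)"
  have [measurable]: "m \<in> borel_measurable borel" "F \<in> borel_measurable borel"
    unfolding m_def F_def by measurable
  have Fm: "F t * m t = f t * indicator {0..1} t" for t
    using s by (auto simp: F_def m_def indicator_def powr_add[symmetric])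
  have "(\<integral>\<^sup>+t. ennreal (m t) \<partial>lborel) \<le> (\<integral>\<^sup>+t. ennreal ((s + 1 * t) powr (- \<beta>)) * indicator {s..} (s + 1 * t) \<partial>lborel)"
    by (intro nn_integral_mono) (auto simp: m_def indicator_def)
  also have "\<dots> = (\<integral>\<^sup>+t\<in>{s..}. ennreal (t powr (- \<beta>)) \<partial>lborel)"
    using nn_integral_real_affine[of "\<lambda>t. ennreal (t powr (- \<beta>)) * indicator {s..} t" 1 s] by simp
  also have "\<dots> = ennreal (- (s powr (- \<beta> + 1)) / (- \<beta> + 1))"
    using \<beta>(1) s by (intro nn_integral_set_has_integral has_integral_powr_to_inf) auto
  also have "- (s powr (- \<beta> + 1)) / (- \<beta> + 1) = B"
  proof -
    have "- (s powr (- \<beta> + 1)) / (- \<beta> + 1) = s powr (1 - \<beta>) / (\<beta> - 1)"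
      by (simp add: divide_simps) (simp add: algebra_simps)
    then show ?thesis unfolding B_def \<beta>(4) by simp
  qed
  finally have m: "(\<integral>\<^sup>+t. ennreal (m t) \<partial>lborel) \<le> ennreal B" .
  have "ennreal (\<bar>x\<bar> powr p) \<le> ennreal (B powr (p - 1)) * (\<integral>\<^sup>+t. ennreal (F t powr p * m t) \<partial>lborel)"
  proof (rule weighted_power_bound[OF _ _ _ _ p _ _ m])
    show "B > 0" using p s by (simp add: B_def)
    show "ennreal \<bar>x\<bar> \<le> (\<integral>\<^sup>+t. ennreal (F t * m t) \<partial>lborel)"
      unfolding Fm by (rule order_trans[OF x]) (auto intro!: nn_integral_mono simp: indicator_def)
  qed (use f in \<open>auto simp: F_def m_def\<close>)
  also have "B powr (p - 1) = (2 * (p - 1)) powr (p - 1) * s powr (- 1 / 2)"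
    using p s \<beta>(3) by (simp add: B_def powr_mult powr_powr)
  also have "(\<integral>\<^sup>+t. ennreal (F t powr p * m t) \<partial>lborel) =
      (\<integral>\<^sup>+t\<in>{0..1}. ennreal (f t powr p * (s + t) powr (p - 1 / 2)) \<partial>lborel)"
  proof (intro nn_integral_cong)
    fix t :: real
    have "F t powr p * m t = f t powr p * (s + t) powr (p - 1 / 2)" if t: "t \<in> {0..1}"
    proof -
      have "F t powr p * m t = f t powr p * ((s + t) powr (\<beta> * p) * (s + t) powr (- \<beta>))"
        using t s f by (simp add: F_def m_def powr_mult powr_powr)
      also have "(s + t) powr (\<beta> * p) * (s + t) powr (- \<beta>) = (s + t) powr (p - 1 / 2)"
        unfolding powr_add[symmetric] \<beta>(2)[symmetric] by (simp add: algebra_simps)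
      finally show ?thesis .
    qed
    then show "ennreal (F t powr p * m t) = ennreal (f t powr p * (s + t) powr (p - 1 / 2)) * indicator {0..1} t"
      by (auto simp: indicator_def F_def)
  qed
  finally show ?thesis .
qed

text \<open>The times \<open>t\<close> at which the backward orbit of \<open>y\<close> lies in \<open>A\<close> have a supremum
  \<open>t\<^sup>* \<le> \<delta> y / c\<close>, and \<open>\<delta> (y - t w) \<ge> c (t\<^sup>* - t)\<close> at these times.\<close>

lemma backward_orbit_bound:
  fixes \<delta> :: "'a::euclidean_space \<Rightarrow> real"
  assumes c: "c > 0" and H: "\<And>x t. x \<in> A \<Longrightarrow> t \<in> {0..1} \<Longrightarrow> \<delta> (x + t *\<^sub>R w) \<ge> c * (\<delta> x + t)"
    and pos: "\<And>x. x \<in> A \<Longrightarrow> \<delta> x > 0"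
  shows "(\<integral>\<^sup>+t\<in>{0..1}. ennreal (indicator A (y - t *\<^sub>R w) * \<delta> (y - t *\<^sub>R w) powr (- 1 / 2)) \<partial>lborel)
    \<le> ennreal (2 / c * \<delta> y powr (1 / 2))"
proof -
  define I where "I = {t \<in> {0..1}. y - t *\<^sub>R w \<in> A}"
  show ?thesis
  proof (cases "I = {}")
    case True
    then have "(\<integral>\<^sup>+t\<in>{0..1}. ennreal (indicator A (y - t *\<^sub>R w) * \<delta> (y - t *\<^sub>R w) powr (- 1 / 2)) \<partial>lborel) =
      (\<integral>\<^sup>+t. 0 \<partial>(lborel :: real measure))"
      by (intro nn_integral_cong) (auto simp: I_def indicator_def)
    then show ?thesis by simp
  next
    case False
    define s where "s = Sup I"
    have bdd: "bdd_above I" by (rule bdd_aboveI[of _ 1]) (auto simp: I_def)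
    have le_s: "t \<le> s" if "t \<in> I" for t using cSup_upper[OF that bdd] by (simp add: s_def)
    have s0: "s \<ge> 0" using False le_s by (force simp: I_def)
    have "t \<le> \<delta> y / c" if "t \<in> I" for t
    proof -
      have "\<delta> (y - t *\<^sub>R w + t *\<^sub>R w) \<ge> c * (\<delta> (y - t *\<^sub>R w) + t)"
        using that by (intro H) (auto simp: I_def)
      moreover have "c * (\<delta> (y - t *\<^sub>R w) + t) \<ge> c * t"
        using that pos[of "y - t *\<^sub>R w"] c by (intro mult_left_mono) (auto simp: I_def)
      ultimately show ?thesis using c by (simp add: field_simps)
    qed
    then have s_le: "s \<le> \<delta> y / c" unfolding s_def by (rule cSup_least[OF False])
    have low: "\<delta> (y - t *\<^sub>R w) \<ge> c * (s - t)" if t: "t \<in> I" for t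
    proof -
      have "t' \<le> t + \<delta> (y - t *\<^sub>R w) / c" if t': "t' \<in> I" for t'
      proof (cases "t' \<le> t")
        case True
        then show ?thesis using pos[of "y - t *\<^sub>R w"] t c by (simp add: I_def add_increasing2)
      next
        case False
        \<comment> \<open>The point y - t w lies on the forward orbit of y - t' w at the time t' -
          t, so the growth hypothesis applies from there.\<close>
        have "\<delta> (y - t' *\<^sub>R w + (t' - t) *\<^sub>R w) \<ge> c * (\<delta> (y - t' *\<^sub>R w) + (t' - t))"
          using t t' False by (intro H) (auto simp: I_def)
        moreover have "y - t' *\<^sub>R w + (t' - t) *\<^sub>R w = y - t *\<^sub>R w" by (simp add: algebra_simps)
        moreover have "c * (\<delta> (y - t' *\<^sub>R w) + (t' - t)) \<ge> c * (t' - t)"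
          using t' pos[of "y - t' *\<^sub>R w"] c by (intro mult_left_mono) (auto simp: I_def)
        ultimately have "c * (t' - t) \<le> \<delta> (y - t *\<^sub>R w)" by simp
        then show ?thesis using c by (simp add: field_simps)
      qed
      then have "s \<le> t + \<delta> (y - t *\<^sub>R w) / c" unfolding s_def by (rule cSup_least[OF False])
      then show ?thesis using c by (simp add: field_simps)
    qed
    have "(\<integral>\<^sup>+t\<in>{0..1}. ennreal (indicator A (y - t *\<^sub>R w) * \<delta> (y - t *\<^sub>R w) powr (- 1 / 2)) \<partial>lborel) \<le>
      (\<integral>\<^sup>+t. ennreal (c powr (- 1 / 2)) * (ennreal ((s + (- 1) * t) powr (- 1 / 2)) * indicator {0..s} (s + (- 1) * t)) \<partial>lborel)"
    proof (intro nn_integral_mono_AE)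
      \<comment> \<open>At t = s the comparison function takes the default value
        \<open>0 powr (- 1 / 2) = 0\<close>, so this single point is discarded as a null
        set.\<close>
      show "AE t in lborel. ennreal (indicator A (y - t *\<^sub>R w) * \<delta> (y - t *\<^sub>R w) powr (- 1 / 2)) * indicator {0..1} t \<le>
        ennreal (c powr (- 1 / 2)) * (ennreal ((s + (- 1) * t) powr (- 1 / 2)) * indicator {0..s} (s + (- 1) * t))"
        using AE_lborel_singleton[of s]
      proof eventually_elim
        case (elim t)
        show ?case
        proof (cases "t \<in> I")
          case True
          then have "t < s" "0 \<le> t" using le_s[OF True] elim by (auto simp: I_def)
          moreover have "\<delta> (y - t *\<^sub>R w) powr (- 1 / 2) \<le> (c * (s - t)) powr (- 1 / 2)"
            using low[OF True] \<open>t < s\<close> c by (intro powr_mono2') auto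
          moreover have "(c * (s - t)) powr (- 1 / 2) = c powr (- 1 / 2) * (s - t) powr (- 1 / 2)"
            using \<open>t < s\<close> c by (simp add: powr_mult)
          ultimately show ?thesis
            by (auto simp: indicator_def ennreal_mult[symmetric] intro!: ennreal_leI)
        qed (auto simp: I_def indicator_def)
      qed
    qed
    also have "\<dots> = ennreal (c powr (- 1 / 2)) * (\<integral>\<^sup>+t\<in>{0..s}. ennreal (t powr (- 1 / 2)) \<partial>lborel)"
      using nn_integral_real_affine[of "\<lambda>t. ennreal (t powr (- 1 / 2)) * indicator {0..s} t" "- 1" s]
      by (simp add: nn_integral_cmult)
    also have "(\<integral>\<^sup>+t\<in>{0..s}. ennreal (t powr (- 1 / 2)) \<partial>lborel) = ennreal (s powr (- 1 / 2 + 1) / (- 1 / 2 + 1))"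
      using s0 by (intro nn_integral_set_has_integral has_integral_powr_from_0) auto
    also have "ennreal (c powr (- 1 / 2)) * ennreal (s powr (- 1 / 2 + 1) / (- 1 / 2 + 1)) =
        ennreal (2 * (c powr (- 1 / 2) * s powr (1 / 2)))"
      by (simp add: ennreal_mult[symmetric] mult_ac)
    also have "\<dots> \<le> ennreal (2 / c * \<delta> y powr (1 / 2))"
    proof (rule ennreal_leI)
      have "s powr (1 / 2) \<le> (\<delta> y / c) powr (1 / 2)" using s0 s_le by (intro powr_mono2) auto
      also have "\<dots> = \<delta> y powr (1 / 2) * c powr (- 1 / 2)"
        using s0 s_le c by (simp add: powr_divide powr_minus_divide)
      finally have "c powr (- 1 / 2) * s powr (1 / 2) \<le> c powr (- 1 / 2) * (\<delta> y powr (1 / 2) * c powr (- 1 / 2))"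
        by (intro mult_left_mono) auto
      also have "\<dots> = \<delta> y powr (1 / 2) * c powr (- 1 / 2 + - 1 / 2)" by (simp only: powr_add mult_ac)
      also have "\<dots> = \<delta> y powr (1 / 2) / c" using c by (simp add: powr_minus_divide)
      finally show "2 * (c powr (- 1 / 2) * s powr (1 / 2)) \<le> 2 / c * \<delta> y powr (1 / 2)" by simp
    qed
    finally show ?thesis .
  qed
qed

text \<open>Use \<open>hardy_weight_bound\<close> at each x with s the distance of x from
  \<open>P\<close>; the growth hypothesis bounds s + t by the distance of the moving point x + t w.
  After Fubini and the substitution y = x + t w, what remains at y is the integral of
  \<open>backward_orbit_bound\<close>.\<close>

lemma hardy_translation:
  fixes P A :: "'a::euclidean_space set"
  assumes p: "p > 1" and P: "closed P" "P \<noteq> {}" and lb: "line_bounded (- P) v k"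
    and A [measurable]: "A \<in> sets borel" "A \<subseteq> - P" and c: "c > 0"
    and H: "\<And>x t. x \<in> A \<Longrightarrow> t \<in> {0..1} \<Longrightarrow> infdist (x + t *\<^sub>R w) P \<ge> c * (infdist x P + t)"
  shows "(\<integral>\<^sup>+x\<in>A. ennreal (\<bar>v (x + w) - v x\<bar> powr p) \<partial>lborel) \<le>
    ennreal ((2 * (p - 1)) powr (p - 1) * norm w powr p * (1 / c) powr (p - 1 / 2) * (2 / c)) *
      (\<integral>\<^sup>+x. ennreal ((infdist x P * k x) powr p) \<partial>lborel)"
proof -
  have [measurable]: "v \<in> borel_measurable borel" "k \<in> borel_measurable borel"
    and k: "\<And>x. 0 \<le> k x" using lb by (auto simp: line_bounded_def)
  define \<delta> where "\<delta> x = infdist x P" for x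
  have [measurable]: "\<delta> \<in> borel_measurable borel"
    unfolding \<delta>_def by (intro borel_measurable_continuous_onI continuous_intros)
  have pos: "\<delta> x > 0" if "x \<notin> P" for x
    using P that by (simp add: \<delta>_def infdist_pos_not_in_closed)
  have \<delta>0: "\<delta> x \<ge> 0" for x by (simp add: \<delta>_def infdist_nonneg)
  define C where "C = (2 * (p - 1)) powr (p - 1) * norm w powr p * (1 / c) powr (p - 1 / 2)"
  have C: "C \<ge> 0" by (simp add: C_def)
  define \<Phi> where "\<Phi> y = k y powr p * \<delta> y powr (p - 1 / 2)" for y
  have [measurable]: "\<Phi> \<in> borel_measurable borel" unfolding \<Phi>_def by measurable
  have \<Phi>0: "\<Phi> y \<ge> 0" for y by (simp add: \<Phi>_def)
  have ae: "AE x in lborel. ennreal (\<bar>v (x + w) - v x\<bar> powr p) * indicator A x \<le>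
     ennreal C * (\<integral>\<^sup>+t. ennreal (indicator A x * \<delta> x powr (- 1 / 2) * \<Phi> (x + t *\<^sub>R w)) * indicator {0..1} t \<partial>lborel)"
  proof -
    have "AE x in lborel. closed_segment x (x + w) \<subseteq> - P \<longrightarrow>
        segment_bound v k x w"
      using lb unfolding line_bounded_def by blast
    then show ?thesis
    proof eventually_elim
      case (elim x)
      show ?case
      proof (cases "x \<in> A")
        case True
        then have s: "\<delta> x > 0" using A(2) pos by auto
        have "closed_segment x (x + w) \<subseteq> - P"
        proof -
          have "x + t *\<^sub>R w \<notin> P" if "t \<in> {0..1}" for t
          proof -
            \<comment> \<open>The growth hypothesis itself keeps the segment off \<open>P\<close>,
              so the line bound is available.\<close>
            have "0 < c * (\<delta> x + t)" using c s that by simp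
            also have "\<dots> \<le> infdist (x + t *\<^sub>R w) P" using H[OF True that] by (simp add: \<delta>_def)
            finally show ?thesis by auto
          qed
          then show ?thesis unfolding closed_segment_start by auto
        qed
        then have x: "segment_bound v k x w"
          using elim by blast
        have "ennreal (\<bar>v (x + w) - v x\<bar> powr p) \<le> ennreal ((2 * (p - 1)) powr (p - 1) * \<delta> x powr (- 1 / 2)) *
            (\<integral>\<^sup>+t\<in>{0..1}. ennreal ((norm w * k (x + t *\<^sub>R w)) powr p * (\<delta> x + t) powr (p - 1 / 2)) \<partial>lborel)"
          by (rule hardy_weight_bound[OF p s _ _ x]) (use k in auto)
        also have "\<dots> \<le> ennreal ((2 * (p - 1)) powr (p - 1) * \<delta> x powr (- 1 / 2)) *
            (\<integral>\<^sup>+t. ennreal (norm w powr p * (1 / c) powr (p - 1 / 2)) *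
              (ennreal (\<Phi> (x + t *\<^sub>R w)) * indicator {0..1} t) \<partial>lborel)"
        proof (intro mult_left_mono nn_integral_mono)
          fix t :: real
          have "(norm w * k (x + t *\<^sub>R w)) powr p * (\<delta> x + t) powr (p - 1 / 2) \<le>
              norm w powr p * (1 / c) powr (p - 1 / 2) * \<Phi> (x + t *\<^sub>R w)" if t: "t \<in> {0..1}"
          proof -
            have "\<delta> x + t \<le> 1 / c * \<delta> (x + t *\<^sub>R w)"
              using H[OF True t] c by (simp add: \<delta>_def field_simps)
            then have "(\<delta> x + t) powr (p - 1 / 2) \<le> (1 / c * \<delta> (x + t *\<^sub>R w)) powr (p - 1 / 2)"
              using p t \<delta>0[of x] by (intro powr_mono2) auto
            also have "\<dots> = (1 / c) powr (p - 1 / 2) * \<delta> (x + t *\<^sub>R w) powr (p - 1 / 2)"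
              using c \<delta>0 by (intro powr_mult)
            finally have "(norm w powr p * k (x + t *\<^sub>R w) powr p) * (\<delta> x + t) powr (p - 1 / 2) \<le>
              (norm w powr p * k (x + t *\<^sub>R w) powr p) * ((1 / c) powr (p - 1 / 2) * \<delta> (x + t *\<^sub>R w) powr (p - 1 / 2))"
              by (intro mult_left_mono) auto
            then show ?thesis using k by (simp add: \<Phi>_def powr_mult mult_ac)
          qed
          then show "ennreal ((norm w * k (x + t *\<^sub>R w)) powr p * (\<delta> x + t) powr (p - 1 / 2)) * indicator {0..1} t \<le>
             ennreal (norm w powr p * (1 / c) powr (p - 1 / 2)) * (ennreal (\<Phi> (x + t *\<^sub>R w)) * indicator {0..1} t)"
            using \<Phi>0 by (auto simp: indicator_def ennreal_mult[symmetric] intro!: ennreal_leI)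
        qed simp
        also have "\<dots> = ennreal C * (\<integral>\<^sup>+t. ennreal (\<delta> x powr (- 1 / 2)) * (ennreal (\<Phi> (x + t *\<^sub>R w)) * indicator {0..1} t) \<partial>lborel)"
        proof -
          have Z: "(\<integral>\<^sup>+t. ennreal a * (ennreal (\<Phi> (x + t *\<^sub>R w)) * indicator {0..1} t) \<partial>lborel) =
              ennreal a * (\<integral>\<^sup>+t. ennreal (\<Phi> (x + t *\<^sub>R w)) * indicator {0..1} t \<partial>lborel)" for a
            by (rule nn_integral_cmult) measurable
          show ?thesis unfolding Z using p by (simp add: C_def ennreal_mult mult_ac)
        qed
        also have "\<dots> = ennreal C * (\<integral>\<^sup>+t. ennreal (indicator A x * \<delta> x powr (- 1 / 2) * \<Phi> (x + t *\<^sub>R w)) * indicator {0..1} t \<partial>lborel)"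
          using True \<Phi>0 by (simp add: ennreal_mult mult_ac)
        finally show ?thesis using True by simp
      qed simp
    qed
  qed
  have "(\<integral>\<^sup>+x\<in>A. ennreal (\<bar>v (x + w) - v x\<bar> powr p) \<partial>lborel) \<le>
     (\<integral>\<^sup>+x. ennreal C * (\<integral>\<^sup>+t. ennreal (indicator A x * \<delta> x powr (- 1 / 2) * \<Phi> (x + t *\<^sub>R w)) * indicator {0..1} t \<partial>lborel) \<partial>lborel)"
    by (rule nn_integral_mono_AE[OF ae])
  also have "\<dots> = ennreal C * (\<integral>\<^sup>+x. (\<integral>\<^sup>+t. ennreal (indicator A x * \<delta> x powr (- 1 / 2) * \<Phi> (x + t *\<^sub>R w)) * indicator {0..1} t \<partial>lborel) \<partial>lborel)"
    by (rule nn_integral_cmult) measurable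
  \<comment> \<open>Exchange, shift by t w for fixed t, exchange back: now the endpoint y is fixed
    and the starting point y - t w runs backwards.\<close>
  also have "(\<integral>\<^sup>+x. (\<integral>\<^sup>+t. ennreal (indicator A x * \<delta> x powr (- 1 / 2) * \<Phi> (x + t *\<^sub>R w)) * indicator {0..1} t \<partial>lborel) \<partial>lborel) =
      (\<integral>\<^sup>+t. (\<integral>\<^sup>+x. ennreal (indicator A x * \<delta> x powr (- 1 / 2) * \<Phi> (x + t *\<^sub>R w)) * indicator {0..1::real} t \<partial>lborel) \<partial>lborel)"
    by (rule lborel_pair.Fubini'[symmetric, where f = "\<lambda>x t. ennreal (indicator A x *
      \<delta> x powr (- 1 / 2) * \<Phi> (x + t *\<^sub>R w)) * indicator {0..1::real} t"]) measurable
  also have "\<dots> = (\<integral>\<^sup>+t. (\<integral>\<^sup>+y. ennreal (indicator A (y - t *\<^sub>R w) * \<delta> (y - t *\<^sub>R w) powr (- 1 / 2) * \<Phi> y) * indicator {0..1::real} t \<partial>lborel) \<partial>lborel)"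
  proof (rule nn_integral_cong)
    fix t :: real
    show "(\<integral>\<^sup>+x. ennreal (indicator A x * \<delta> x powr (- 1 / 2) * \<Phi> (x + t *\<^sub>R w)) * indicator {0..1} t \<partial>lborel) =
      (\<integral>\<^sup>+y. ennreal (indicator A (y - t *\<^sub>R w) * \<delta> (y - t *\<^sub>R w) powr (- 1 / 2) * \<Phi> y) * indicator {0..1} t \<partial>lborel)"
      using nn_integral_lborel_shift[of "\<lambda>y. ennreal (indicator A (y - t *\<^sub>R w) * \<delta> (y - t *\<^sub>R w) powr (- 1 / 2) * \<Phi> y) * indicator {0..1} t" "t *\<^sub>R w"]
      by simp
  qed
  also have "\<dots> = (\<integral>\<^sup>+y. (\<integral>\<^sup>+t. ennreal (indicator A (y - t *\<^sub>R w) * \<delta> (y - t *\<^sub>R w) powr (- 1 / 2) * \<Phi> y) * indicator {0..1::real} t \<partial>lborel) \<partial>lborel)"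
    by (rule lborel_pair.Fubini'[where f = "\<lambda>y t. ennreal (indicator A (y - t *\<^sub>R w) *
      \<delta> (y - t *\<^sub>R w) powr (- 1 / 2) * \<Phi> y) * indicator {0..1::real} t"]) measurable
  also have "\<dots> \<le> (\<integral>\<^sup>+y. ennreal (2 / c) * ennreal ((\<delta> y * k y) powr p) \<partial>lborel)"
  proof (intro nn_integral_mono)
    fix y
    have "(\<integral>\<^sup>+t. ennreal (indicator A (y - t *\<^sub>R w) * \<delta> (y - t *\<^sub>R w) powr (- 1 / 2) * \<Phi> y) * indicator {0..1::real} t \<partial>lborel) =
        ennreal (\<Phi> y) * (\<integral>\<^sup>+t\<in>{0..1}. ennreal (indicator A (y - t *\<^sub>R w) * \<delta> (y - t *\<^sub>R w) powr (- 1 / 2)) \<partial>lborel)"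
      using \<Phi>0 by (subst nn_integral_cmult[symmetric])
        (auto intro!: nn_integral_cong simp: ennreal_mult[symmetric] indicator_def mult_ac)
    also have "\<dots> \<le> ennreal (\<Phi> y) * ennreal (2 / c * \<delta> y powr (1 / 2))"
      by (intro mult_left_mono backward_orbit_bound c) (use H A pos in \<open>auto simp: \<delta>_def\<close>)
    also have "\<dots> = ennreal (2 / c * (k y powr p * (\<delta> y powr (p - 1 / 2) * \<delta> y powr (1 / 2))))"
      using c \<Phi>0 by (simp add: ennreal_mult[symmetric] \<Phi>_def mult_ac)
    \<comment> \<open>The exponents from Jensen and from the backward orbit add up to that of the
      weight.\<close>
    also have "\<delta> y powr (p - 1 / 2) * \<delta> y powr (1 / 2) = \<delta> y powr p"
      by (simp add: powr_add[symmetric])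
    also have "k y powr p * \<delta> y powr p = (\<delta> y * k y) powr p"
      using \<delta>0 k by (simp add: powr_mult mult.commute)
    finally show "(\<integral>\<^sup>+t. ennreal (indicator A (y - t *\<^sub>R w) * \<delta> (y - t *\<^sub>R w) powr (- 1 / 2) * \<Phi> y) * indicator {0..1::real} t \<partial>lborel)
      \<le> ennreal (2 / c) * ennreal ((\<delta> y * k y) powr p)"
      using c by (subst ennreal_mult[symmetric]) auto
  qed
  also have "\<dots> = ennreal (2 / c) * (\<integral>\<^sup>+y. ennreal ((\<delta> y * k y) powr p) \<partial>lborel)"
    by (rule nn_integral_cmult) measurable
  finally have "(\<integral>\<^sup>+x\<in>A. ennreal (\<bar>v (x + w) - v x\<bar> powr p) \<partial>lborel) \<le>
    ennreal C * (ennreal (2 / c) * (\<integral>\<^sup>+y. ennreal ((\<delta> y * k y) powr p) \<partial>lborel))"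
    by (simp add: mult_left_mono)
  moreover have "ennreal (C * (2 / c)) = ennreal C * ennreal (2 / c)"
    using C c by (intro ennreal_mult) auto
  ultimately show ?thesis
    unfolding C_def[symmetric] by (simp only: \<delta>_def mult.assoc)
qed

section \<open>Periodically perforated space\<close>

lemma int_lattice_0: "0 \<in> int_lattice"
  by (simp add: int_lattice_def)

lemma int_lattice_add: "x \<in> int_lattice \<Longrightarrow> y \<in> int_lattice \<Longrightarrow> x + y \<in> int_lattice"
  by (simp add: int_lattice_def inner_add_left)

lemma int_lattice_uminus: "x \<in> int_lattice \<Longrightarrow> - x \<in> int_lattice"
  by (simp add: int_lattice_def)

lemma mem_periodize_1: "x \<in> periodize 1 A \<longleftrightarrow> (\<exists>z\<in>int_lattice. x - z \<in> A)"
proof -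
  have "x \<in> (\<lambda>y. 1 *\<^sub>R (z + y)) ` A \<longleftrightarrow> x - z \<in> A" for z
  proof
    assume "x - z \<in> A"
    then have "1 *\<^sub>R (z + (x - z)) \<in> (\<lambda>y. 1 *\<^sub>R (z + y)) ` A" by (rule imageI)
    then show "x \<in> (\<lambda>y. 1 *\<^sub>R (z + y)) ` A" by simp
  qed auto
  then show ?thesis by (simp add: periodize_def)
qed

lemma periodize_1_shift:
  assumes "z \<in> int_lattice" "x \<in> periodize 1 A"
  shows "x + z \<in> periodize 1 A"
proof -
  obtain u where u: "u \<in> int_lattice" "x - u \<in> A" using assms(2) by (auto simp: mem_periodize_1)
  then have "x + z - (u + z) \<in> A" by simp
  then show ?thesis using int_lattice_add[OF u(1) assms(1)] unfolding mem_periodize_1 by blast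
qed

lemma periodize_1_shift_iff: "z \<in> int_lattice \<Longrightarrow> x + z \<in> periodize 1 A \<longleftrightarrow> x \<in> periodize 1 A"
  using periodize_1_shift[of z x A] periodize_1_shift[of "- z" "x + z" A] int_lattice_uminus[of z] by auto

lemma open_periodize_1: "open A \<Longrightarrow> open (periodize 1 A)"
  unfolding periodize_def by (auto intro!: open_UN open_translation)

lemma subset_periodize_1: "A \<subseteq> periodize 1 A"
proof
  fix x assume "x \<in> A"
  then show "x \<in> periodize 1 A" unfolding mem_periodize_1 by (intro bexI[OF _ int_lattice_0]) simp
qed

lemma int_lattice_cell: "\<exists>z\<in>int_lattice. x - z \<in> cbox (- (1 / 2) *\<^sub>R One) ((1 / 2) *\<^sub>R One)" for x :: "'a::euclidean_space"
proof -
  define z :: 'a where "z = (\<Sum>b\<in>Basis. of_int (round (x \<bullet> b)) *\<^sub>R b)"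
  have zb: "z \<bullet> b = of_int (round (x \<bullet> b))" if "b \<in> Basis" for b
    using that by (simp add: z_def)
  have "- (1 / 2) \<le> (x - z) \<bullet> b \<and> (x - z) \<bullet> b \<le> 1 / 2" if "b \<in> Basis" for b
    using of_int_round_abs_le[of "x \<bullet> b"] zb[OF that] by (simp only: inner_diff_left) linarith
  then show ?thesis
    by (intro bexI[of _ z]) (auto simp: mem_box int_lattice_def zb)
qed

text \<open>\<open>P\<close> is the union of all holes and \<open>G\<close> the region on which the
  norm counts as known; the latter becomes the union of the slabs around the cell walls.\<close>

locale perforated =
  fixes P G :: "'a::euclidean_space set" and p :: real
  assumes closed_P: "closed P" and P_ne: "P \<noteq> {}"
    and P_per: "z \<in> int_lattice \<Longrightarrow> x + z \<in> P \<longleftrightarrow> x \<in> P"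
    and open_G: "open G" and G_per: "z \<in> int_lattice \<Longrightarrow> x + z \<in> G \<longleftrightarrow> x \<in> G"
    and p_gt_1: "p > 1"
begin

abbreviation \<delta> :: "'a \<Rightarrow> real" where "\<delta> x \<equiv> infdist x P"

definition energy :: "('a \<Rightarrow> real) \<Rightarrow> ('a \<Rightarrow> real) \<Rightarrow> ennreal" where
  "energy v k = Lp_int p G v + (\<integral>\<^sup>+x. ennreal ((\<delta> x * k x) powr p) \<partial>lborel)"

text \<open>\<open>A - P\<close>, because a line bound off \<open>P\<close> says nothing about
  \<open>v\<close> inside the holes.\<close>

definition controlled :: "'a set \<Rightarrow> bool" where
  "controlled A \<longleftrightarrow> (\<exists>K\<ge>0. \<forall>v k. line_bounded (- P) v k \<longrightarrow>
     Lp_int p (A - P) v \<le> ennreal K * energy v k)"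

text \<open>With periodised balls, a finite cover of one cell covers the whole space, and one
  constant serves all lattice copies at once.\<close>

definition good :: "'a \<Rightarrow> bool" where
  "good x \<longleftrightarrow> (\<exists>\<rho>>0. controlled (periodize 1 (ball x \<rho>)))"

lemma \<delta>_pos: "x \<notin> P \<Longrightarrow> \<delta> x > 0"
  using closed_P P_ne by (simp add: infdist_pos_not_in_closed)

lemma \<delta>_per: assumes "z \<in> int_lattice" shows "\<delta> (x + z) = \<delta> x"
proof -
  have le: "\<delta> (x + z) \<le> \<delta> x" if "z \<in> int_lattice" for x z
  proof -
    obtain q where q: "q \<in> P" "\<delta> x = dist x q"
      using infdist_attains_inf[OF closed_P P_ne] by metis
    have "\<delta> (x + z) \<le> dist (x + z) (q + z)" using P_per[OF that] q(1) by (intro infdist_le) auto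
    then show ?thesis using q by simp
  qed
  from le[OF assms, of x] le[OF int_lattice_uminus[OF assms], of "x + z"] show ?thesis by simp
qed

lemma controlled_subset: "controlled B \<Longrightarrow> A - P \<subseteq> B \<Longrightarrow> controlled A"
  unfolding controlled_def
proof (elim exE conjE, intro exI conjI allI impI)
  fix K v k assume "0 \<le> K" and AB: "A - P \<subseteq> B" and lb: "line_bounded (- P) v k"
    and K: "\<forall>v k. line_bounded (- P) v k \<longrightarrow>
      Lp_int p (B - P) v \<le> ennreal K * energy v k"
  have "Lp_int p (A - P) v \<le> Lp_int p (B - P) v"
    using AB by (intro nn_integral_mono) (auto simp: indicator_def)
  also have "\<dots> \<le> ennreal K * energy v k" using K lb by blast
  finally show "Lp_int p (A - P) v \<le> ennreal K * energy v k" .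
qed

lemma controlled_empty: "A \<subseteq> P \<Longrightarrow> controlled A"
  unfolding controlled_def
proof (intro exI[of _ 0] conjI allI impI)
  fix v k :: "'a \<Rightarrow> real" assume "A \<subseteq> P"
  then have "A - P = {}" by auto
  then show "Lp_int p (A - P) v \<le> ennreal 0 * energy v k"
    by (simp only:) simp
qed simp

lemma controlled_G: "controlled G"
  unfolding controlled_def
proof (intro exI[of _ 1] conjI allI impI)
  fix v k :: "'a \<Rightarrow> real"
  have "Lp_int p (G - P) v \<le> Lp_int p G v"
    by (intro nn_integral_mono) (auto simp: indicator_def)
  also have "\<dots> \<le> energy v k" unfolding energy_def by simp
  finally show "Lp_int p (G - P) v \<le> ennreal 1 * energy v k" by simp
qed simp

lemma controlledE:
  assumes "controlled A"
  obtains K where "K \<ge> 0" "\<And>v k. line_bounded (- P) v k \<Longrightarrow>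
    Lp_int p (A - P) v \<le> ennreal K * energy v k"
proof -
  from assms obtain K where K: "K \<ge> 0" "\<forall>v k. line_bounded (- P) v k \<longrightarrow>
    Lp_int p (A - P) v \<le> ennreal K * energy v k"
    unfolding controlled_def by (elim exE conjE)
  show thesis by (rule that[OF K(1)]) (rule K(2)[rule_format])
qed

lemma controlled_Un:
  assumes "controlled A" "controlled B" "open A" "open B"
  shows "controlled (A \<union> B)"
proof -
  obtain K where K: "K \<ge> 0" "\<And>v k. line_bounded (- P) v k \<Longrightarrow>
      Lp_int p (A - P) v \<le> ennreal K * energy v k"
    using assms(1) by (rule controlledE) (rule that)
  obtain L where L: "L \<ge> 0" "\<And>v k. line_bounded (- P) v k \<Longrightarrow>
      Lp_int p (B - P) v \<le> ennreal L * energy v k"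
    using assms(2) by (rule controlledE) (rule that)
  have [measurable]: "A \<in> sets borel" "B \<in> sets borel" "P \<in> sets borel"
    using assms closed_P by auto
  have "Lp_int p ((A \<union> B) - P) v \<le> ennreal (K + L) * energy v k"
    if lb: "line_bounded (- P) v k" for v k
  proof -
    have [measurable]: "v \<in> borel_measurable borel" using lb by (simp add: line_bounded_def)
    have "Lp_int p ((A \<union> B) - P) v \<le>
        (\<integral>\<^sup>+x. ennreal (\<bar>v x\<bar> powr p) * indicator (A - P) x + ennreal (\<bar>v x\<bar> powr p) * indicator (B - P) x \<partial>lborel)"
      by (intro nn_integral_mono) (auto simp: indicator_def)
    also have "\<dots> = Lp_int p (A - P) v + Lp_int p (B - P) v"
      by (intro nn_integral_add) auto
    also have "\<dots> \<le> ennreal K * energy v k + ennreal L * energy v k"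
      by (intro add_mono K L lb)
    also have "\<dots> = ennreal (K + L) * energy v k"
      using K(1) L(1) by (simp add: ennreal_plus distrib_right)
    finally show ?thesis .
  qed
  then show ?thesis
    unfolding controlled_def using K(1) L(1) by (intro exI[of _ "K + L"]) auto
qed

lemma controlled_UN:
  assumes "finite I" "\<And>i. i \<in> I \<Longrightarrow> controlled (A i) \<and> open (A i)"
  shows "controlled (\<Union>i\<in>I. A i)"
  using assms
proof (induction I rule: finite_induct)
  case empty
  then show ?case by (simp add: controlled_empty)
next
  case (insert i I)
  then have "controlled (A i \<union> (\<Union>i\<in>I. A i))" by (intro controlled_Un) auto
  then show ?case by simp
qed

text \<open>Write v(x) as v(x + w) minus the increment. A change of variables carries the first term
  into \<open>B\<close>, and \<open>hardy_translation\<close> bounds the second by the gradient part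
  of the energy.\<close>

lemma controlled_translate:
  assumes A: "open A" and c: "c > 0"
    and H: "\<And>x t. x \<in> A - P \<Longrightarrow> t \<in> {0..1} \<Longrightarrow> \<delta> (x + t *\<^sub>R w) \<ge> c * (\<delta> x + t)"
    and B: "\<And>x. x \<in> A - P \<Longrightarrow> x + w \<in> B" "controlled B"
  shows "controlled A"
proof -
  obtain K where K: "K \<ge> 0" "\<And>v k. line_bounded (- P) v k \<Longrightarrow>
      Lp_int p (B - P) v \<le> ennreal K * energy v k"
    using B(2) by (rule controlledE) (rule that)
  have [measurable]: "A \<in> sets borel" "P \<in> sets borel"
    using A closed_P by auto
  define L where "L = (2 * (p - 1)) powr (p - 1) * norm w powr p * (1 / c) powr (p - 1 / 2) * (2 / c)"
  have L: "L \<ge> 0" using c by (simp add: L_def)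
  \<comment> \<open>The growth hypothesis at t = 1 makes the distance from \<open>P\<close>
    positive, so the translate lies off the holes.\<close>
  have xw: "x + w \<in> B - P" if "x \<in> A - P" for x
  proof -
    have "0 < c * (\<delta> x + 1)" using c infdist_nonneg[of x P] by (intro mult_pos_pos) auto
    also have "\<dots> \<le> \<delta> (x + 1 *\<^sub>R w)" using that by (intro H) auto
    finally show ?thesis using B(1)[OF that] by auto
  qed
  have "Lp_int p (A - P) v \<le> ennreal (2 powr p * (K + L)) * energy v k"
    if lb: "line_bounded (- P) v k" for v k
  proof -
    have [measurable]: "v \<in> borel_measurable borel" using lb by (simp add: line_bounded_def)
    have "Lp_int p (A - P) v \<le>
        (\<integral>\<^sup>+x. ennreal (2 powr p) * (ennreal (\<bar>v (x + w)\<bar> powr p) * indicator (A - P) x +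
          ennreal (\<bar>v (x + w) - v x\<bar> powr p) * indicator (A - P) x) \<partial>lborel)"
    proof (intro nn_integral_mono)
      fix x
      have "\<bar>v (x + w) + - (v (x + w) - v x)\<bar> powr p \<le>
          2 powr p * (\<bar>v (x + w)\<bar> powr p + \<bar>- (v (x + w) - v x)\<bar> powr p)"
        using p_gt_1 by (intro powr_add_le) auto
      then have "\<bar>v x\<bar> powr p \<le> 2 powr p * (\<bar>v (x + w)\<bar> powr p + \<bar>v (x + w) - v x\<bar> powr p)"
        by (simp add: abs_minus_commute)
      then have "ennreal (\<bar>v x\<bar> powr p) \<le> ennreal (2 powr p) * (ennreal (\<bar>v (x + w)\<bar> powr p) + ennreal (\<bar>v (x + w) - v x\<bar> powr p))"
        by (simp add: ennreal_mult[symmetric] ennreal_plus[symmetric] ennreal_leI del: ennreal_plus)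
      then show "ennreal (\<bar>v x\<bar> powr p) * indicator (A - P) x \<le>
        ennreal (2 powr p) * (ennreal (\<bar>v (x + w)\<bar> powr p) * indicator (A - P) x +
          ennreal (\<bar>v (x + w) - v x\<bar> powr p) * indicator (A - P) x)"
        by (auto simp: indicator_def)
    qed
    also have "\<dots> = ennreal (2 powr p) * ((\<integral>\<^sup>+x\<in>A - P. ennreal (\<bar>v (x + w)\<bar> powr p) \<partial>lborel) +
        (\<integral>\<^sup>+x\<in>A - P. ennreal (\<bar>v (x + w) - v x\<bar> powr p) \<partial>lborel))"
      by (simp add: nn_integral_cmult nn_integral_add)
    also have "\<dots> \<le> ennreal (2 powr p) * (ennreal K * energy v k + ennreal L * energy v k)"
    proof (intro mult_left_mono add_mono)
      have "(\<integral>\<^sup>+x\<in>A - P. ennreal (\<bar>v (x + w)\<bar> powr p) \<partial>lborel) =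
          (\<integral>\<^sup>+x. ennreal (\<bar>v x\<bar> powr p) * indicator (A - P) (x - w) \<partial>lborel)"
        using nn_integral_lborel_shift[of "\<lambda>x. ennreal (\<bar>v x\<bar> powr p) * indicator (A - P) (x - w)" w] by simp
      also have "\<dots> \<le> Lp_int p (B - P) v"
      proof (intro nn_integral_mono mult_left_mono)
        fix x show "indicator (A - P) (x - w) \<le> (indicator (B - P) x :: ennreal)"
          using xw[of "x - w"] by (auto simp: indicator_def)
      qed simp
      also have "\<dots> \<le> ennreal K * energy v k" by (rule K(2)[OF lb])
      finally show "(\<integral>\<^sup>+x\<in>A - P. ennreal (\<bar>v (x + w)\<bar> powr p) \<partial>lborel) \<le> ennreal K * energy v k" .
      have "(\<integral>\<^sup>+x\<in>A - P. ennreal (\<bar>v (x + w) - v x\<bar> powr p) \<partial>lborel) \<le>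
        ennreal L * (\<integral>\<^sup>+x. ennreal ((\<delta> x * k x) powr p) \<partial>lborel)"
        unfolding L_def by (rule hardy_translation[OF p_gt_1 closed_P P_ne lb _ _ c H]) auto
      also have "\<dots> \<le> ennreal L * energy v k"
        unfolding energy_def by (intro mult_left_mono) auto
      finally show "(\<integral>\<^sup>+x\<in>A - P. ennreal (\<bar>v (x + w) - v x\<bar> powr p) \<partial>lborel) \<le> ennreal L * energy v k" .
    qed simp
    also have "\<dots> = ennreal (2 powr p * (K + L)) * energy v k"
      using K(1) L by (simp add: ennreal_mult ennreal_plus distrib_right mult.assoc)
    finally show ?thesis .
  qed
  then show ?thesis
    unfolding controlled_def using K(1) L by (intro exI[of _ "2 powr p * (K + L)"]) auto
qed

text \<open>By periodicity of \<open>P\<close> and of the distance, growth on one ball is growth on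
  all its lattice copies, so \<open>controlled_translate\<close> applies to the periodised
  ball.\<close>

lemma good_translate:
  assumes c: "c > 0" and \<rho>: "\<rho> > 0"
    and H: "\<And>x t. x \<in> ball x0 \<rho> - P \<Longrightarrow> t \<in> {0..1} \<Longrightarrow> \<delta> (x + t *\<^sub>R w) \<ge> c * (\<delta> x + t)"
    and g: "good (x0 + w)"
  shows "good x0"
proof -
  obtain r where r: "r > 0" "controlled (periodize 1 (ball (x0 + w) r))"
    using g by (auto simp: good_def)
  have "controlled (periodize 1 (ball x0 (min \<rho> r)))"
  proof (rule controlled_translate[OF _ c _ _ r(2)])
    show "open (periodize 1 (ball x0 (min \<rho> r)))" by (intro open_periodize_1) auto
    fix x assume "x \<in> periodize 1 (ball x0 (min \<rho> r)) - P"
    then obtain z where z: "z \<in> int_lattice" "x - z \<in> ball x0 (min \<rho> r)" "x \<notin> P"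
      by (auto simp: mem_periodize_1)
    then have "x - z \<notin> P" using P_per[of z "x - z"] by simp
    then have "\<delta> (x - z + t *\<^sub>R w) \<ge> c * (\<delta> (x - z) + t)" if "t \<in> {0..1}" for t
      using H[of "x - z" t] that z by auto
    moreover have "\<delta> (x - z) = \<delta> x" using \<delta>_per[OF z(1), of "x - z"] by simp
    moreover have "\<delta> (x - z + t *\<^sub>R w) = \<delta> (x + t *\<^sub>R w)" for t
      using \<delta>_per[OF z(1), of "x - z + t *\<^sub>R w"] by (simp add: algebra_simps)
    ultimately show "\<delta> (x + t *\<^sub>R w) \<ge> c * (\<delta> x + t)" if "t \<in> {0..1}" for t using that by simp
    have "x + w - z \<in> ball (x0 + w) r"
      using z(2) by (simp add: dist_norm algebra_simps)
    then show "x + w \<in> periodize 1 (ball (x0 + w) r)" using z(1) by (auto simp: mem_periodize_1)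
  qed
  then show ?thesis unfolding good_def using \<rho> r(1) by (intro exI[of _ "min \<rho> r"]) auto
qed

text \<open>On a compact segment off \<open>P\<close> the distance has a positive minimum 2 r.
  Segments started within r of \<open>x\<close> therefore keep distance r, and since the distance is
  bounded above on that ball, the growth hypothesis holds once \<open>c\<close> is small.\<close>

lemma good_segment:
  assumes seg: "closed_segment x y \<subseteq> - P" and g: "good y"
  shows "good x"
proof -
  define w where "w = y - x"
  have y: "y = x + w" by (simp add: w_def)
  have "\<exists>q\<in>closed_segment x y. \<forall>q'\<in>closed_segment x y. \<delta> q \<le> \<delta> q'"
    by (intro continuous_attains_inf continuous_on_infdist continuous_on_id) auto
  then obtain q where q: "q \<in> closed_segment x y" "\<And>q'. q' \<in> closed_segment x y \<Longrightarrow> \<delta> q \<le> \<delta> q'"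
    by blast
  define r where "r = \<delta> q / 2"
  have r: "r > 0" using q(1) seg \<delta>_pos by (auto simp: r_def)
  \<comment> \<open>On the ball the distance is at most \<delta> x + r and t is at most 1, so
    \<open>c\<close> times their sum is at most r.\<close>
  define c where "c = r / (\<delta> x + r + 1)"
  have pos: "\<delta> x + r + 1 > 0" using r infdist_nonneg[of x P] by linarith
  have c: "c > 0" using r pos by (simp add: c_def)
  show ?thesis
  proof (rule good_translate[OF c r])
    show "good (x + w)" using g y by simp
    fix x' t assume x': "x' \<in> ball x r - P" and t: "t \<in> {0..1::real}"
    have lip: "\<delta> a \<le> \<delta> b + dist a b" for a b by (rule infdist_triangle)
    have "\<delta> x' \<le> \<delta> x + r" using lip[of x' x] x' by (simp add: dist_commute)
    then have "c * (\<delta> x' + t) \<le> c * (\<delta> x + r + 1)" using t c by (intro mult_left_mono) auto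
    also have "\<dots> = r" using pos by (simp add: c_def)
    also have "r \<le> \<delta> (x' + t *\<^sub>R w)"
    proof -
      have "x + t *\<^sub>R w \<in> closed_segment x y" using t unfolding y closed_segment_start by auto
      then have "2 * r \<le> \<delta> (x + t *\<^sub>R w)" using q(2) by (simp add: r_def)
      moreover have "dist (x + t *\<^sub>R w) (x' + t *\<^sub>R w) < r" using x' by simp
      ultimately show ?thesis using lip[of "x + t *\<^sub>R w" "x' + t *\<^sub>R w"] by linarith
    qed
    finally show "c * (\<delta> x' + t) \<le> \<delta> (x' + t *\<^sub>R w)" .
  qed
qed

lemma good_segment_iff: "closed_segment x y \<subseteq> - P \<Longrightarrow> good x \<longleftrightarrow> good y"
  using good_segment[of x y] good_segment[of y x] by (auto simp: closed_segment_commute)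

lemma good_G: "x \<in> G \<Longrightarrow> good x"
proof -
  assume "x \<in> G"
  then obtain \<rho> where \<rho>: "\<rho> > 0" "ball x \<rho> \<subseteq> G" using open_G openE by blast
  have "periodize 1 (ball x \<rho>) \<subseteq> G"
  proof
    fix y assume "y \<in> periodize 1 (ball x \<rho>)"
    then obtain z where "z \<in> int_lattice" "y - z \<in> G" using \<rho>(2) unfolding mem_periodize_1 by blast
    then show "y \<in> G" using G_per[of z "y - z"] by simp
  qed
  then show "good x"
    using \<rho>(1) controlled_subset[OF controlled_G] unfolding good_def by blast
qed

lemma good_interior: "x \<in> interior P \<Longrightarrow> good x"
proof -
  assume "x \<in> interior P"
  then obtain \<rho> where \<rho>: "\<rho> > 0" "ball x \<rho> \<subseteq> P" by (auto simp: mem_interior)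
  have "periodize 1 (ball x \<rho>) \<subseteq> P"
  proof
    fix y assume "y \<in> periodize 1 (ball x \<rho>)"
    then obtain z where "z \<in> int_lattice" "y - z \<in> P" using \<rho>(2) unfolding mem_periodize_1 by blast
    then show "y \<in> P" using P_per[of z "y - z"] by simp
  qed
  then show "good x" using \<rho>(1) controlled_empty unfolding good_def by blast
qed

lemma good_shift: assumes "z \<in> int_lattice" shows "good (x + z) \<longleftrightarrow> good x"
proof -
  have "periodize 1 (ball (x + z) \<rho>) = periodize 1 (ball x \<rho>)" for \<rho>
  proof (intro set_eqI)
    fix y
    have "y \<in> periodize 1 (ball (x + z) \<rho>) \<longleftrightarrow> y - z \<in> periodize 1 (ball x \<rho>)"
      unfolding mem_periodize_1 by (simp add: dist_norm algebra_simps)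
    also have "\<dots> \<longleftrightarrow> y \<in> periodize 1 (ball x \<rho>)"
      using periodize_1_shift_iff[OF assms, of "y - z"] by simp
    finally show "y \<in> periodize 1 (ball (x + z) \<rho>) \<longleftrightarrow> y \<in> periodize 1 (ball x \<rho>)" .
  qed
  then show ?thesis by (simp add: good_def)
qed

text \<open>Compactness of the closed cell turns goodness of all points into finitely many
  controlled sets, whose periodisations cover the space.\<close>

lemma controlled_UNIV:
  assumes "\<And>x. good x"
  shows "controlled UNIV"
proof -
  obtain \<rho> where \<rho>: "\<And>x. \<rho> x > 0" "\<And>x. controlled (periodize 1 (ball x (\<rho> x)))"
    using assms unfolding good_def by metis
  let ?Y = "cbox (- (1 / 2) *\<^sub>R One) ((1 / 2) *\<^sub>R One) :: 'a set"
  obtain D where D: "finite D" "?Y \<subseteq> (\<Union>x\<in>D. ball x (\<rho> x))"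
  proof (rule compactE_image[of ?Y ?Y "\<lambda>x. ball x (\<rho> x)"])
    show "?Y \<subseteq> (\<Union>x\<in>?Y. ball x (\<rho> x))" using \<rho>(1) by auto
  qed auto
  have "controlled (\<Union>x\<in>D. periodize 1 (ball x (\<rho> x)))"
    using D(1) \<rho>(2) by (intro controlled_UN) (auto intro!: open_periodize_1)
  moreover have "UNIV - P \<subseteq> (\<Union>x\<in>D. periodize 1 (ball x (\<rho> x)))"
  proof
    fix y
    obtain z where z: "z \<in> int_lattice" "y - z \<in> ?Y" using int_lattice_cell by blast
    then obtain x where "x \<in> D" "y - z \<in> ball x (\<rho> x)" using D(2) by blast
    then show "y \<in> (\<Union>x\<in>D. periodize 1 (ball x (\<rho> x)))" using z(1) by (auto simp: mem_periodize_1 simp del: mem_ball)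
  qed
  ultimately show ?thesis by (rule controlled_subset)
qed

end

section \<open>Smooth boundaries and the periodicity cell\<close>

lemma smooth_on_deriv_continuous:
  assumes "smooth_on S g" "open S"
  shows "continuous_on S (\<lambda>y. frechet_derivative g (at y) v)"
proof -
  have eq: "frechet_derivative g (at y) v = (\<Sum>b\<in>Basis. (v \<bullet> b) * frechet_derivative g (at y) b)" if "y \<in> S" for y
    using assms(1) that by (intro linear_real_basis_expansion has_derivative_linear[OF Ck_on_has_derivative[of 0 S]])
      (auto simp: smooth_on_def simp del: Ck_on.simps)
  have "Ck_on (Suc (Suc 0)) S g" using assms(1) unfolding smooth_on_def by blast
  then have "continuous_on S (\<lambda>y. frechet_derivative g (at y) b)" if "b \<in> Basis" for b
    using that by (auto intro!: continuous_at_imp_continuous_on differentiable_imp_continuous_within)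
  then have "continuous_on S (\<lambda>y. \<Sum>b\<in>Basis. (v \<bullet> b) * frechet_derivative g (at y) b)"
    by (intro continuous_intros)
  then show ?thesis by (rule continuous_on_eq) (simp add: eq)
qed

text \<open>A defining function \<open>g\<close> of \<open>U\<close> near a boundary point is comparable to the distance
  from \<open>U\<close>, and grows at a linear rate along a direction \<open>e\<close> transversal to the boundary.\<close>

lemma smooth_boundary_escape:
  fixes U P :: "'a::euclidean_space set"
  assumes U: "open U" "smooth_boundary U" and x0: "x0 \<in> frontier U"
    and r0: "r0 > 0" "P \<inter> ball x0 r0 = closure U \<inter> ball x0 r0"
  obtains w \<rho> c where "\<rho> > 0" "c > 0"
    "\<And>x t. x \<in> ball x0 \<rho> - P \<Longrightarrow> t \<in> {0..1} \<Longrightarrow> infdist (x + t *\<^sub>R w) P \<ge> c * (infdist x P + t)"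
    "x0 \<in> closure (- P)"
proof -
  obtain r g where r: "r > 0" and g: "smooth_on (ball x0 r) g"
    and dg: "frechet_derivative g (at x0) \<noteq> (\<lambda>v. 0)"
    and Ug: "U \<inter> ball x0 r = {y \<in> ball x0 r. g y < 0}"
  proof -
    obtain r g where *: "r > 0" "smooth_on (ball x0 r) g"
        "\<forall>y\<in>ball x0 r. frechet_derivative g (at y) \<noteq> (\<lambda>v. 0)" "U \<inter> ball x0 r = {y \<in> ball x0 r. g y < 0}"
      using U(2) x0 unfolding smooth_boundary_def by blast
    show thesis by (rule that[of r g]) (use * in auto)
  qed
  define D where "D y = frechet_derivative g (at y)" for y
  have hd: "(g has_derivative D y) (at y)" if "y \<in> ball x0 r" for y
    unfolding D_def using g that by (intro Ck_on_has_derivative[of 0 "ball x0 r"]) (auto simp: smooth_on_def simp del: Ck_on.simps)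
  obtain v where "D x0 v \<noteq> 0" using dg by (auto simp: D_def fun_eq_iff)
  \<comment> \<open>Replacing v by -v if necessary makes g increase along e.\<close>
  then obtain e where e: "D x0 e > 0"
    using has_derivative_linear[OF hd[of x0]] r linear_neg[of "D x0" v]
    by (cases "D x0 v > 0") (auto simp: not_less_iff_gr_or_eq neg_0_less_iff_less intro: that[of v] that[of "- v"])
  have e0: "e \<noteq> 0" using e has_derivative_linear[OF hd[of x0]] r linear_0 by fastforce
  \<comment> \<open>Half the slope at \<open>x0\<close>: by continuity g still grows along e at a
    rate above \<open>a\<close> in a whole neighbourhood.\<close>
  define a where "a = D x0 e / 2"
  have a: "a > 0" using e by (simp add: a_def)
  \<comment> \<open>A Lipschitz constant of g near \<open>x0\<close>: each partial derivative may
    exceed its value at \<open>x0\<close> by 1. The leading 1 gives L >= 1.\<close>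
  define L where "L = 1 + (\<Sum>b\<in>Basis. \<bar>D x0 b\<bar> + 1)"
  have L: "L \<ge> 1" by (auto simp: L_def intro!: sum_nonneg)
  have cont: "((\<lambda>y. D y v) \<longlongrightarrow> D x0 v) (nhds x0)" for v
  proof -
    have "continuous (at x0) (\<lambda>y. D y v)"
      using smooth_on_deriv_continuous[OF g, of v] r
      by (simp add: D_def continuous_on_eq_continuous_at)
    then show ?thesis using tendsto_at_iff_tendsto_nhds[of "\<lambda>y. D y v" x0] by (simp add: continuous_at)
  qed
  have "\<forall>\<^sub>F y in nhds x0. a < D y e"
    using cont[of e] e by (intro order_tendstoD) (auto simp: a_def)
  moreover have "\<forall>\<^sub>F y in nhds x0. \<forall>b\<in>Basis. \<bar>D y b\<bar> < \<bar>D x0 b\<bar> + 1"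
    by (intro eventually_ball_finite ballI order_tendstoD(2)[OF tendsto_rabs[OF cont]]) auto
  moreover have "\<forall>\<^sub>F y in nhds x0. y \<in> ball x0 (min r r0)"
    using r r0 by (intro eventually_nhds_in_open) auto
  ultimately have "\<forall>\<^sub>F y in nhds x0. a < D y e \<and> (\<forall>b\<in>Basis. \<bar>D y b\<bar> < \<bar>D x0 b\<bar> + 1) \<and> y \<in> ball x0 (min r r0)"
    by eventually_elim auto
  then obtain r1 where r1: "r1 > 0" "\<And>y. y \<in> ball x0 r1 \<Longrightarrow> a < D y e"
      "\<And>y b. y \<in> ball x0 r1 \<Longrightarrow> b \<in> Basis \<Longrightarrow> \<bar>D y b\<bar> < \<bar>D x0 b\<bar> + 1"
      "\<And>y. y \<in> ball x0 r1 \<Longrightarrow> y \<in> ball x0 r" "\<And>y. y \<in> ball x0 r1 \<Longrightarrow> y \<in> ball x0 r0"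
    by (auto simp: eventually_nhds_metric dist_commute)
  have grow: "g (y + t *\<^sub>R e) \<ge> g y + a * t" if "y \<in> ball x0 r1" "y + t *\<^sub>R e \<in> ball x0 r1" "t \<ge> 0" for y t
  proof -
    have seg: "y + s *\<^sub>R e \<in> ball x0 r1" if "0 \<le> s" "s \<le> t" for s
    proof -
      have "y + s *\<^sub>R e \<in> closed_segment (y + 0 *\<^sub>R e) (y + t *\<^sub>R e)"
        using that \<open>t \<ge> 0\<close> by (subst closed_segment_on_line) auto
      then show ?thesis
        using convex_contains_segment[of "ball x0 r1"] \<open>y \<in> ball x0 r1\<close> \<open>y + t *\<^sub>R e \<in> ball x0 r1\<close>
        by (auto simp del: mem_ball)
    qed
    have "g (y + 0 *\<^sub>R e) - a * 0 \<le> g (y + t *\<^sub>R e) - a * t"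
    proof (rule DERIV_nonneg_imp_nondecreasing[OF that(3)])
      fix s assume s: "0 \<le> s" "s \<le> t"
      have "((\<lambda>s. g (y + s *\<^sub>R e)) has_derivative (\<lambda>h. D (y + s *\<^sub>R e) (h *\<^sub>R e))) (at s)"
        by (rule has_derivative_compose[where g = g and f = "\<lambda>s. y + s *\<^sub>R e", OF _ hd[OF r1(4)[OF seg[OF s]]]])
          (auto intro!: derivative_eq_intros)
      moreover have "D (y + s *\<^sub>R e) (h *\<^sub>R e) = D (y + s *\<^sub>R e) e * h" for h
        using has_derivative_linear[OF hd[OF r1(4)[OF seg[OF s]]]] by (simp add: linear_cmul)
      ultimately have "((\<lambda>s. g (y + s *\<^sub>R e)) has_real_derivative D (y + s *\<^sub>R e) e) (at s)"
        by (simp add: has_field_derivative_def)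
      then have "((\<lambda>s. g (y + s *\<^sub>R e) - a * s) has_real_derivative D (y + s *\<^sub>R e) e - a) (at s)"
        by (auto intro!: derivative_eq_intros)
      then show "\<exists>d. ((\<lambda>s. g (y + s *\<^sub>R e) - a * s) has_real_derivative d) (at s) \<and> 0 \<le> d"
        using r1(2)[OF seg[OF s]] by (intro exI[of _ "D (y + s *\<^sub>R e) e - a"]) auto
    qed
    then show ?thesis by simp
  qed
  have lip: "\<bar>g y - g y'\<bar> \<le> L * dist y y'" if "y \<in> ball x0 r1" "y' \<in> ball x0 r1" for y y'
  proof -
    have "norm (g y - g y') \<le> L * norm (y - y')"
    proof (rule differentiable_bound[of "ball x0 r1" g D])
      fix x assume x: "x \<in> ball x0 r1"
      show "(g has_derivative D x) (at x within ball x0 r1)"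
        using hd[OF r1(4)[OF x]] by (rule has_derivative_at_withinI)
      show "onorm (D x) \<le> L"
      proof (rule onorm_le)
        fix v
        have "D x v = (\<Sum>b\<in>Basis. (v \<bullet> b) * D x b)"
          by (rule linear_real_basis_expansion[OF has_derivative_linear[OF hd[OF r1(4)[OF x]]]])
        then have "norm (D x v) \<le> (\<Sum>b\<in>Basis. \<bar>(v \<bullet> b) * D x b\<bar>)"
          by (simp add: sum_abs)
        also have "\<dots> \<le> (\<Sum>b\<in>Basis. norm v * (\<bar>D x0 b\<bar> + 1))"
          using r1(3)[OF x] by (auto intro!: sum_mono mult_mono Basis_le_norm simp: abs_mult less_imp_le)
        also have "\<dots> = norm v * (\<Sum>b\<in>Basis. \<bar>D x0 b\<bar> + 1)" by (simp add: sum_distrib_left)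
        also have "\<dots> \<le> L * norm v" by (simp add: L_def algebra_simps)
        finally show "norm (D x v) \<le> L * norm v" .
      qed
    qed (use that in auto)
    then show ?thesis by (simp add: dist_norm)
  qed
  have gcont: "continuous_on (ball x0 r) g"
    using hd by (intro continuous_at_imp_continuous_on ballI has_derivative_continuous)
  have nonpos: "g y \<le> 0" if "y \<in> closure U" "y \<in> ball x0 r" for y
  proof (rule ccontr)
    assume "\<not> g y \<le> 0"
    then have "y \<in> ball x0 r \<inter> g -` {0<..}" using that(2) by auto
    moreover have "open (ball x0 r \<inter> g -` {0<..})"
      using gcont by (rule continuous_open_preimage) auto
    ultimately have "U \<inter> (ball x0 r \<inter> g -` {0<..}) \<noteq> {}"
      using that(1) open_Int_closure_eq_empty[of "ball x0 r \<inter> g -` {0<..}" U] by blast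
    then obtain z where z: "z \<in> U" "z \<in> ball x0 r" "z \<in> g -` {0<..}" by blast
    then have "g z < 0" using Ug by blast
    then show False using z(3) by simp
  qed
  have gx0: "g x0 = 0"
  proof (rule antisym)
    show "g x0 \<le> 0" using x0 r by (intro nonpos) (auto simp: frontier_def)
    have "x0 \<notin> U" using x0 U(1) by (simp add: frontier_def interior_open)
    then have "x0 \<notin> {y \<in> ball x0 r. g y < 0}" using Ug by blast
    then show "0 \<le> g x0" using r by simp
  qed
  have P_iff: "y \<in> P \<longleftrightarrow> g y \<le> 0" if y: "y \<in> ball x0 r1" for y
  proof -
    have "y \<in> P \<longleftrightarrow> y \<in> closure U" using r0(2) r1(5)[OF y] by blast
    also have "\<dots> \<longleftrightarrow> g y \<le> 0"
    proof
      show "y \<in> closure U \<Longrightarrow> g y \<le> 0" using nonpos r1(4)[OF y] by blast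
      assume gy: "g y \<le> 0"
      show "y \<in> closure U"
        unfolding closure_approachable
      proof (intro allI impI)
        \<comment> \<open>A short step backwards along e makes g strictly negative, so points with g
          = 0 are limits of points of \<open>U\<close>.\<close>
        fix \<epsilon> :: real assume \<epsilon>: "\<epsilon> > 0"
        obtain d where d: "d > 0" "ball y d \<subseteq> ball x0 r1" using y openE[OF open_ball] by metis
        define t where "t = min \<epsilon> d / (2 * norm e)"
        have t: "t > 0" "t * norm e < \<epsilon>" "t * norm e < d" using \<epsilon> d e0 by (auto simp: t_def)
        have "y - t *\<^sub>R e \<in> ball y d" using t by (simp add: dist_norm)
        then have yt: "y - t *\<^sub>R e \<in> ball x0 r1" using d(2) by blast
        have "a * t > 0" using a t by simp
        then have "g (y - t *\<^sub>R e) < 0" using grow[OF yt, of t] y t(1) gy by simp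
        then have "y - t *\<^sub>R e \<in> U" using Ug r1(4)[OF yt] by blast
        moreover have "dist (y - t *\<^sub>R e) y < \<epsilon>" using t by (simp add: dist_norm)
        ultimately show "\<exists>z\<in>U. dist z y < \<epsilon>" by blast
      qed
    qed
    finally show ?thesis .
  qed
  have x0_cl: "x0 \<in> closure (- P)"
    unfolding closure_approachable
  proof (intro allI impI)
    fix \<epsilon> :: real assume \<epsilon>: "\<epsilon> > 0"
    define t where "t = min \<epsilon> r1 / (2 * norm e)"
    have t: "t > 0" "t * norm e < \<epsilon>" "t * norm e < r1" using \<epsilon> r1(1) e0 by (auto simp: t_def)
    have yt: "x0 + t *\<^sub>R e \<in> ball x0 r1" using t by (simp add: dist_norm)
    have "a * t > 0" using a t by simp
    then have "g (x0 + t *\<^sub>R e) > 0" using grow[OF _ yt] r1(1) t(1) gx0 by simp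
    then have "x0 + t *\<^sub>R e \<in> - P" using P_iff[OF yt] by simp
    moreover have "dist (x0 + t *\<^sub>R e) x0 < \<epsilon>" using t by (simp add: dist_norm)
    ultimately show "\<exists>z\<in>- P. dist z x0 < \<epsilon>" by blast
  qed
  have Pne: "P \<noteq> {}" using P_iff[of x0] r1(1) gx0 by auto
  \<comment> \<open>On \<open>P\<close> near \<open>x0\<close> the function g is nonpositive, so the
    Lipschitz bound separates y from it. On the halved ball, points of \<open>P\<close> outside the
    larger ball are too far away to matter.\<close>
  have lower: "infdist y P \<ge> g y / L" if y: "y \<in> ball x0 (r1 / 2)" for y
  proof -
    have "g y / L \<le> dist y q" if q: "q \<in> P" for q
    proof (cases "q \<in> ball x0 r1")
      case True
      then have "g y \<le> L * dist y q"
        using lip[of y q] y P_iff[OF True] q r1(1) by auto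
      then show ?thesis using L by (simp add: field_simps)
    next
      case False
      then have "r1 / 2 \<le> dist y q"
        using y dist_triangle[of x0 q y] by (auto simp: dist_commute)
      have "g y \<le> L * (r1 / 2)"
      proof -
        have "g y \<le> L * dist y x0" using lip[of y x0] y gx0 r1(1) by auto
        also have "\<dots> \<le> L * (r1 / 2)" using y L by (intro mult_left_mono) (auto simp: dist_commute)
        finally show ?thesis .
      qed
      then have "g y / L \<le> r1 / 2" using L by (simp add: field_simps)
      with \<open>r1 / 2 \<le> dist y q\<close> show ?thesis by (rule order_trans[rotated])
    qed
    then show ?thesis unfolding infdist_notempty[OF Pne] by (intro cINF_greatest[OF Pne])
  qed
  \<comment> \<open>\<open>\<rho>\<close> leaves room to step back from the ball to \<open>P\<close>
    along e, a length of at most L * \<rho> * norm e / a; together they make r1/4. The translation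
    by \<open>R\<close> e has length r1/4 and so stays where \<open>lower\<close> applies.
    \<open>c\<close> is the smaller of the rates at which g / L dominates the distance and the
    time.\<close>
  define \<rho> where "\<rho> = r1 / (4 * (1 + L * norm e / a))"
  define R where "R = r1 / (4 * norm e)"
  define c where "c = a / L * min (1 / norm e) R"
  have k0: "L * norm e / a \<ge> 0" using L a by simp
  have \<rho>: "\<rho> > 0" "\<rho> \<le> r1 / 4" "\<rho> * (1 + L * norm e / a) = r1 / 4"
  proof -
    show "\<rho> > 0" using k0 r1(1) by (auto simp: \<rho>_def intro!: divide_pos_pos)
    show "\<rho> \<le> r1 / 4" unfolding \<rho>_def using k0 r1(1) by (intro divide_left_mono) auto
    have "1 + L * norm e / a \<noteq> 0" using k0 by linarith
    then show "\<rho> * (1 + L * norm e / a) = r1 / 4" 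
      unfolding \<rho>_def times_divide_eq_left by (rule nonzero_mult_divide_mult_cancel_right)
  qed
  have R: "R > 0" "R * norm e = r1 / 4" using r1(1) e0 by (auto simp: R_def)
  have c: "c > 0" using a L R e0 by (simp add: c_def)
  show thesis
  proof (rule that[OF \<rho>(1) c _ x0_cl, of "R *\<^sub>R e"])
    fix x t assume x: "x \<in> ball x0 \<rho> - P" and t: "t \<in> {0..1::real}"
    have xr: "x \<in> ball x0 r1" using x \<rho>(2) r1(1) by auto
    then have gx: "g x > 0" using P_iff[of x] x by auto
    have upper: "infdist x P \<le> g x * norm e / a"
    proof -
      \<comment> \<open>Going back along e by this parameter lowers g to at most 0 and so lands in
        \<open>P\<close>.\<close>
      define s where "s = g x / a"
      have s: "s \<ge> 0" using gx a by (simp add: s_def)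
      have "g x \<le> L * \<rho>"
      proof -
        have "g x \<le> L * dist x x0" using lip[OF xr, of x0] r1(1) gx0 by auto
        also have "\<dots> \<le> L * \<rho>" using x L by (intro mult_left_mono) (auto simp: dist_commute)
        finally show ?thesis .
      qed
      then have "s * norm e \<le> L * \<rho> / a * norm e"
        using a by (intro mult_right_mono) (auto simp: s_def divide_right_mono)
      moreover have "\<rho> * (1 + L * norm e / a) = \<rho> + L * \<rho> / a * norm e" by (simp add: algebra_simps)
      ultimately have "\<rho> + s * norm e \<le> r1 / 4" using \<rho>(3) by linarith
      then have xs: "x - s *\<^sub>R e \<in> ball x0 r1"
        using x s r1(1) dist_triangle[of x0 "x - s *\<^sub>R e" x] by (simp add: dist_norm)
      have "g (x - s *\<^sub>R e) \<le> 0" using grow[OF xs, of s] xr s a by (simp add: s_def)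
      then have "infdist x P \<le> dist x (x - s *\<^sub>R e)" using P_iff[OF xs] by (intro infdist_le) auto
      then show ?thesis using gx a by (simp add: dist_norm s_def)
    qed
    let ?y = "x + t *\<^sub>R R *\<^sub>R e"
    have "dist x0 ?y \<le> dist x0 x + t * (R * norm e)"
      using dist_triangle[of x0 ?y x] t R by (simp add: dist_norm)
    also have "\<dots> \<le> dist x0 x + 1 * (R * norm e)"
      using t R by (intro add_left_mono mult_right_mono) auto
    also have "\<dots> < r1 / 2" using x \<rho>(2) R(2) by simp
    finally have y: "?y \<in> ball x0 (r1 / 2)" by simp
    have "c * (infdist x P + t) = a / L * (min (1 / norm e) R * infdist x P + min (1 / norm e) R * t)"
      by (simp only: c_def distrib_left mult.assoc)
    also have "\<dots> \<le> a / L * (1 / norm e * infdist x P + R * t)"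
      using a L t infdist_nonneg[of x P] by (intro mult_left_mono add_mono mult_right_mono) auto
    also have "\<dots> \<le> a / L * (g x / a + R * t)"
      using upper a L e0 by (intro mult_left_mono add_right_mono) (auto simp: field_simps)
    also have "\<dots> = (g x + a * (t * R)) / L" using a L by (simp add: field_simps)
    also have "\<dots> \<le> g ?y / L"
      using grow[OF xr, of "t * R"] y r1(1) t R L by (intro divide_right_mono) auto
    also have "\<dots> \<le> infdist ?y P" by (rule lower[OF y])
    finally show "c * (infdist x P + t) \<le> infdist ?y P" .
  qed
qed

lemma closed_int_lattice: "closed (int_lattice :: 'a::euclidean_space set)"
proof -
  have "int_lattice = (\<Inter>b\<in>(Basis :: 'a set). (\<lambda>z. z \<bullet> b) -` \<int>)"
    by (auto simp: int_lattice_def)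
  also have "closed \<dots>"
    by (intro closed_INT ballI closed_vimage closed_Ints) (auto intro: continuous_intros)
  finally show ?thesis .
qed

lemma cube_Y_eq_box: "cube_Y = box (- (1 / 2) *\<^sub>R One) ((1 / 2) *\<^sub>R (One :: 'a::euclidean_space))"
proof -
  have *: "\<bar>t\<bar> < 1 / 2 \<longleftrightarrow> - (1 / 2) < t \<and> t < 1 / 2" for t :: real by linarith
  show ?thesis unfolding cube_Y_def box_def * by simp
qed

lemma frontier_cube_Y:
  "frontier cube_Y = cbox (- (1 / 2) *\<^sub>R One) ((1 / 2) *\<^sub>R (One :: 'a::euclidean_space)) - cube_Y"
  unfolding cube_Y_eq_box frontier_box by (auto simp: box_eq_empty)

section \<open>Geometry of the periodic holes\<close>

locale holes =
  fixes \<tau> :: "nat \<Rightarrow> 'a::euclidean_space set" and m :: nat and c0 :: real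
  assumes c0: "c0 > 0" and m: "m \<ge> 1"
    and holes: "\<And>i. i < m \<Longrightarrow> open (\<tau> i) \<and> \<tau> i \<noteq> {} \<and> \<tau> i \<subseteq> cube_Y \<and>
                  smooth_boundary (\<tau> i) \<and> connected (frontier (\<tau> i)) \<and>
                  setdist (\<tau> i) (frontier cube_Y) \<ge> c0"
    and holes_sep: "\<And>i j. i < m \<Longrightarrow> j < m \<Longrightarrow> i \<noteq> j \<Longrightarrow> setdist (\<tau> i) (\<tau> j) \<ge> c0"
begin

definition T :: "'a set" where "T = (\<Union>i<m. closure (\<tau> i))"

definition P :: "'a set" where "P = periodize 1 T"

text \<open>Layers around all cell walls with normal \<open>b\<close>. The holes stay
  \<open>c0\<close> away from the walls, so half of that gap is left between the layers and
  \<open>P\<close>.\<close>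

definition slab :: "'a \<Rightarrow> 'a set" where
  "slab b = {x. \<exists>n::int. \<bar>x \<bullet> b - of_int n - 1 / 2\<bar> < c0 / 2}"

text \<open>Moving a point of the hole along \<open>b\<close> to the nearer wall gives a frontier
  point of the cell at distance 1/2 minus the absolute value of its coordinate.\<close>

lemma closure_hole_bound:
  assumes i: "i < m" and y: "y \<in> closure (\<tau> i)" and b: "b \<in> Basis"
  shows "\<bar>y \<bullet> b\<bar> \<le> 1 / 2 - c0"
proof -
  have bound: "\<bar>y \<bullet> b\<bar> \<le> 1 / 2 - c0" if y: "y \<in> \<tau> i" for y
  proof -
    have yb: "\<bar>y \<bullet> a\<bar> < 1 / 2" if "a \<in> Basis" for a using holes[OF i] y that by (auto simp: cube_Y_def)
    have yb': "- (1 / 2) \<le> y \<bullet> a \<and> y \<bullet> a \<le> 1 / 2" if "a \<in> Basis" for a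
      using yb[OF that] by linarith
    define s :: real where "s = (if y \<bullet> b \<ge> 0 then 1 else -1)"
    define q where "q = y + (s / 2 - y \<bullet> b) *\<^sub>R b"
    have qa: "q \<bullet> a = (if a = b then s / 2 else y \<bullet> a)" if "a \<in> Basis" for a
      using that b by (simp add: q_def inner_add_left inner_Basis)
    have "q \<in> frontier cube_Y"
      unfolding frontier_cube_Y
    proof
      show "q \<in> cbox (- (1 / 2) *\<^sub>R One) ((1 / 2) *\<^sub>R One)"
        unfolding mem_box using yb' by (auto simp: qa s_def)
      have "\<bar>q \<bullet> b\<bar> = 1 / 2" using qa[OF b] by (auto simp: s_def split: if_splits)
      then show "q \<notin> cube_Y" using b unfolding cube_Y_def by (auto intro!: bexI[of _ b])
    qed
    then have "setdist (\<tau> i) (frontier cube_Y) \<le> dist y q" using y by (rule setdist_le_dist[rotated])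
    then have "c0 \<le> dist y q" using holes[OF i] by linarith
    also have "\<dots> = \<bar>s / 2 - y \<bullet> b\<bar>" using b by (simp add: q_def dist_norm)
    finally show ?thesis using yb[OF b] by (auto simp: s_def split: if_splits)
  qed
  have "closed {y. \<bar>y \<bullet> b\<bar> \<le> 1 / 2 - c0}"
    by (intro closed_Collect_le continuous_intros)
  then have "closure (\<tau> i) \<subseteq> {y. \<bar>y \<bullet> b\<bar> \<le> 1 / 2 - c0}"
    using bound by (intro closure_minimal) auto
  then show ?thesis using y by auto
qed

lemma T_bound: "y \<in> T \<Longrightarrow> b \<in> Basis \<Longrightarrow> \<bar>y \<bullet> b\<bar> \<le> 1 / 2 - c0"
  unfolding T_def using closure_hole_bound by auto

lemma T_subset_cube: "T \<subseteq> cube_Y"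
proof
  fix y assume "y \<in> T"
  then have "\<bar>y \<bullet> b\<bar> < 1 / 2" if "b \<in> Basis" for b
    using T_bound[OF _ that, of y] c0 by linarith
  then show "y \<in> cube_Y" by (simp add: cube_Y_def)
qed

lemma compact_T: "compact T"
proof -
  have "bounded T" using T_subset_cube bounded_box by (metis bounded_subset cube_Y_eq_box)
  moreover have "closed T" unfolding T_def by (intro closed_UN) auto
  ultimately show ?thesis by (simp add: compact_eq_bounded_closed)
qed

lemma T_nonempty: "T \<noteq> {}"
  using holes[of 0] m closure_subset[of "\<tau> 0"] by (force simp: T_def)

lemma T_subset_P: "T \<subseteq> P"
  unfolding P_def by (rule subset_periodize_1)

lemma closed_P: "closed P"
proof -
  have "closed (\<Union>x\<in>int_lattice. \<Union>y\<in>T. {x + y})"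
    by (rule closed_compact_sums[OF closed_int_lattice compact_T])
  also have "(\<Union>x\<in>int_lattice. \<Union>y\<in>T. {x + y}) = P"
    by (auto simp: P_def periodize_def)
  finally show ?thesis .
qed

lemma P_shift_iff: "z \<in> int_lattice \<Longrightarrow> x + z \<in> P \<longleftrightarrow> x \<in> P"
  unfolding P_def by (rule periodize_1_shift_iff)

lemma lattice_large:
  assumes "z \<in> int_lattice" "z \<noteq> (0::'a)"
  obtains b where "b \<in> Basis" "\<bar>z \<bullet> b\<bar> \<ge> 1"
proof -
  obtain b where b: "b \<in> Basis" "z \<bullet> b \<noteq> 0" using assms(2) by (auto simp: euclidean_eq_iff[of z])
  moreover from assms(1) b(1) obtain n where "z \<bullet> b = of_int n" by (auto simp: int_lattice_def Ints_def)
  ultimately show thesis by (intro that[of b]) auto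
qed

text \<open>Holes in different lattice cells are at least 2 c0 apart and different holes in one cell
  at least c0, so near one hole only that hole is seen.\<close>

lemma P_local:
  assumes i: "i < m" and x: "x \<in> closure (\<tau> i)" and y: "y \<in> P" "dist x y < c0"
  shows "y \<in> closure (\<tau> i)"
proof -
  obtain z j where z: "z \<in> int_lattice" and j: "j < m" "y - z \<in> closure (\<tau> j)"
    using y(1) unfolding P_def mem_periodize_1 T_def by auto
  have z0: "z = 0"
  proof (rule ccontr)
    assume "z \<noteq> 0"
    then obtain b where b: "b \<in> Basis" "\<bar>z \<bullet> b\<bar> \<ge> 1" using lattice_large[OF z] by blast
    have "\<bar>x \<bullet> b\<bar> \<le> 1 / 2 - c0" "\<bar>(y - z) \<bullet> b\<bar> \<le> 1 / 2 - c0"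
      using closure_hole_bound[OF i x b(1)] closure_hole_bound[OF j b(1)] by auto
    moreover have "\<bar>(x - y) \<bullet> b\<bar> < c0"
      using Basis_le_norm[OF b(1), of "x - y"] y(2) by (simp add: dist_norm)
    ultimately show False using b(2) c0 unfolding inner_diff_left by linarith
  qed
  have "j = i"
  proof (rule ccontr)
    assume "j \<noteq> i"
    then have "c0 \<le> setdist (closure (\<tau> i)) (closure (\<tau> j))"
      using holes_sep[OF i j(1)] by (simp add: setdist_closure_1 setdist_closure_2)
    also have "\<dots> \<le> dist x y" using x j(2) z0 by (intro setdist_le_dist) auto
    finally show False using y(2) by simp
  qed
  then show ?thesis using j(2) z0 by simp
qed

text \<open>The growth estimate speaks of points off \<open>P\<close> only. Letting such points tend
  to \<open>x0\<close> shows that the translate of \<open>x0\<close> itself lands at distance at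
  least \<open>c\<close> from \<open>P\<close>.\<close>

lemma escape:
  assumes i: "i < m" and x0: "x0 \<in> frontier (\<tau> i)"
  obtains w \<rho> c where "\<rho> > 0" "c > 0"
    "\<And>x t. x \<in> ball x0 \<rho> - P \<Longrightarrow> t \<in> {0..1} \<Longrightarrow> infdist (x + t *\<^sub>R w) P \<ge> c * (infdist x P + t)"
    "x0 \<in> closure (- P)" "c \<le> infdist (x0 + w) P"
proof (rule smooth_boundary_escape[of "\<tau> i" x0 c0 P])
  have "x0 \<in> closure (\<tau> i)" using x0 by (simp add: frontier_def)
  moreover have "closure (\<tau> i) \<subseteq> P" using i T_subset_P by (auto simp: T_def)
  ultimately show "P \<inter> ball x0 c0 = closure (\<tau> i) \<inter> ball x0 c0"
    using P_local[OF i] by auto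
next
  fix w \<rho> c
  assume \<rho>: "\<rho> > 0" and c: "c > 0" and cl: "x0 \<in> closure (- P)"
    and H: "\<And>x t. x \<in> ball x0 \<rho> - P \<Longrightarrow> t \<in> {0..1} \<Longrightarrow> infdist (x + t *\<^sub>R w) P \<ge> c * (infdist x P + t)"
  have low: "c \<le> infdist (x0 + w) P"
  proof (rule field_le_epsilon)
    fix \<epsilon> :: real assume \<epsilon>: "\<epsilon> > 0"
    obtain y where y: "y \<in> - P" "dist y x0 < min \<rho> \<epsilon>"
      using cl \<epsilon> \<rho> unfolding closure_approachable by (metis min_less_iff_conj)
    then have "c * (infdist y P + 1) \<le> infdist (y + 1 *\<^sub>R w) P" by (intro H) (auto simp: dist_commute)
    moreover have "c * 1 \<le> c * (infdist y P + 1)" using c infdist_nonneg[of y P] by (intro mult_left_mono) auto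
    moreover have "infdist (y + w) P \<le> infdist (x0 + w) P + dist (y + w) (x0 + w)" by (rule infdist_triangle)
    moreover have "dist (y + w) (x0 + w) < \<epsilon>" using y(2) by simp
    ultimately show "c \<le> infdist (x0 + w) P + \<epsilon>" by simp
  qed
  show thesis by (rule that[OF \<rho> c H cl low])
qed (use holes[OF i] x0 c0 in auto)

text \<open>On a line a connected frontier is convex. But leaving the bounded hole from an inner
  point in both directions meets the frontier on both sides, so that the inner point would be a
  frontier point.\<close>

lemma DIM_ge_2: "DIM('a) \<ge> 2"
proof (rule ccontr)
  assume "\<not> DIM('a) \<ge> 2"
  moreover have "DIM('a) > 0" by simp
  ultimately have 1: "DIM('a) = 1" by linarith
  then obtain b where b: "(Basis :: 'a set) = {b}" by (auto simp: card_1_singleton_iff)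
  let ?U = "\<tau> 0"
  have U: "open ?U" "?U \<noteq> {}" "?U \<subseteq> cube_Y" "connected (frontier ?U)" using holes[of 0] m by auto
  have conv: "convex (frontier ?U)" using U(4) connected_convex_1_gen[OF 1] by blast
  obtain x where x: "x \<in> ?U" using U(2) by auto
  have bb: "b \<in> Basis" unfolding b by (rule singletonI)
  have hit: "\<exists>t>0. x + (s * t) *\<^sub>R b \<in> frontier ?U" if s: "s \<in> {1, -1}" for s
  proof -
    have xb: "\<bar>x \<bullet> b\<bar> < 1 / 2" using x U(3) bb by (auto simp: cube_Y_def)
    have "(x + s *\<^sub>R b) \<bullet> b = x \<bullet> b + s" using bb by (simp add: inner_add_left)
    then have "x + s *\<^sub>R b \<notin> cube_Y" using xb s bb by (auto simp: cube_Y_def intro!: bexI[of _ b])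
    then have "x + s *\<^sub>R b \<notin> ?U" using U(3) by auto
    then have "closed_segment x (x + s *\<^sub>R b) \<inter> frontier ?U \<noteq> {}"
      using x by (intro connected_Int_frontier) auto
    then obtain t where t: "0 \<le> t" "x + t *\<^sub>R s *\<^sub>R b \<in> frontier ?U"
      unfolding closed_segment_start by auto
    have "x \<notin> frontier ?U" using x U(1) by (simp add: frontier_def interior_open)
    then have "t \<noteq> 0" using t by auto
    then show ?thesis using t by (intro exI[of _ t]) (auto simp: mult.commute)
  qed
  obtain t1 t2 where t: "t1 > 0" "x + t1 *\<^sub>R b \<in> frontier ?U" "t2 > 0" "x + (- t2) *\<^sub>R b \<in> frontier ?U"
    using hit[of 1] hit[of "-1"] by auto
  have "closed_segment (x + (- t2) *\<^sub>R b) (x + t1 *\<^sub>R b) \<subseteq> frontier ?U"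
    using conv t by (simp add: closed_segment_subset)
  moreover have "x + 0 *\<^sub>R b \<in> closed_segment (x + (- t2) *\<^sub>R b) (x + t1 *\<^sub>R b)"
    using t by (subst closed_segment_on_line) auto
  ultimately have "x \<in> frontier ?U" by auto
  then show False using x U(1) by (simp add: frontier_def interior_open)
qed

lemma open_slab: "open (slab b)"
proof -
  have "slab b = (\<Union>n::int. {x. \<bar>x \<bullet> b - of_int n - 1 / 2\<bar> < c0 / 2})" by (auto simp: slab_def)
  also have "open \<dots>" by (intro open_UN ballI open_Collect_less continuous_intros)
  finally show ?thesis .
qed

lemma slab_shift:
  assumes z: "z \<in> int_lattice" and b: "b \<in> Basis" and x: "x \<in> slab b"
  shows "x + z \<in> slab b"
proof -
  obtain k where k: "z \<bullet> b = of_int k" using z b by (auto simp: int_lattice_def Ints_def)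
  obtain n :: int where "\<bar>x \<bullet> b - of_int n - 1 / 2\<bar> < c0 / 2" using x by (auto simp: slab_def)
  then have "\<bar>(x + z) \<bullet> b - of_int (n + k) - 1 / 2\<bar> < c0 / 2" using k by (simp add: inner_add_left)
  then show ?thesis unfolding slab_def by blast
qed

lemma slab_shift_iff: "z \<in> int_lattice \<Longrightarrow> b \<in> Basis \<Longrightarrow> x + z \<in> slab b \<longleftrightarrow> x \<in> slab b"
  using slab_shift[of z b x] slab_shift[of "- z" b "x + z"] int_lattice_uminus[of z] by auto

text \<open>In the coordinate along \<open>b\<close>, slab points are within c0/2 of a half-integer,
  while points of \<open>P\<close> are at least c0 away from every half-integer.\<close>

lemma slab_infdist:
  assumes b: "b \<in> Basis" and x: "x \<in> slab b"
  shows "infdist x P \<ge> c0 / 2"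
proof -
  obtain n :: int where n: "\<bar>x \<bullet> b - of_int n - 1 / 2\<bar> < c0 / 2" using x by (auto simp: slab_def)
  have "c0 / 2 \<le> dist x q" if q: "q \<in> P" for q
  proof -
    obtain z where z: "z \<in> int_lattice" "q - z \<in> T" using q unfolding P_def mem_periodize_1 by auto
    obtain k where k: "z \<bullet> b = of_int k" using z b by (auto simp: int_lattice_def Ints_def)
    have "\<bar>q \<bullet> b - of_int k\<bar> \<le> 1 / 2 - c0" using T_bound[OF z(2) b] k by (simp add: inner_diff_left)
    \<comment> \<open>No integers lie strictly between -1 and 0: the wall at n + 1/2 is either to
      the right or to the left of the cell centred at k.\<close>
    moreover have "of_int n - of_int k \<ge> (0::real) \<or> of_int n - of_int k \<le> (-1::real)"
      by (cases "n \<ge> k") auto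
    moreover have "\<bar>x \<bullet> b - q \<bullet> b\<bar> \<le> dist x q"
      using Basis_le_norm[OF b, of "x - q"] by (simp add: dist_norm inner_diff_left)
    ultimately show ?thesis using n by linarith
  qed
  moreover have Pne: "P \<noteq> {}" using T_nonempty T_subset_P by auto
  ultimately show ?thesis unfolding infdist_notempty[OF Pne] by (intro cINF_greatest) auto
qed

lemma slab_Int_P: "b \<in> Basis \<Longrightarrow> slab b \<inter> P = {}"
  using slab_infdist c0 by fastforce

lemma frontier_cube_in_slab:
  assumes "x \<in> frontier cube_Y"
  obtains b where "b \<in> Basis" "x \<in> slab b"
proof -
  have x: "x \<in> cbox (- (1 / 2) *\<^sub>R One) ((1 / 2) *\<^sub>R One)" "x \<notin> cube_Y"
    using assms unfolding frontier_cube_Y by auto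
  from x(2) obtain b where b: "b \<in> Basis" "\<not> \<bar>x \<bullet> b\<bar> < 1 / 2" unfolding cube_Y_def by blast
  have "- (1 / 2) \<le> x \<bullet> b \<and> x \<bullet> b \<le> 1 / 2" using x(1) b(1) unfolding mem_box by auto
  then have "\<bar>x \<bullet> b - of_int 0 - 1 / 2\<bar> < c0 / 2 \<or> \<bar>x \<bullet> b - of_int (-1) - 1 / 2\<bar> < c0 / 2"
    using b(2) c0 by (simp only: of_int_0 of_int_minus of_int_1) linarith
  then have "x \<in> slab b" unfolding slab_def by blast
  then show thesis using b(1) that by blast
qed

lemma P_in_cube: "x \<in> P \<Longrightarrow> x \<in> cbox (- (1 / 2) *\<^sub>R One) ((1 / 2) *\<^sub>R One) \<Longrightarrow> x \<in> T"
proof -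
  assume x: "x \<in> P" "x \<in> cbox (- (1 / 2) *\<^sub>R One) ((1 / 2) *\<^sub>R One)"
  obtain z where z: "z \<in> int_lattice" "x - z \<in> T" using x(1) unfolding P_def mem_periodize_1 by auto
  have "z = 0"
  proof (rule ccontr)
    assume "z \<noteq> 0"
    then obtain b where b: "b \<in> Basis" "\<bar>z \<bullet> b\<bar> \<ge> 1" using lattice_large[OF z(1)] by blast
    have "- (1 / 2) \<le> x \<bullet> b \<and> x \<bullet> b \<le> 1 / 2" using x(2) b(1) unfolding mem_box by auto
    then show False using T_bound[OF z(2) b(1)] b(2) c0 unfolding inner_diff_left by linarith
  qed
  then show "x \<in> T" using z by simp
qed

text \<open>Near a boundary point of a hole the complement of \<^term>\<open>P\<close> is connected, so a property that
  is locally constant there holds or fails near the whole connected boundary of that hole. If it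
  failed somewhere in the cell, the failure set together with the holes it touches would be a
  nonempty bounded clopen set.\<close>

lemma locally_constant_on_cell:
  fixes Q :: "'a \<Rightarrow> bool"
  assumes Q: "\<And>x y. closed_segment x y \<subseteq> - P \<Longrightarrow> Q x \<longleftrightarrow> Q y"
    and wall: "\<And>x. x \<in> frontier cube_Y \<Longrightarrow> Q x"
    and x: "x \<in> cube_Y" "x \<notin> P"
  shows "Q x"
proof (rule ccontr)
  assume nQ: "\<not> Q x"
  have ball: "Q y \<longleftrightarrow> Q y'" if "ball y r \<subseteq> - P" "y' \<in> ball y r" for y y' r
  proof (rule Q)
    have "y \<in> ball y r" using that(2) by (auto intro: le_less_trans[OF zero_le_dist])
    then have "closed_segment y y' \<subseteq> ball y r" using that(2) by (intro closed_segment_subset convex_ball)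
    then show "closed_segment y y' \<subseteq> - P" using that(1) by blast
  qed
  have op: "open {y. y \<notin> P \<and> (Q y \<longleftrightarrow> q)}" for q
    unfolding open_contains_ball
  proof (intro ballI)
    fix y assume y: "y \<in> {y. y \<notin> P \<and> (Q y \<longleftrightarrow> q)}"
    then obtain r where r: "r > 0" "ball y r \<subseteq> - P"
      using openE[OF open_Compl[OF closed_P], of y] by blast
    then show "\<exists>r>0. ball y r \<subseteq> {y. y \<notin> P \<and> (Q y \<longleftrightarrow> q)}"
      using ball[OF r(2)] y by (intro exI[of _ r]) blast
  qed
  define Bad where "Bad = {y. y \<notin> P \<and> \<not> Q y}"
  have open_Bad: "open Bad" using op[of False] by (simp add: Bad_def)
  have open_Good: "open {y. y \<notin> P \<and> Q y}" using op[of True] by simp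
  have dich: "\<exists>N. open N \<and> x0 \<in> N \<and> N \<subseteq> ball x0 c0 \<and> ((\<forall>y\<in>N - P. Q y) \<or> (\<forall>y\<in>N - P. \<not> Q y))"
    if i: "i < m" and x0: "x0 \<in> frontier (\<tau> i)" for i x0
  proof (rule escape[OF i x0])
    fix w \<rho> c
    assume \<rho>: "\<rho> > 0" and c: "c > 0" and low: "c \<le> infdist (x0 + w) P"
      and H: "\<And>x t. x \<in> ball x0 \<rho> - P \<Longrightarrow> t \<in> {0..1} \<Longrightarrow> infdist (x + t *\<^sub>R w) P \<ge> c * (infdist x P + t)"
    have Pne: "P \<noteq> {}" using T_nonempty T_subset_P by auto
    have up: "infdist (x + t *\<^sub>R w) P > 0" if "x \<in> ball x0 \<rho> - P" "t \<in> {0..1}" for x t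
    proof -
      have "infdist x P > 0" using that closed_P Pne by (intro infdist_pos_not_in_closed) auto
      then have "0 < c * (infdist x P + t)" using c that by simp
      then show ?thesis using H[OF that] by linarith
    qed
    define s where "s = min c0 (min \<rho> c)"
    have ballw: "ball (x0 + w) c \<subseteq> - P"
    proof
      fix y assume "y \<in> ball (x0 + w) c"
      then have "dist (x0 + w) y < infdist (x0 + w) P" using low by simp
      then show "y \<in> - P" using infdist_le[of y P "x0 + w"] by auto
    qed
    \<comment> \<open>Points near \<open>x0\<close> off \<open>P\<close> are joined to their
      translates by segments off \<open>P\<close>, and all these translates lie in one ball off
      \<open>P\<close> around x0 + w.\<close>
    have "Q y \<longleftrightarrow> Q (x0 + w)" if y: "y \<in> ball x0 s - P" for y
    proof -
      have "Q y \<longleftrightarrow> Q (y + w)"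
      proof (rule Q)
        have "y + t *\<^sub>R w \<notin> P" if "t \<in> {0..1}" for t
          using up[of y t] y that by (auto simp: s_def)
        then show "closed_segment y (y + w) \<subseteq> - P" unfolding closed_segment_start by auto
      qed
      also have "\<dots> \<longleftrightarrow> Q (x0 + w)"
        using ball[OF ballw, of "y + w"] y by (auto simp: s_def)
      finally show ?thesis .
    qed
    moreover have "ball x0 s \<subseteq> ball x0 c0" by (intro subset_ball) (simp add: s_def)
    moreover have "x0 \<in> ball x0 s" using c0 \<rho> c by (simp add: s_def)
    ultimately show ?thesis by (intro exI[of _ "ball x0 s"]) blast
  qed
  have cl_compl: "x0 \<in> closure (- P)" if "i < m" "x0 \<in> frontier (\<tau> i)" for i x0
    using escape[OF that] by blast
  define Nbad where "Nbad = \<Union>{N. open N \<and> (\<forall>y\<in>N - P. \<not> Q y)}"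
  define Ngood where "Ngood = \<Union>{N. open N \<and> (\<forall>y\<in>N - P. Q y)}"
  have opN: "open Nbad" "open Ngood" unfolding Nbad_def Ngood_def by (auto intro: open_Union)
  have all_bad: "frontier (\<tau> i) \<subseteq> Nbad" if i: "i < m" and touch: "frontier (\<tau> i) \<inter> closure Bad \<noteq> {}" for i
  proof (rule ccontr)
    assume not: "\<not> frontier (\<tau> i) \<subseteq> Nbad"
    have cover: "frontier (\<tau> i) \<subseteq> Nbad \<union> Ngood"
    proof
      fix x0 assume "x0 \<in> frontier (\<tau> i)"
      from dich[OF i this] show "x0 \<in> Nbad \<union> Ngood" unfolding Nbad_def Ngood_def by blast
    qed
    \<comment> \<open>The overlap is an open subset of \<open>P\<close>, whereas every frontier
      point is a limit of points off \<open>P\<close>; so the two open sets are disjoint on the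
      frontier and its connectedness applies.\<close>
    have "Nbad \<inter> Ngood \<subseteq> P" unfolding Nbad_def Ngood_def by blast
    then have "Nbad \<inter> Ngood \<inter> (- P) = {}" by blast
    then have "Nbad \<inter> Ngood \<inter> closure (- P) = {}"
      using opN open_Int_closure_eq_empty[of "Nbad \<inter> Ngood" "- P"] by auto
    then have disj: "Nbad \<inter> Ngood \<inter> frontier (\<tau> i) = {}" using cl_compl[OF i] by blast
    obtain x0 where x0: "x0 \<in> frontier (\<tau> i)" "x0 \<in> closure Bad" using touch by auto
    have "Ngood \<inter> Bad = {}" unfolding Ngood_def Bad_def by blast
    then have "Ngood \<inter> closure Bad = {}" using opN(2) open_Int_closure_eq_empty by blast
    then have "x0 \<in> Nbad" using x0 cover by blast
    moreover have "Ngood \<inter> frontier (\<tau> i) \<noteq> {}" using not cover by blast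
    moreover have "connected (frontier (\<tau> i))" using holes[OF i] by blast
    ultimately show False
      using connectedD[of "frontier (\<tau> i)" Nbad Ngood] opN disj cover x0(1) by blast
  qed
  define I where "I = {i. i < m \<and> frontier (\<tau> i) \<inter> closure Bad \<noteq> {}}"
  \<comment> \<open>Filling in the touched holes absorbs the part of the boundary of
    \<open>Bad\<close> that lies on \<open>P\<close>; the remainder is excluded by local constancy
    and by the walls.\<close>
  define D where "D = (Bad \<inter> cube_Y) \<union> (\<Union>i\<in>I. closure (\<tau> i))"
  have fin: "finite I" by (simp add: I_def)
  have open_cube: "open (cube_Y :: 'a set)" unfolding cube_Y_eq_box by (rule open_box)
  have sub: "closure (\<tau> i) \<subseteq> cube_Y" if "i < m" for i using that T_subset_cube by (auto simp: T_def)
  have "open D"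
    unfolding open_subopen[of D]
  proof (intro ballI)
    fix y assume y: "y \<in> D"
    show "\<exists>N. open N \<and> y \<in> N \<and> N \<subseteq> D"
    proof (cases "y \<in> Bad \<inter> cube_Y \<or> (\<exists>i\<in>I. y \<in> \<tau> i)")
      case True
      then show ?thesis
      proof
        assume "y \<in> Bad \<inter> cube_Y"
        then show ?thesis using open_Bad open_cube by (intro exI[of _ "Bad \<inter> cube_Y"]) (auto simp: D_def)
      next
        assume "\<exists>i\<in>I. y \<in> \<tau> i"
        then obtain i where i: "i \<in> I" "y \<in> \<tau> i" by blast
        then show ?thesis using holes[of i] closure_subset[of "\<tau> i"]
          by (intro exI[of _ "\<tau> i"]) (auto simp: D_def I_def)
      qed
    next
      case False
      then obtain i where i: "i \<in> I" "y \<in> closure (\<tau> i)" "y \<notin> \<tau> i" using y by (auto simp: D_def)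
      then have im: "i < m" by (simp add: I_def)
      have yf: "y \<in> frontier (\<tau> i)" using i holes[OF im] by (simp add: frontier_def interior_open)
      then have "y \<in> Nbad" using all_bad[OF im] i(1) by (auto simp: I_def)
      moreover have "y \<in> cube_Y" using sub[OF im] i(2) by blast
      \<comment> \<open>Within distance \<open>c0\<close> of y the only part of \<open>P\<close> is
        the same hole, which is contained in \<open>D\<close>; the rest of the neighbourhood is
        bad.\<close>
      moreover have "Nbad \<inter> cube_Y \<inter> ball y c0 \<subseteq> D"
      proof
        fix q assume q: "q \<in> Nbad \<inter> cube_Y \<inter> ball y c0"
        show "q \<in> D"
        proof (cases "q \<in> P")
          case True
          then have "q \<in> closure (\<tau> i)" using P_local[OF im i(2)] q by auto
          then show ?thesis using i(1) by (auto simp: D_def)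
        next
          case False
          then have "\<not> Q q" using q unfolding Nbad_def by blast
          then show ?thesis using q False by (auto simp: D_def Bad_def)
        qed
      qed
      ultimately show ?thesis using opN open_cube c0
        by (intro exI[of _ "Nbad \<inter> cube_Y \<inter> ball y c0"]) auto
    qed
  qed
  moreover have "closed D"
  proof -
    have "closure (Bad \<inter> cube_Y) \<subseteq> D"
    proof
      fix y assume y: "y \<in> closure (Bad \<inter> cube_Y)"
      then have yB: "y \<in> closure Bad" using closure_mono[of "Bad \<inter> cube_Y" Bad] by auto
      have yY: "y \<in> closure cube_Y" using y closure_mono[of "Bad \<inter> cube_Y" cube_Y] by auto
      have "closure cube_Y \<subseteq> cbox (- (1 / 2) *\<^sub>R One) ((1 / 2) *\<^sub>R (One :: 'a))"
        unfolding cube_Y_eq_box by (intro closure_minimal box_subset_cbox closed_cbox)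
      then have yc: "y \<in> cbox (- (1 / 2) *\<^sub>R One) ((1 / 2) *\<^sub>R One)" using yY by blast
      show "y \<in> D"
      proof (cases "y \<in> P")
        case False
        have "{y. y \<notin> P \<and> Q y} \<inter> Bad = {}" by (auto simp: Bad_def)
        then have "{y. y \<notin> P \<and> Q y} \<inter> closure Bad = {}"
          using open_Good open_Int_closure_eq_empty by blast
        then have nQy: "\<not> Q y" using False yB by auto
        \<comment> \<open>The hypothesis on the walls enters here: a limit of bad points that lies
          off \<open>P\<close> is bad, hence not on a wall.\<close>
        then have "y \<notin> frontier cube_Y" using wall by auto
        then have "y \<in> cube_Y" using yc by (auto simp: frontier_cube_Y)
        then show ?thesis using False nQy by (auto simp: D_def Bad_def)
      next
        case True
        then have "y \<in> T" using P_in_cube yc by blast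
        then obtain i where i: "i < m" "y \<in> closure (\<tau> i)" by (auto simp: T_def)
        have "y \<notin> \<tau> i"
        proof
          assume "y \<in> \<tau> i"
          moreover have "\<tau> i \<subseteq> P" using closure_subset[of "\<tau> i"] T_subset_P i(1) by (auto simp: T_def)
          then have "\<tau> i \<inter> Bad = {}" by (auto simp: Bad_def)
          then have "\<tau> i \<inter> closure Bad = {}" using holes[OF i(1)] open_Int_closure_eq_empty by blast
          ultimately show False using yB by blast
        qed
        then have "y \<in> frontier (\<tau> i)" using i holes[OF i(1)] by (simp add: frontier_def interior_open)
        then have "i \<in> I" using i yB by (auto simp: I_def)
        then show ?thesis using i by (auto simp: D_def)
      qed
    qed
    moreover have "closure (\<Union>i\<in>I. closure (\<tau> i)) = (\<Union>i\<in>I. closure (\<tau> i))"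
      using fin by (intro closure_closed closed_UN) auto
    ultimately have "closure D \<subseteq> D"
      unfolding D_def closure_Un by blast
    then show ?thesis using closure_subset_eq by blast
  qed
  moreover have "x \<in> D" using x nQ by (auto simp: D_def Bad_def)
  ultimately have "D = UNIV" using clopen[of D] by blast
  moreover have "D \<subseteq> cube_Y" using sub by (auto simp: D_def I_def)
  moreover have "bounded (cube_Y :: 'a set)" by (simp add: cube_Y_eq_box)
  ultimately show False using not_bounded_UNIV[where 'a = 'a] bounded_subset by blast
qed

end

section \<open>Estimates on the perforated space\<close>

lemma borel_measurable_infdist [measurable]:
  assumes [measurable]: "f \<in> borel_measurable M"
  shows "(\<lambda>x. infdist (f x) S) \<in> borel_measurable M"
proof -
  have [measurable]: "(\<lambda>y. infdist y S) \<in> borel_measurable borel"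
    by (intro borel_measurable_continuous_onI continuous_intros)
  show ?thesis by (rule measurable_compose[OF assms]) measurable
qed

context holes
begin

lemma int_lattice_cell_P:
  obtains z where "z \<in> int_lattice" "(x::'a) - z \<in> cbox (- (1 / 2) *\<^sub>R One) ((1 / 2) *\<^sub>R One)"
  using int_lattice_cell[of x] by blast

text \<open>With the slabs as \<open>G\<close>, the walls are good. Goodness is constant along
  segments off \<open>P\<close>, so it spreads through the cell off the holes; boundary points of
  holes inherit it by \<open>escape\<close>, and inner points of holes carry nothing to
  estimate.\<close>

lemma cell_estimate:
  assumes p: "p > 1"
  obtains K where "K \<ge> 0" "\<And>v k. line_bounded (- P) v k \<Longrightarrow>
    Lp_int p (- P) v \<le>
      ennreal K * ((\<integral>\<^sup>+x\<in>(\<Union>b\<in>Basis. slab b). ennreal (\<bar>v x\<bar> powr p) \<partial>lborel) +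
        (\<integral>\<^sup>+x. ennreal ((infdist x P * k x) powr p) \<partial>lborel))"
proof -
  interpret perforated P "\<Union>b\<in>Basis. slab b" p
  proof
    show "closed P" by (rule closed_P)
    show "P \<noteq> {}" using T_nonempty T_subset_P by auto
    show "open (\<Union>b\<in>Basis. slab b)" by (intro open_UN ballI open_slab)
  qed (use P_shift_iff slab_shift_iff p in auto)
  have wall: "good x" if "x \<in> frontier cube_Y" for x
    using frontier_cube_in_slab[OF that] good_G by blast
  have outside: "good x" if "x \<notin> P" for x
  proof -
    obtain z where z: "z \<in> int_lattice" "x - z \<in> cbox (- (1 / 2) *\<^sub>R One) ((1 / 2) *\<^sub>R One)"
      by (rule int_lattice_cell_P)
    have "good (x - z)"
    proof (cases "x - z \<in> cube_Y")
      case True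
      have "x - z \<notin> P" using P_shift_iff[OF z(1), of "x - z"] that by simp
      then show ?thesis using locally_constant_on_cell[of good, OF good_segment_iff wall True] by blast
    next
      case False
      then show ?thesis using z(2) by (intro wall) (simp add: frontier_cube_Y)
    qed
    then show ?thesis using good_shift[OF z(1), of "x - z"] by simp
  qed
  have "good x" for x
  proof (cases "x \<in> P")
    case True
    obtain z where z: "z \<in> int_lattice" "x - z \<in> cbox (- (1 / 2) *\<^sub>R One) ((1 / 2) *\<^sub>R One)"
      by (rule int_lattice_cell_P)
    have "x - z \<in> P" using P_shift_iff[OF z(1), of "x - z"] True by simp
    then have "x - z \<in> T" using z(2) P_in_cube by blast
    then obtain i where i: "i < m" "x - z \<in> closure (\<tau> i)" by (auto simp: T_def)
    have "good (x - z)"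
    proof (cases "x - z \<in> \<tau> i")
      case True
      have "\<tau> i \<subseteq> P" using closure_subset[of "\<tau> i"] T_subset_P i(1) by (auto simp: T_def)
      then have "x - z \<in> interior P" using True holes[OF i(1)] interior_maximal by blast
      then show ?thesis by (rule good_interior)
    next
      case False
      then have "x - z \<in> frontier (\<tau> i)" using i holes[OF i(1)] by (simp add: frontier_def interior_open)
      from i(1) this show ?thesis
      proof (rule escape)
        fix w \<rho> c
        assume \<rho>: "\<rho> > 0" and c: "c > 0" and low: "c \<le> infdist (x - z + w) P"
          and H: "\<And>y t. y \<in> ball (x - z) \<rho> - P \<Longrightarrow> t \<in> {0..1} \<Longrightarrow> infdist (y + t *\<^sub>R w) P \<ge> c * (infdist y P + t)"
        \<comment> \<open>The escape direction leads from the boundary of the hole to a point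
          already known to be good.\<close>
        have "x - z + w \<notin> P" using low c by auto
        then have "good (x - z + w)" by (rule outside)
        then show ?thesis using good_translate[OF c \<rho> H] by blast
      qed
    qed
    then show ?thesis using good_shift[OF z(1), of "x - z"] by simp
  qed (rule outside)
  then have "controlled UNIV" by (rule controlled_UNIV)
  then show thesis
  proof (rule controlledE)
    fix K assume K: "K \<ge> 0" "\<And>v k. line_bounded (- P) v k \<Longrightarrow>
      Lp_int p (UNIV - P) v \<le> ennreal K * energy v k"
    show thesis
      by (rule that[OF K(1)]) (use K(2) in \<open>simp add: energy_def Compl_eq_Diff_UNIV\<close>)
  qed
qed

lemma slab_shift_orthogonal:
  assumes "b \<in> Basis" "j \<in> Basis" "b \<noteq> j"
  shows "x + s *\<^sub>R j \<in> slab b \<longleftrightarrow> x \<in> slab b"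
  using assms by (simp add: slab_def inner_add_left inner_Basis)

text \<open>Slabs are invariant under the translations orthogonal to their normal, so one long translation
  that leaves the domain gives a Poincare inequality on them.\<close>

lemma slab_estimate:
  assumes p: "p > 1" and lb: "line_bounded (- P) v k" and L: "L > 0"
    and bj: "b \<in> Basis" "j \<in> Basis" "b \<noteq> j"
    and vanish: "\<And>x. v x = 0 \<or> v (x + L *\<^sub>R j) = 0"
  shows "Lp_int p (slab b) v \<le>
    ennreal (L powr p * (2 / c0) powr p) * (\<integral>\<^sup>+x. ennreal ((infdist x P * k x) powr p) \<partial>lborel)"
proof -
  have [measurable]: "v \<in> borel_measurable borel" "k \<in> borel_measurable borel"
    and k: "\<And>x. 0 \<le> k x" using lb by (auto simp: line_bounded_def)
  have [measurable]: "slab b \<in> sets borel" using open_slab by auto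
  define w where "w = L *\<^sub>R j"
  have nw: "norm w = L" using L bj(2) by (simp add: w_def)
  have sw: "x + t *\<^sub>R w \<in> slab b \<longleftrightarrow> x \<in> slab b" for x t
    using slab_shift_orthogonal[OF bj, of x "t * L"] by (simp add: w_def)
  define \<Psi> where "\<Psi> x = ennreal ((L * k x) powr p) * indicator (slab b) x" for x
  have [measurable]: "\<Psi> \<in> borel_measurable borel" unfolding \<Psi>_def by measurable
  have "AE x in lborel. closed_segment x (x + w) \<subseteq> - P \<longrightarrow>
        segment_bound v k x w"
    using lb unfolding line_bounded_def by blast
  then have ae: "AE x in lborel. ennreal (\<bar>v x\<bar> powr p) * indicator (slab b) x \<le>
      (\<integral>\<^sup>+t. \<Psi> (x + t *\<^sub>R w) * indicator {0..1} t \<partial>lborel)"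
  proof eventually_elim
    case (elim x)
    show ?case
    proof (cases "x \<in> slab b \<and> v x \<noteq> 0")
      case True
      then have x: "x \<in> slab b" "v (x + w) = 0" using vanish[of x] by (auto simp: w_def)
      have "closed_segment x (x + w) \<subseteq> - P"
        unfolding closed_segment_start using sw x(1) slab_Int_P[OF bj(1)] by blast
      then have "ennreal \<bar>v x\<bar> \<le> (\<integral>\<^sup>+t. ennreal (L * k (x + t *\<^sub>R w) * indicator {0..1} t) \<partial>lborel)"
        using elim x(2) nw by (simp add: ennreal_mult'' indicator_def of_bool_def if_distrib cong: if_cong)
      \<comment> \<open>Jensen on the unit interval: the weight is its indicator and the total mass
        is 1.\<close>
      then have "ennreal (\<bar>v x\<bar> powr p) \<le> ennreal (1 powr (p - 1)) *
          (\<integral>\<^sup>+t. ennreal ((L * k (x + t *\<^sub>R w)) powr p * indicator {0..1} t) \<partial>lborel)"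
        using k L by (intro weighted_power_bound[OF _ _ _ _ p]) (auto simp: ennreal_indicator)
      also have "\<dots> = (\<integral>\<^sup>+t. \<Psi> (x + t *\<^sub>R w) * indicator {0..1} t \<partial>lborel)"
        using x(1) by (auto intro!: nn_integral_cong simp: \<Psi>_def sw indicator_def)
      finally show ?thesis using x(1) by simp
    qed (use p in \<open>auto simp: indicator_def\<close>)
  qed
  have "Lp_int p (slab b) v \<le>
      (\<integral>\<^sup>+x. (\<integral>\<^sup>+t. \<Psi> (x + t *\<^sub>R w) * indicator {0..1} t \<partial>lborel) \<partial>lborel)"
    by (rule nn_integral_mono_AE[OF ae])
  also have "\<dots> = (\<integral>\<^sup>+t. (\<integral>\<^sup>+x. \<Psi> (x + t *\<^sub>R w) * indicator {0..1::real} t \<partial>lborel) \<partial>lborel)"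
    by (rule lborel_pair.Fubini'[symmetric, where f = "\<lambda>x t. \<Psi> (x + t *\<^sub>R w) * indicator {0..1::real} t"]) measurable
  also have "\<dots> = (\<integral>\<^sup>+t. (\<integral>\<^sup>+x. \<Psi> x \<partial>lborel) * indicator {0..1::real} t \<partial>lborel)"
  proof (rule nn_integral_cong)
    fix t :: real
    show "(\<integral>\<^sup>+x. \<Psi> (x + t *\<^sub>R w) * indicator {0..1} t \<partial>lborel) = (\<integral>\<^sup>+x. \<Psi> x \<partial>lborel) * indicator {0..1} t"
      using nn_integral_lborel_shift[of \<Psi> "t *\<^sub>R w"] by (simp add: nn_integral_multc)
  qed
  also have "\<dots> = (\<integral>\<^sup>+x. \<Psi> x \<partial>lborel)" by (simp add: nn_integral_cmult)
  also have "\<dots> \<le> (\<integral>\<^sup>+x. ennreal (L powr p * (2 / c0) powr p) * ennreal ((infdist x P * k x) powr p) \<partial>lborel)"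
  proof (intro nn_integral_mono)
    fix x
    have "(L * k x) powr p \<le> L powr p * (2 / c0) powr p * (infdist x P * k x) powr p" if x: "x \<in> slab b"
    proof -
      have "L * k x \<le> L * (2 / c0) * (infdist x P * k x)"
      proof -
        \<comment> \<open>The slab keeps distance c0/2 from the holes, so the weight can be inserted
          at the price of 2 / c0.\<close>
        have "1 \<le> 2 / c0 * infdist x P" using slab_infdist[OF bj(1) x] c0 by (simp add: field_simps)
        then have "L * k x * 1 \<le> L * k x * (2 / c0 * infdist x P)" using L k by (intro mult_left_mono) auto
        then show ?thesis by (simp add: mult_ac)
      qed
      then have "(L * k x) powr p \<le> (L * (2 / c0) * (infdist x P * k x)) powr p"
        using L k p by (intro powr_mono2) auto
      also have "\<dots> = L powr p * (2 / c0) powr p * (infdist x P * k x) powr p"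
        using L k c0 infdist_nonneg[of x P] by (simp only: powr_mult)
      finally show ?thesis .
    qed
    then show "\<Psi> x \<le> ennreal (L powr p * (2 / c0) powr p) * ennreal ((infdist x P * k x) powr p)"
      by (auto simp: \<Psi>_def indicator_def ennreal_mult[symmetric] intro!: ennreal_leI)
  qed
  also have "\<dots> = ennreal (L powr p * (2 / c0) powr p) * (\<integral>\<^sup>+x. ennreal ((infdist x P * k x) powr p) \<partial>lborel)"
    by (rule nn_integral_cmult) (use closed_P in measurable)
  finally show ?thesis .
qed

text \<open>Each slab family is handled by a translation along a basis vector other than its normal.
  The dependence on L is kept explicit, since L will be of order 1/\<epsilon>.\<close>

lemma unit_estimate:
  assumes p: "p > 1"
  obtains K where "K \<ge> 0" "\<And>v k L. line_bounded (- P) v k \<Longrightarrow> L \<ge> 1 \<Longrightarrow>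
    (\<And>x j. j \<in> Basis \<Longrightarrow> v x = 0 \<or> v (x + L *\<^sub>R j) = 0) \<Longrightarrow>
    Lp_int p (- P) v \<le>
      ennreal (K * L powr p) * (\<integral>\<^sup>+x. ennreal ((infdist x P * k x) powr p) \<partial>lborel)"
proof (rule cell_estimate[OF p])
  fix K assume K: "K \<ge> 0" "\<And>v k. line_bounded (- P) v k \<Longrightarrow>
    Lp_int p (- P) v \<le>
      ennreal K * ((\<integral>\<^sup>+x\<in>(\<Union>b\<in>Basis. slab b). ennreal (\<bar>v x\<bar> powr p) \<partial>lborel) +
        (\<integral>\<^sup>+x. ennreal ((infdist x P * k x) powr p) \<partial>lborel))"
  \<comment> \<open>One term for each of the slab families and 1 for the gradient part of the
    energy, which is absorbed using L^p >= 1.\<close>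
  define A where "A = real DIM('a) * (2 / c0) powr p + 1"
  show thesis
  proof (rule that[of "K * A"])
    show "K * A \<ge> 0" using K(1) by (simp add: A_def)
    fix v k L
    assume lb: "line_bounded (- P) v k" and L: "L \<ge> 1"
      and vanish: "\<And>x j. j \<in> Basis \<Longrightarrow> v x = 0 \<or> v (x + L *\<^sub>R j) = 0"
    let ?E = "(\<integral>\<^sup>+x. ennreal ((infdist x P * k x) powr p) \<partial>lborel)"
    have [measurable]: "v \<in> borel_measurable borel" using lb by (auto simp: line_bounded_def)
    have [measurable]: "slab b \<in> sets borel" for b using open_slab by auto
    have one: "Lp_int p (slab b) v \<le> ennreal (L powr p * (2 / c0) powr p) * ?E"
      if b: "b \<in> Basis" for b
    proof -
      have "\<exists>j\<in>Basis. b \<noteq> j"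
      proof (rule ccontr)
        assume "\<not> (\<exists>j\<in>Basis. b \<noteq> j)"
        then have "\<forall>j\<in>(Basis :: 'a set). j = b" by auto
        then have "(Basis :: 'a set) \<subseteq> {b}" by auto
        then have "DIM('a) \<le> card {b}" by (intro card_mono) auto
        then show False using DIM_ge_2 by simp
      qed
      then obtain j where "j \<in> Basis" "b \<noteq> j" by blast
      then show ?thesis using L by (intro slab_estimate[OF p lb _ b _ _ vanish]) auto
    qed
    have "(\<integral>\<^sup>+x\<in>(\<Union>b\<in>Basis. slab b). ennreal (\<bar>v x\<bar> powr p) \<partial>lborel) \<le>
        (\<integral>\<^sup>+x. (\<Sum>b\<in>Basis. ennreal (\<bar>v x\<bar> powr p) * indicator (slab b) x) \<partial>lborel)"
    proof (intro nn_integral_mono)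
      fix x
      show "ennreal (\<bar>v x\<bar> powr p) * indicator (\<Union>b\<in>Basis. slab b) x \<le> (\<Sum>b\<in>Basis. ennreal (\<bar>v x\<bar> powr p) * indicator (slab b) x)"
      proof (cases "x \<in> (\<Union>b\<in>Basis. slab b)")
        case True
        then obtain b where b: "b \<in> Basis" "x \<in> slab b" by blast
        have "ennreal (\<bar>v x\<bar> powr p) * indicator (slab b) x \<le> (\<Sum>b\<in>Basis. ennreal (\<bar>v x\<bar> powr p) * indicator (slab b) x)"
          using b(1) by (intro member_le_sum) auto
        then show ?thesis using True b by simp
      qed simp
    qed
    also have "\<dots> = (\<Sum>b\<in>Basis. \<integral>\<^sup>+x\<in>slab b. ennreal (\<bar>v x\<bar> powr p) \<partial>lborel)"
      by (rule nn_integral_sum) measurable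
    also have "\<dots> \<le> (\<Sum>b\<in>(Basis::'a set). ennreal (L powr p * (2 / c0) powr p) * ?E)"
      by (intro sum_mono one)
    also have "\<dots> = ennreal (real DIM('a) * (L powr p * (2 / c0) powr p)) * ?E"
      by (simp add: ennreal_mult ennreal_of_nat_eq_real_of_nat mult.assoc)
    finally have slabs: "(\<integral>\<^sup>+x\<in>(\<Union>b\<in>Basis. slab b). ennreal (\<bar>v x\<bar> powr p) \<partial>lborel) \<le>
      ennreal (real DIM('a) * (L powr p * (2 / c0) powr p)) * ?E" .
    have "Lp_int p (- P) v \<le>
      ennreal K * (ennreal (real DIM('a) * (L powr p * (2 / c0) powr p)) * ?E + ?E)"
      by (rule order_trans[OF K(2)[OF lb]]) (intro mult_left_mono add_right_mono slabs, simp)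
    also have "\<dots> = ennreal K * (ennreal (real DIM('a) * (L powr p * (2 / c0) powr p)) + ennreal 1) * ?E"
      by (simp add: distrib_right mult.assoc)
    also have "\<dots> = ennreal (K * (real DIM('a) * (L powr p * (2 / c0) powr p) + 1)) * ?E"
      using K(1) by (simp add: ennreal_mult ennreal_plus)
    also have "\<dots> \<le> ennreal (K * A * L powr p) * ?E"
    proof (intro mult_right_mono ennreal_leI)
      have "1 \<le> L powr p" using L p by (simp add: ge_one_powr_ge_zero)
      then have "K * (real DIM('a) * (L powr p * (2 / c0) powr p) + 1) \<le> K * (real DIM('a) * (L powr p * (2 / c0) powr p) + L powr p)"
        using K(1) by (intro mult_left_mono) auto
      then show "K * (real DIM('a) * (L powr p * (2 / c0) powr p) + 1) \<le> K * A * L powr p"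
        by (simp add: A_def algebra_simps)
    qed simp
    finally show "Lp_int p (- P) v \<le> ennreal (K * A * L powr p) * ?E" .
  qed
qed

lemma mem_periodize_iff:
  assumes "\<epsilon> > 0"
  shows "x \<in> periodize \<epsilon> T \<longleftrightarrow> (1 / \<epsilon>) *\<^sub>R x \<in> P"
proof -
  have "periodize \<epsilon> T = (\<lambda>y. \<epsilon> *\<^sub>R y) ` P"
    unfolding P_def periodize_def by (simp add: image_UN image_image)
  then show ?thesis using assms by (auto simp: image_iff intro!: bexI[of _ "(1 / \<epsilon>) *\<^sub>R x"])
qed

text \<open>In the variable x/\<epsilon> the translation has length D/\<epsilon>, while the gradient
  gains the factor \<epsilon>; the Jacobian is the same on both sides.\<close>

lemma scaled_estimate:
  assumes p: "p > 1" and D: "D \<ge> 1"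
  obtains K where "K > 0" "\<And>\<epsilon> v k. 0 < \<epsilon> \<Longrightarrow> \<epsilon> < 1 \<Longrightarrow> line_bounded (- periodize \<epsilon> T) v k \<Longrightarrow>
    \<forall>x. \<forall>j\<in>Basis. v x = 0 \<or> v (x + D *\<^sub>R j) = 0 \<Longrightarrow>
    Lp_int p (- periodize \<epsilon> T) v \<le>
      ennreal K * (\<integral>\<^sup>+x. ennreal ((infdist ((1 / \<epsilon>) *\<^sub>R x) P * k x) powr p) \<partial>lborel)"
proof (rule unit_estimate[OF p])
  fix K assume K: "K \<ge> 0" "\<And>v k L. line_bounded (- P) v k \<Longrightarrow> L \<ge> 1 \<Longrightarrow>
    (\<And>x j. j \<in> Basis \<Longrightarrow> v x = 0 \<or> v (x + L *\<^sub>R j) = 0) \<Longrightarrow>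
    Lp_int p (- P) v \<le>
      ennreal (K * L powr p) * (\<integral>\<^sup>+x. ennreal ((infdist x P * k x) powr p) \<partial>lborel)"
  \<comment> \<open>The summand 1 makes the constant strictly positive.\<close>
  show thesis
  proof (rule that[of "K * D powr p + 1"])
    show "K * D powr p + 1 > 0" using K(1) by (intro add_nonneg_pos) auto
    fix \<epsilon> v k
    assume \<epsilon>: "0 < \<epsilon>" "\<epsilon> < 1" and lb: "line_bounded (- periodize \<epsilon> T) v k"
      and vanish: "\<forall>x. \<forall>j\<in>Basis. v x = 0 \<or> v (x + D *\<^sub>R j) = 0"
    have [measurable]: "v \<in> borel_measurable borel" "k \<in> borel_measurable borel"
      and k: "\<And>x. 0 \<le> k x" using lb by (auto simp: line_bounded_def)
    have [measurable]: "P \<in> sets borel" using closed_P by auto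
    have mem: "\<epsilon> *\<^sub>R x \<in> periodize \<epsilon> T \<longleftrightarrow> x \<in> P" for x using mem_periodize_iff[OF \<epsilon>(1), of "\<epsilon> *\<^sub>R x"] \<epsilon> by simp
    have meas [measurable]: "periodize \<epsilon> T \<in> sets borel"
    proof -
      have "periodize \<epsilon> T = (\<lambda>x. (1 / \<epsilon>) *\<^sub>R x) -` P \<inter> space borel" using mem_periodize_iff[OF \<epsilon>(1)] by auto
      also have "\<dots> \<in> sets borel" by measurable
      finally show ?thesis .
    qed
    have "line_bounded ((\<lambda>y. \<epsilon> *\<^sub>R y) -` (- periodize \<epsilon> T)) (\<lambda>y. v (\<epsilon> *\<^sub>R y)) (\<lambda>y. \<epsilon> * k (\<epsilon> *\<^sub>R y))"
      by (rule line_bounded_scale[OF lb \<epsilon>(1)])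
    moreover have "(\<lambda>y. \<epsilon> *\<^sub>R y) -` (- periodize \<epsilon> T) = - P" using mem by auto
    ultimately have lb': "line_bounded (- P) (\<lambda>y. v (\<epsilon> *\<^sub>R y)) (\<lambda>y. \<epsilon> * k (\<epsilon> *\<^sub>R y))" by simp
    have est: "(\<integral>\<^sup>+x\<in>- P. ennreal (\<bar>v (\<epsilon> *\<^sub>R x)\<bar> powr p) \<partial>lborel) \<le>
        ennreal (K * (D / \<epsilon>) powr p) * (\<integral>\<^sup>+x. ennreal ((infdist x P * (\<epsilon> * k (\<epsilon> *\<^sub>R x))) powr p) \<partial>lborel)"
    proof (rule K(2)[OF lb'])
      show "1 \<le> D / \<epsilon>" using D \<epsilon> by simp
      show "v (\<epsilon> *\<^sub>R x) = 0 \<or> v (\<epsilon> *\<^sub>R (x + (D / \<epsilon>) *\<^sub>R j)) = 0" if "j \<in> Basis" for x j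
        using vanish[rule_format, OF that, of "\<epsilon> *\<^sub>R x"] \<epsilon>(1) by (simp add: scaleR_add_right)
    qed
    let ?d = "ennreal (\<epsilon> ^ DIM('a))"
    have "Lp_int p (- periodize \<epsilon> T) v =
        ?d * (\<integral>\<^sup>+x. ennreal (\<bar>v (\<epsilon> *\<^sub>R x)\<bar> powr p) * indicator (- periodize \<epsilon> T) (\<epsilon> *\<^sub>R x) \<partial>lborel)"
      by (rule nn_integral_lborel_scale[OF _ \<epsilon>(1)]) measurable
    also have "\<dots> = ?d * (\<integral>\<^sup>+x\<in>- P. ennreal (\<bar>v (\<epsilon> *\<^sub>R x)\<bar> powr p) \<partial>lborel)"
      by (simp add: indicator_def mem)
    also have "\<dots> \<le> ?d * (ennreal (K * (D / \<epsilon>) powr p) * (\<integral>\<^sup>+x. ennreal ((infdist x P * (\<epsilon> * k (\<epsilon> *\<^sub>R x))) powr p) \<partial>lborel))"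
      by (intro mult_left_mono est) simp
    also have "(\<integral>\<^sup>+x. ennreal ((infdist x P * (\<epsilon> * k (\<epsilon> *\<^sub>R x))) powr p) \<partial>lborel) =
        ennreal (\<epsilon> powr p) * (\<integral>\<^sup>+x. ennreal ((infdist x P * k (\<epsilon> *\<^sub>R x)) powr p) \<partial>lborel)"
    proof (subst nn_integral_cmult[symmetric])
      show "(\<lambda>x. ennreal ((infdist x P * k (\<epsilon> *\<^sub>R x)) powr p)) \<in> borel_measurable lborel" by measurable
      have "(infdist x P * (\<epsilon> * k (\<epsilon> *\<^sub>R x))) powr p = \<epsilon> powr p * (infdist x P * k (\<epsilon> *\<^sub>R x)) powr p" for x
        using \<epsilon>(1) k infdist_nonneg[of x P] by (simp add: powr_mult)
      then show "(\<integral>\<^sup>+x. ennreal ((infdist x P * (\<epsilon> * k (\<epsilon> *\<^sub>R x))) powr p) \<partial>lborel) =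
        (\<integral>\<^sup>+x. ennreal (\<epsilon> powr p) * ennreal ((infdist x P * k (\<epsilon> *\<^sub>R x)) powr p) \<partial>lborel)"
        by (simp add: ennreal_mult)
    qed
    also have "?d * (ennreal (K * (D / \<epsilon>) powr p) * (ennreal (\<epsilon> powr p) * (\<integral>\<^sup>+x. ennreal ((infdist x P * k (\<epsilon> *\<^sub>R x)) powr p) \<partial>lborel))) =
      ennreal (K * (D / \<epsilon>) powr p * \<epsilon> powr p) * (?d * (\<integral>\<^sup>+x. ennreal ((infdist x P * k (\<epsilon> *\<^sub>R x)) powr p) \<partial>lborel))"
      using K(1) by (simp add: ennreal_mult mult_ac)
    \<comment> \<open>Here \<epsilon> cancels, which is the uniformity of the estimate.\<close>
    also have "K * (D / \<epsilon>) powr p * \<epsilon> powr p = K * D powr p"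
      using \<epsilon>(1) D by (simp add: powr_divide)
    also have "?d * (\<integral>\<^sup>+x. ennreal ((infdist x P * k (\<epsilon> *\<^sub>R x)) powr p) \<partial>lborel) =
        (\<integral>\<^sup>+x. ennreal ((infdist ((1 / \<epsilon>) *\<^sub>R x) P * k x) powr p) \<partial>lborel)"
      using \<epsilon>(1) by (subst nn_integral_lborel_scale[OF _ \<epsilon>(1), of "\<lambda>x. ennreal ((infdist ((1 / \<epsilon>) *\<^sub>R x) P * k x) powr p)"]) auto
    also have "ennreal (K * D powr p) * \<dots> \<le> ennreal (K * D powr p + 1) * \<dots>"
      by (intro mult_right_mono ennreal_leI) auto
    finally show "Lp_int p (- periodize \<epsilon> T) v \<le>
      ennreal (K * D powr p + 1) * (\<integral>\<^sup>+x. ennreal ((infdist ((1 / \<epsilon>) *\<^sub>R x) P * k x) powr p) \<partial>lborel)" .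
  qed
qed

end

section \<open>Passage to the weighted space\<close>

text \<open>An open set is a countable union of compact boxes, on each of which the function is
  integrable.\<close>

lemma loc_integrable_measurable:
  fixes f :: "'a::euclidean_space \<Rightarrow> 'b::{banach,second_countable_topology}"
  assumes "open U" "loc_integrable U f"
  shows "f \<in> borel_measurable (lebesgue_on U)"
proof -
  obtain D where D: "countable D" "D \<subseteq> Pow U" "\<And>X. X \<in> D \<Longrightarrow> \<exists>a b. X = cbox a b" "\<Union>D = U"
    by (rule open_countable_Union_open_cbox[OF assms(1)]) (rule that)
  show ?thesis
  proof (rule measurable_piecewise_restrict[OF D(1)])
    fix X assume X: "X \<in> D"
    then obtain a b where ab: "X = cbox a b" using D(3) by blast
    have XU: "X \<subseteq> U" using D(2) X by blast
    show "X \<inter> space (lebesgue_on U) \<in> sets (lebesgue_on U)"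
      using assms(1) ab by (auto simp: sets_restrict_space)
    have "f \<in> borel_measurable (lebesgue_on X)"
      using assms(2) XU ab unfolding loc_integrable_def by (meson borel_measurable_integrable compact_cbox)
    moreover have "restrict_space (lebesgue_on U) X = lebesgue_on X"
      using XU assms(1) by (subst restrict_restrict_space) (auto simp: ab Int_absorb1)
    ultimately show "f \<in> borel_measurable (restrict_space (lebesgue_on U) X)" by simp
  qed (use D(4) in auto)
qed

lemma completion_ex_borel_measurable_euclidean:
  fixes g :: "'b \<Rightarrow> 'a::euclidean_space"
  assumes "g \<in> borel_measurable (completion M)"
  obtains g' where "g' \<in> borel_measurable M" "AE x in M. g x = g' x"
proof -
  have "\<exists>q\<in>borel_measurable M. AE x in M. g x \<bullet> b = q x" for b
    by (rule completion_ex_borel_measurable_real) (use assms in measurable)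
  then obtain q where q: "\<And>b. q b \<in> borel_measurable M" "\<And>b. AE x in M. g x \<bullet> b = q b x" by metis
  show thesis
  proof (rule that[of "\<lambda>x. \<Sum>b\<in>Basis. q b x *\<^sub>R b"])
    show "(\<lambda>x. \<Sum>b\<in>Basis. q b x *\<^sub>R b) \<in> borel_measurable M"
      using q(1) by measurable
    have "AE x in M. \<forall>b\<in>Basis. g x \<bullet> b = q b x"
      using q(2) by (subst AE_ball_countable) (auto intro: countable_finite)
    then show "AE x in M. g x = (\<Sum>b\<in>Basis. q b x *\<^sub>R b)"
    proof eventually_elim
      case (elim x)
      have "g x = (\<Sum>b\<in>Basis. (g x \<bullet> b) *\<^sub>R b)" by (simp add: euclidean_representation)
      then show ?case using elim by simp
    qed
  qed
qed

lemma test_fn_eq_0: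
  assumes "test_fn U \<psi>" "x \<notin> U"
  shows "\<psi> x = 0" "frechet_derivative \<psi> (at x) b = 0"
proof -
  let ?S = "closure (support_on UNIV \<psi>)"
  have x: "x \<notin> ?S" using assms by (auto simp: test_fn_def)
  have zero: "\<psi> y = 0" if "y \<notin> ?S" for y
    using that closure_subset[of "support_on UNIV \<psi>"] by (auto simp: support_on_def)
  show "\<psi> x = 0" using zero[OF x] .
  have "\<forall>\<^sub>F y in at x. y \<in> - ?S"
    using x by (intro eventually_at_in_open') auto
  then have ev: "\<forall>\<^sub>F y in at x. 0 = \<psi> y" by (auto simp: zero elim!: eventually_mono)
  have "((\<lambda>y. 0) has_derivative (\<lambda>v. 0)) (at x)" by simp
  then have "(\<psi> has_derivative (\<lambda>v. 0)) (at x)"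
    by (rule has_derivative_transform_eventually[OF _ ev]) (use zero[OF x] in auto)
  from frechet_derivative_at[OF this] show "frechet_derivative \<psi> (at x) b = 0" by metis
qed

text \<open>Bridge from Lebesgue measurable functions that matter on \<open>U\<close> only to Borel
  functions on the whole space. Test functions vanish outside \<open>U\<close>, so Borel
  representatives of the cut-off functions satisfy the same weak identity; vanishing on
  \<open>N\<close> then lets the line bound cross into \<open>N\<close>.\<close>

lemma weak_gradient_zero_extension:
  fixes v :: "'a::euclidean_space \<Rightarrow> real" and h :: "'a \<Rightarrow> 'a"
  assumes wg: "weak_gradient U v h" and U: "open U" and N: "open N" and W: "W \<subseteq> U \<union> N"
    and zero: "\<And>x. x \<in> U \<inter> N \<Longrightarrow> v x = 0"
  obtains v' k where "line_bounded W v' k" "AE x in lborel. v' x = indicator U x * v x"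
    "AE x in lborel. k x = indicator U x * norm (h x)" "\<And>x. x \<in> N \<Longrightarrow> v' x = 0"
proof -
  have lv: "loc_integrable U v" and lh: "loc_integrable U h"
    and weak: "\<And>\<psi> b. test_fn U \<psi> \<Longrightarrow> b \<in> Basis \<Longrightarrow>
      (LINT x|lebesgue. v x * frechet_derivative \<psi> (at x) b) = - (LINT x|lebesgue. (h x \<bullet> b) * \<psi> x)"
    using wg unfolding weak_gradient_def by blast+
  have [measurable]: "U \<in> sets borel" "N \<in> sets borel" using U N by auto
  have Ul: "U \<inter> space lebesgue \<in> sets lebesgue" by simp
  have vU: "(\<lambda>x. indicator U x *\<^sub>R v x) \<in> borel_measurable lebesgue"
    using loc_integrable_measurable[OF U lv] unfolding borel_measurable_restrict_space_iff[OF Ul] .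
  have hU: "(\<lambda>x. indicator U x *\<^sub>R h x) \<in> borel_measurable lebesgue"
    using loc_integrable_measurable[OF U lh] unfolding borel_measurable_restrict_space_iff[OF Ul] .
  obtain w where w [measurable]: "w \<in> borel_measurable lborel" and wae: "AE x in lborel. indicator U x *\<^sub>R v x = w x"
    using completion_ex_borel_measurable_real[OF vU] by blast
  obtain q where q [measurable]: "q \<in> borel_measurable lborel" and qae: "AE x in lborel. indicator U x *\<^sub>R h x = q x"
    by (rule completion_ex_borel_measurable_euclidean[OF hU])
  have wael: "AE x in lebesgue. indicator U x *\<^sub>R v x = w x" and qael: "AE x in lebesgue. indicator U x *\<^sub>R h x = q x"
    using wae qae by (auto intro: AE_completion)
  have "line_bounded U w (\<lambda>x. norm (q x))"
  proof (rule weak_gradient_line_bounded[OF U])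
    show "w \<in> borel_measurable borel" "q \<in> borel_measurable borel" using w q by auto
    fix K assume K: "compact K" "K \<subseteq> U"
    have [measurable]: "K \<in> sets borel" using K(1) by (simp add: borel_compact)
    have Kl: "K \<inter> space lebesgue \<in> sets lebesgue" by simp
    have "integrable lebesgue (\<lambda>x. indicator K x *\<^sub>R v x)"
      using lv K unfolding loc_integrable_def integrable_restrict_space[OF Kl, symmetric] by blast
    then have "integrable lebesgue (\<lambda>x. indicator K x * w x)"
    proof (rule integrable_cong_AE_imp)
      show "(\<lambda>x. indicator K x * w x) \<in> borel_measurable lebesgue" by (intro measurable_completion) measurable
      show "AE x in lebesgue. indicator K x *\<^sub>R v x = indicator K x * w x"
        using wael by eventually_elim (use K(2) in \<open>auto simp: indicator_def split: if_splits\<close>)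
    qed
    then show "integrable lborel (\<lambda>x. indicator K x * w x)"
      by (subst (asm) integrable_completion) auto
    have "integrable lebesgue (\<lambda>x. indicator K x *\<^sub>R h x)"
      using lh K unfolding loc_integrable_def integrable_restrict_space[OF Kl, symmetric] by blast
    then have "integrable lebesgue (\<lambda>x. indicator K x *\<^sub>R q x)"
    proof (rule integrable_cong_AE_imp)
      show "(\<lambda>x. indicator K x *\<^sub>R q x) \<in> borel_measurable lebesgue" by (intro measurable_completion) measurable
      show "AE x in lebesgue. indicator K x *\<^sub>R h x = indicator K x *\<^sub>R q x"
        using qael by eventually_elim (use K(2) in \<open>auto simp: indicator_def split: if_splits\<close>)
    qed
    then show "integrable lborel (\<lambda>x. indicator K x *\<^sub>R q x)"
      by (subst (asm) integrable_completion) auto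
  next
    fix \<psi> and b :: 'a assume \<psi>: "test_fn U \<psi>" and b: "b \<in> Basis"
    have sm: "smooth_on UNIV \<psi>" using \<psi> by (simp add: test_fn_def)
    have [measurable]: "\<psi> \<in> borel_measurable borel"
      using sm unfolding smooth_on_def
      by (intro borel_measurable_continuous_onI) (metis Ck_on.simps(1))
    have [measurable]: "(\<lambda>x. frechet_derivative \<psi> (at x) b) \<in> borel_measurable borel"
      by (intro borel_measurable_continuous_onI smooth_on_deriv_continuous[OF sm]) auto
    have "(LINT x|lborel. w x * frechet_derivative \<psi> (at x) b) = (LINT x|lebesgue. w x * frechet_derivative \<psi> (at x) b)"
      by (rule integral_completion[symmetric]) measurable
    also have "\<dots> = (LINT x|lebesgue. (indicator U x *\<^sub>R v x) * frechet_derivative \<psi> (at x) b)"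
    proof (rule integral_cong_AE)
      show "(\<lambda>x. w x * frechet_derivative \<psi> (at x) b) \<in> borel_measurable lebesgue"
        by (intro measurable_completion) measurable
      show "(\<lambda>x. (indicator U x *\<^sub>R v x) * frechet_derivative \<psi> (at x) b) \<in> borel_measurable lebesgue"
        by (intro borel_measurable_times vU measurable_completion) measurable
      show "AE x in lebesgue. w x * frechet_derivative \<psi> (at x) b = (indicator U x *\<^sub>R v x) * frechet_derivative \<psi> (at x) b"
        using wael by eventually_elim simp
    qed
    also have "\<dots> = (LINT x|lebesgue. v x * frechet_derivative \<psi> (at x) b)"
      by (intro Bochner_Integration.integral_cong) (auto simp: indicator_def test_fn_eq_0[OF \<psi>])
    also have "\<dots> = - (LINT x|lebesgue. (h x \<bullet> b) * \<psi> x)" by (rule weak[OF \<psi> b])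
    also have "(LINT x|lebesgue. (h x \<bullet> b) * \<psi> x) = (LINT x|lebesgue. ((indicator U x *\<^sub>R h x) \<bullet> b) * \<psi> x)"
      by (intro Bochner_Integration.integral_cong) (auto simp: indicator_def test_fn_eq_0[OF \<psi>])
    also have "\<dots> = (LINT x|lebesgue. (q x \<bullet> b) * \<psi> x)"
    proof (rule integral_cong_AE)
      show "(\<lambda>x. (q x \<bullet> b) * \<psi> x) \<in> borel_measurable lebesgue"
        by (intro measurable_completion) measurable
      show "(\<lambda>x. ((indicator U x *\<^sub>R h x) \<bullet> b) * \<psi> x) \<in> borel_measurable lebesgue"
        by (intro borel_measurable_times borel_measurable_inner hU measurable_completion) measurable
      show "AE x in lebesgue. ((indicator U x *\<^sub>R h x) \<bullet> b) * \<psi> x = (q x \<bullet> b) * \<psi> x"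
        using qael by eventually_elim simp
    qed
    also have "\<dots> = (LINT x|lborel. (q x \<bullet> b) * \<psi> x)"
      by (rule integral_completion) measurable
    finally show "(LINT x|lborel. w x * frechet_derivative \<psi> (at x) b) = - (LINT x|lborel. (q x \<bullet> b) * \<psi> x)" .
  qed
  note lbw = this
  \<comment> \<open>The representative vanishes on \<open>N\<close> only almost everywhere.
    \<open>line_bounded_extend\<close> evaluates it at individual points of a segment, so it is set
    to 0 there exactly.\<close>
  define v' where "v' x = indicator (- N) x * w x" for x
  have v'w: "AE x in lborel. v' x = w x"
    using wae
  proof eventually_elim
    case (elim x)
    show ?case
    proof (cases "x \<in> N")
      case True
      then have "indicator U x *\<^sub>R v x = 0" using zero[of x] by (auto simp: indicator_def)
      then have "w x = 0" using elim by metis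
      then show ?thesis using True by (simp add: v'_def)
    qed (simp add: v'_def)
  qed
  have "line_bounded U v' (\<lambda>x. norm (q x))"
    unfolding line_bounded_def
  proof (intro conjI allI)
    show "v' \<in> borel_measurable borel" unfolding v'_def using w by measurable
    show "(\<lambda>x. norm (q x)) \<in> borel_measurable borel" using q by measurable
    fix u
    have "AE x in lborel. closed_segment x (x + u) \<subseteq> U \<longrightarrow>
      segment_bound w (\<lambda>x. norm (q x)) x u"
      using lbw unfolding line_bounded_def by blast
    \<comment> \<open>The bound involves the function at x and x + u only, so agreement almost
      everywhere at both points transfers it.\<close>
    then show "AE x in lborel. closed_segment x (x + u) \<subseteq> U \<longrightarrow>
      segment_bound v' (\<lambda>x. norm (q x)) x u"
      using v'w AE_lborel_shift[OF v'w, of u] by eventually_elim simp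
  qed simp
  then have lb: "line_bounded W v' (\<lambda>x. norm (q x))"
    by (rule line_bounded_extend[OF _ U N W]) (simp add: v'_def)
  show thesis
  proof (rule that[OF lb])
    show "AE x in lborel. v' x = indicator U x * v x"
      using v'w wae by eventually_elim simp
    show "AE x in lborel. norm (q x) = indicator U x * norm (h x)"
      using qae
    proof eventually_elim
      case (elim x)
      show ?case unfolding elim[symmetric] by (simp add: indicator_def)
    qed
    show "x \<in> N \<Longrightarrow> v' x = 0" for x by (simp add: v'_def)
  qed
qed

lemma Lp_pow_lebesgue_on:
  "U \<in> sets lebesgue \<Longrightarrow> Lp_pow p U f = (\<integral>\<^sup>+x. ennreal (\<bar>f x\<bar> powr p) \<partial>lebesgue_on U)"
  unfolding Lp_pow_def by (subst nn_integral_restrict_space) auto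

text \<open>On \<open>{\<delta> > 1/(j+1)}\<close> the weighted convergence is unweighted; then let \<open>j\<close> tend to infinity.\<close>

lemma weighted_limit_estimate:
  fixes u :: "'b \<Rightarrow> real" and g :: "'b \<Rightarrow> 'a::euclidean_space"
  assumes p: "p > 0" and K: "K \<ge> 0"
    and [measurable]: "u \<in> borel_measurable M" "g \<in> borel_measurable M"
      "\<And>n. vs n \<in> borel_measurable M" "\<And>n. hs n \<in> borel_measurable M" "\<delta> \<in> borel_measurable M"
    and pos: "\<And>x. x \<in> space M \<Longrightarrow> \<delta> x > 0"
    and est: "\<And>n. (\<integral>\<^sup>+x. ennreal (\<bar>vs n x\<bar> powr p) \<partial>M) \<le> ennreal K * (\<integral>\<^sup>+x. ennreal (\<bar>\<delta> x * norm (hs n x)\<bar> powr p) \<partial>M)"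
    and d: "(\<lambda>n. \<integral>\<^sup>+x. ennreal (\<bar>\<delta> x * (vs n x - u x)\<bar> powr p) \<partial>M) \<longlonglongrightarrow> 0"
    and e: "(\<lambda>n. \<integral>\<^sup>+x. ennreal (\<bar>\<delta> x * norm (hs n x - g x)\<bar> powr p) \<partial>M) \<longlonglongrightarrow> 0"
  shows "(\<integral>\<^sup>+x. ennreal (\<bar>u x\<bar> powr p) \<partial>M) \<le>
    ennreal (2 powr p * (K * 2 powr p)) * (\<integral>\<^sup>+x. ennreal (\<bar>\<delta> x * norm (g x)\<bar> powr p) \<partial>M)"
proof -
  define E where "E = (\<integral>\<^sup>+x. ennreal (\<bar>\<delta> x * norm (g x)\<bar> powr p) \<partial>M)"
  define dn where "dn n = (\<integral>\<^sup>+x. ennreal (\<bar>\<delta> x * (vs n x - u x)\<bar> powr p) \<partial>M)" for n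
  define en where "en n = (\<integral>\<^sup>+x. ennreal (\<bar>\<delta> x * norm (hs n x - g x)\<bar> powr p) \<partial>M)" for n
  have split: "(\<integral>\<^sup>+x. ennreal (\<bar>f x\<bar> powr p) \<partial>M) \<le>
      ennreal (2 powr p) * ((\<integral>\<^sup>+x. ennreal (a x powr p) \<partial>M) + (\<integral>\<^sup>+x. ennreal (b x powr p) \<partial>M))"
    if [measurable]: "a \<in> borel_measurable M" "b \<in> borel_measurable M"
      and ab: "\<And>x. x \<in> space M \<Longrightarrow> \<bar>f x\<bar> \<le> a x + b x" "\<And>x. x \<in> space M \<Longrightarrow> a x \<ge> 0 \<and> b x \<ge> 0"
    for f a b :: "'b \<Rightarrow> real"
  proof -
    have "(\<integral>\<^sup>+x. ennreal (\<bar>f x\<bar> powr p) \<partial>M) \<le>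
        (\<integral>\<^sup>+x. ennreal (2 powr p) * (ennreal (a x powr p) + ennreal (b x powr p)) \<partial>M)"
    proof (intro nn_integral_mono)
      fix x assume x: "x \<in> space M"
      have "\<bar>f x\<bar> powr p \<le> \<bar>a x + b x\<bar> powr p"
        using p ab(1)[OF x] by (intro powr_mono2) auto
      also have "\<dots> \<le> 2 powr p * (\<bar>a x\<bar> powr p + \<bar>b x\<bar> powr p)" by (rule powr_add_le[OF p])
      finally have "\<bar>f x\<bar> powr p \<le> 2 powr p * (a x powr p + b x powr p)" using ab(2)[OF x] by simp
      then show "ennreal (\<bar>f x\<bar> powr p) \<le> ennreal (2 powr p) * (ennreal (a x powr p) + ennreal (b x powr p))"
        by (simp add: ennreal_mult[symmetric] ennreal_plus[symmetric] ennreal_leI del: ennreal_plus)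
    qed
    also have "\<dots> = ennreal (2 powr p) * ((\<integral>\<^sup>+x. ennreal (a x powr p) \<partial>M) + (\<integral>\<^sup>+x. ennreal (b x powr p) \<partial>M))"
      by (simp add: nn_integral_cmult nn_integral_add)
    finally show ?thesis .
  qed
  have grad: "(\<integral>\<^sup>+x. ennreal (\<bar>\<delta> x * norm (hs n x)\<bar> powr p) \<partial>M) \<le> ennreal (2 powr p) * (E + en n)" for n
    unfolding E_def en_def
  proof (rule split)
    fix x assume x: "x \<in> space M"
    have "norm (hs n x) \<le> norm (g x) + norm (hs n x - g x)"
      using norm_triangle_ineq[of "g x" "hs n x - g x"] by simp
    then have "\<delta> x * norm (hs n x) \<le> \<delta> x * (norm (g x) + norm (hs n x - g x))"
      using pos[OF x] by (intro mult_left_mono) auto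
    then show "\<bar>\<delta> x * norm (hs n x)\<bar> \<le> \<bar>\<delta> x * norm (g x)\<bar> + \<bar>\<delta> x * norm (hs n x - g x)\<bar>"
      using pos[OF x] by (simp add: algebra_simps abs_mult)
  qed auto
  define A where "A j = {x \<in> space M. \<delta> x > 1 / real (Suc j)}" for j :: nat
  have [measurable]: "A j \<in> sets M" for j unfolding A_def by measurable
  have Aj: "(\<integral>\<^sup>+x. ennreal (\<bar>u x\<bar> powr p) * indicator (A j) x \<partial>M) \<le> ennreal (2 powr p * (K * 2 powr p)) * E" for j
  \<comment> \<open>For fixed j, n tends to infinity. The factor (j + 1)^p multiplies only the
    vanishing error \<open>dn n\<close>, so the limiting bound is free of j.\<close>
  proof (rule LIMSEQ_le_const)
    have step: "(\<integral>\<^sup>+x. ennreal (\<bar>u x\<bar> powr p) * indicator (A j) x \<partial>M) \<le>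
        ennreal (2 powr p) * (ennreal K * (ennreal (2 powr p) * (E + en n)) + ennreal (real (Suc j) powr p) * dn n)" for n
    proof -
      have "(\<integral>\<^sup>+x. ennreal (\<bar>u x\<bar> powr p) * indicator (A j) x \<partial>M) =
          (\<integral>\<^sup>+x. ennreal (\<bar>u x * indicator (A j) x\<bar> powr p) \<partial>M)"
        using p by (intro nn_integral_cong) (auto simp: indicator_def)
      also have "\<dots> \<le> ennreal (2 powr p) * ((\<integral>\<^sup>+x. ennreal (\<bar>vs n x\<bar> powr p) \<partial>M) +
          (\<integral>\<^sup>+x. ennreal ((real (Suc j) * \<bar>\<delta> x * (vs n x - u x)\<bar>) powr p) \<partial>M))"
      proof (rule split)
        fix x assume x: "x \<in> space M"
        show "\<bar>u x * indicator (A j) x\<bar> \<le> \<bar>vs n x\<bar> + real (Suc j) * \<bar>\<delta> x * (vs n x - u x)\<bar>"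
        proof (cases "x \<in> A j")
          case True
          then have "1 \<le> real (Suc j) * \<delta> x" by (simp add: A_def field_simps)
          then have "1 * \<bar>vs n x - u x\<bar> \<le> real (Suc j) * \<delta> x * \<bar>vs n x - u x\<bar>"
            by (intro mult_right_mono) auto
          then show ?thesis using True pos[OF x] by (simp add: abs_mult mult.assoc)
        qed simp
      qed auto
      also have "(\<integral>\<^sup>+x. ennreal ((real (Suc j) * \<bar>\<delta> x * (vs n x - u x)\<bar>) powr p) \<partial>M) = ennreal (real (Suc j) powr p) * dn n"
        unfolding dn_def by (subst nn_integral_cmult[symmetric]) (auto simp: powr_mult ennreal_mult)
      also have "(\<integral>\<^sup>+x. ennreal (\<bar>vs n x\<bar> powr p) \<partial>M) \<le> ennreal K * (ennreal (2 powr p) * (E + en n))"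
        by (rule order_trans[OF est]) (intro mult_left_mono grad, simp)
      finally show ?thesis by (simp add: add_right_mono mult_left_mono)
    qed
    have "(\<lambda>n. ennreal (2 powr p) * (ennreal K * (ennreal (2 powr p) * (E + en n)) + ennreal (real (Suc j) powr p) * dn n))
      \<longlonglongrightarrow> ennreal (2 powr p) * (ennreal K * (ennreal (2 powr p) * (E + 0)) + ennreal (real (Suc j) powr p) * 0)"
      using d e unfolding dn_def[symmetric] en_def[symmetric]
      by (intro ennreal_tendsto_cmult tendsto_add tendsto_const) auto
    then show "(\<lambda>n. ennreal (2 powr p) * (ennreal K * (ennreal (2 powr p) * (E + en n)) + ennreal (real (Suc j) powr p) * dn n))
      \<longlonglongrightarrow> ennreal (2 powr p * (K * 2 powr p)) * E"
      using K by (simp add: ennreal_mult mult.assoc)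
    show "\<exists>N. \<forall>n\<ge>N. (\<integral>\<^sup>+x. ennreal (\<bar>u x\<bar> powr p) * indicator (A j) x \<partial>M) \<le>
        ennreal (2 powr p) * (ennreal K * (ennreal (2 powr p) * (E + en n)) + ennreal (real (Suc j) powr p) * dn n)"
      using step by blast
  qed
  have inc: "incseq (\<lambda>j x. ennreal (\<bar>u x\<bar> powr p) * indicator (A j) x)"
  proof (rule incseq_SucI, rule le_funI)
    fix j x
    have "1 / real (Suc (Suc j)) \<le> 1 / real (Suc j)" by (intro divide_left_mono) auto
    then have "A j \<subseteq> A (Suc j)" by (auto simp: A_def)
    then show "ennreal (\<bar>u x\<bar> powr p) * indicator (A j) x \<le> ennreal (\<bar>u x\<bar> powr p) * indicator (A (Suc j)) x"
      by (auto simp: indicator_def)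
  qed
  have sup: "ennreal (\<bar>u x\<bar> powr p) = (SUP j. ennreal (\<bar>u x\<bar> powr p) * indicator (A j) x)" if x: "x \<in> space M" for x
  proof (rule antisym)
    obtain j where "1 / real (Suc j) < \<delta> x" using nat_approx_posE[OF pos[OF x]] by blast
    then have "x \<in> A j" using x by (simp add: A_def)
    then have "ennreal (\<bar>u x\<bar> powr p) = ennreal (\<bar>u x\<bar> powr p) * indicator (A j) x" by simp
    also have "\<dots> \<le> (SUP j. ennreal (\<bar>u x\<bar> powr p) * indicator (A j) x)" by (rule SUP_upper) simp
    finally show "ennreal (\<bar>u x\<bar> powr p) \<le> (SUP j. ennreal (\<bar>u x\<bar> powr p) * indicator (A j) x)" .
    show "(SUP j. ennreal (\<bar>u x\<bar> powr p) * indicator (A j) x) \<le> ennreal (\<bar>u x\<bar> powr p)"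
      by (rule SUP_least) (auto simp: indicator_def)
  qed
  have "(\<integral>\<^sup>+x. ennreal (\<bar>u x\<bar> powr p) \<partial>M) = (\<integral>\<^sup>+x. (SUP j. ennreal (\<bar>u x\<bar> powr p) * indicator (A j) x) \<partial>M)"
    by (rule nn_integral_cong[OF sup])
  also have "\<dots> = (SUP j. \<integral>\<^sup>+x. ennreal (\<bar>u x\<bar> powr p) * indicator (A j) x \<partial>M)"
    by (rule nn_integral_monotone_convergence_SUP[OF inc]) measurable
  also have "\<dots> \<le> ennreal (2 powr p * (K * 2 powr p)) * E"
    by (rule SUP_least) (rule Aj)
  finally show ?thesis unfolding E_def .
qed

context holes
begin

text \<open>A function that vanishes near the outer boundary extends by zero to the whole perforated
  space with its line bound intact. This is what turns a problem on the domain into the periodic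
  one.\<close>

lemma wsob_estimate:
  assumes K: "\<And>v k. line_bounded (- periodize \<epsilon> T) v k \<Longrightarrow>
      \<forall>x. \<forall>j\<in>Basis. v x = 0 \<or> v (x + D *\<^sub>R j) = 0 \<Longrightarrow>
      Lp_int p (- periodize \<epsilon> T) v \<le>
        ennreal K * (\<integral>\<^sup>+x. ennreal ((infdist ((1 / \<epsilon>) *\<^sub>R x) P * k x) powr p) \<partial>lborel)"
    and p: "p > 0" and \<Omega>: "open \<Omega>" and U: "open (\<Omega> - periodize \<epsilon> T)"
    and D: "\<And>x j. j \<in> Basis \<Longrightarrow> x \<in> \<Omega> \<Longrightarrow> x + D *\<^sub>R j \<notin> \<Omega>"
    and per: "periodize \<epsilon> T \<in> sets borel"
    and wg: "weak_gradient (\<Omega> - periodize \<epsilon> T) v h"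
    and N: "open N" "frontier \<Omega> \<subseteq> N" "\<And>x. x \<in> (\<Omega> - periodize \<epsilon> T) \<inter> N \<Longrightarrow> v x = 0"
  shows "Lp_pow p (\<Omega> - periodize \<epsilon> T) v \<le>
    ennreal K * Lp_pow p (\<Omega> - periodize \<epsilon> T) (\<lambda>x. infdist ((1 / \<epsilon>) *\<^sub>R x) P * norm (h x))"
proof -
  let ?U = "\<Omega> - periodize \<epsilon> T"
  \<comment> \<open>Adding the exterior gives an open set that covers the complement of \<Omega>, so
    that \<open>?U\<close> and \<open>?N\<close> cover everything off the holes.\<close>
  let ?N = "N \<union> - closure \<Omega>"
  have covN: "- \<Omega> \<subseteq> ?N" using N(2) by (auto simp: frontier_def interior_open[OF \<Omega>])
  have oN: "open ?N" using N(1) by (intro open_Un) auto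
  have cov: "- periodize \<epsilon> T \<subseteq> ?U \<union> ?N" using covN by blast
  have zero: "v x = 0" if "x \<in> ?U \<inter> ?N" for x
    using that N(3)[of x] closure_subset[of \<Omega>] by blast
  show ?thesis
  proof (rule weak_gradient_zero_extension[OF wg U oN cov zero])
    fix v' k
    assume lb: "line_bounded (- periodize \<epsilon> T) v' k"
      and v': "AE x in lborel. v' x = indicator ?U x * v x"
      and k: "AE x in lborel. k x = indicator ?U x * norm (h x)"
      and v'0: "\<And>x. x \<in> ?N \<Longrightarrow> v' x = 0"
    have [measurable]: "v' \<in> borel_measurable borel" "k \<in> borel_measurable borel"
      using lb by (auto simp: line_bounded_def)
    \<comment> \<open>A point and its translate by \<open>D\<close> never both lie in \<Omega>, and
      off \<Omega> the extension is zero at every point, not merely almost everywhere.\<close>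
    have vanish: "v' x = 0 \<or> v' (x + D *\<^sub>R j) = 0" if "j \<in> Basis" for x j
    proof (cases "x \<in> \<Omega>")
      case True
      then have "x + D *\<^sub>R j \<in> ?N" using D[OF that True] covN by blast
      then show ?thesis using v'0 by blast
    next
      case False
      then show ?thesis using covN v'0 by blast
    qed
    have v'l: "AE x in lebesgue. v' x = indicator ?U x * v x" and kl: "AE x in lebesgue. k x = indicator ?U x * norm (h x)"
      using v' k by (auto intro: AE_completion)
    have "Lp_pow p ?U v = (\<integral>\<^sup>+x\<in>- periodize \<epsilon> T. ennreal (\<bar>v' x\<bar> powr p) \<partial>lebesgue)"
      unfolding Lp_pow_def
    proof (rule nn_integral_cong_AE)
      show "AE x in lebesgue. ennreal (\<bar>v x\<bar> powr p) * indicator ?U x = ennreal (\<bar>v' x\<bar> powr p) * indicator (- periodize \<epsilon> T) x"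
        using v'l by eventually_elim (use p in \<open>auto simp: indicator_def\<close>)
    qed
    also have "\<dots> = Lp_int p (- periodize \<epsilon> T) v'"
      by (rule nn_integral_completion) (use per in measurable)
    also have "\<dots> \<le> ennreal K * (\<integral>\<^sup>+x. ennreal ((infdist ((1 / \<epsilon>) *\<^sub>R x) P * k x) powr p) \<partial>lborel)"
      using vanish by (intro K[OF lb]) blast
    also have "(\<integral>\<^sup>+x. ennreal ((infdist ((1 / \<epsilon>) *\<^sub>R x) P * k x) powr p) \<partial>lborel) =
        (\<integral>\<^sup>+x. ennreal ((infdist ((1 / \<epsilon>) *\<^sub>R x) P * k x) powr p) \<partial>lebesgue)"
      by (rule nn_integral_completion[symmetric]) measurable
    also have "\<dots> = Lp_pow p ?U (\<lambda>x. infdist ((1 / \<epsilon>) *\<^sub>R x) P * norm (h x))"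
      unfolding Lp_pow_def
    proof (rule nn_integral_cong_AE)
      show "AE x in lebesgue. ennreal ((infdist ((1 / \<epsilon>) *\<^sub>R x) P * k x) powr p) =
        ennreal (\<bar>infdist ((1 / \<epsilon>) *\<^sub>R x) P * norm (h x)\<bar> powr p) * indicator ?U x"
        using kl by eventually_elim (use p in \<open>auto simp: indicator_def infdist_nonneg\<close>)
    qed
    finally show ?thesis .
  qed
qed

text \<open>The bounds on \<phi> are given in the open cell; the walls of all cells are countably
  many hyperplanes.\<close>

lemma AE_in_cell: "AE x in lborel. \<exists>z\<in>int_lattice. (x::'a) - z \<in> cube_Y"
proof -
  have "AE x in lborel. \<forall>bn\<in>Basis \<times> (UNIV :: int set). (x::'a) \<bullet> fst bn \<noteq> of_int (snd bn) + 1 / 2"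
  proof (subst AE_ball_countable)
    show "countable ((Basis :: 'a set) \<times> (UNIV :: int set))" by (intro countable_SIGMA) (auto intro: countable_finite)
    show "\<forall>bn\<in>Basis \<times> UNIV. AE x in lborel. (x::'a) \<bullet> fst bn \<noteq> of_int (snd bn) + 1 / 2"
    proof
      fix bn :: "'a \<times> int" assume bn: "bn \<in> Basis \<times> UNIV"
      have "negligible {x. x \<bullet> fst bn = of_int (snd bn) + 1 / 2}"
        using bn by (intro negligible_standard_hyperplane) auto
      moreover have "{x. x \<bullet> fst bn = of_int (snd bn) + 1 / 2} \<in> sets borel" by measurable
      ultimately have "{x. x \<bullet> fst bn = of_int (snd bn) + 1 / 2} \<in> null_sets lborel"
        by (simp add: negligible_iff_null_sets null_sets_completion_iff)
      from AE_not_in[OF this] show "AE x in lborel. x \<bullet> fst bn \<noteq> of_int (snd bn) + 1 / 2" by simp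
    qed
  qed
  then show ?thesis
  proof eventually_elim
    case (elim x)
    obtain z where z: "z \<in> int_lattice" "x - z \<in> cbox (- (1 / 2) *\<^sub>R One) ((1 / 2) *\<^sub>R One)"
      by (rule int_lattice_cell_P)
    have "\<bar>(x - z) \<bullet> b\<bar> < 1 / 2" if b: "b \<in> Basis" for b
    proof -
      obtain n where n: "z \<bullet> b = of_int n" using z(1) b by (auto simp: int_lattice_def Ints_def)
      \<comment> \<open>These are the two walls with normal \<open>b\<close> of the cell centred at
        \<open>z\<close>.\<close>
      have "x \<bullet> b \<noteq> of_int n + 1 / 2" "x \<bullet> b \<noteq> of_int (n - 1) + 1 / 2"
        using bspec[OF elim, of "(b, n)"] bspec[OF elim, of "(b, n - 1)"] b by auto
      moreover have "- (1 / 2) \<le> (x - z) \<bullet> b \<and> (x - z) \<bullet> b \<le> 1 / 2" using z(2) b unfolding mem_box by auto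
      ultimately show ?thesis unfolding inner_diff_left n by (simp only: of_int_diff of_int_1) linarith
    qed
    then show ?case using z(1) by (auto simp: cube_Y_def)
  qed
qed

text \<open>Periodicity moves the point into the cell, where \<phi> is compared with the distance
  from \<open>T\<close>; enlarging \<open>T\<close> to \<open>P\<close> only shortens the
  distance.\<close>

lemma weight_lower_bound:
  assumes per: "\<And>y z. z \<in> int_lattice \<Longrightarrow> y \<notin> periodize 1 T \<Longrightarrow> \<phi> (y + z) = \<phi> y"
    and low: "\<And>y. y \<in> cube_Y - T \<Longrightarrow> c * infdist y T \<le> \<phi> y" and c: "c > 0" and \<epsilon>: "\<epsilon> > 0"
  shows "AE x in lebesgue. x \<notin> periodize \<epsilon> T \<longrightarrow> c * infdist ((1 / \<epsilon>) *\<^sub>R x) P \<le> \<phi> ((1 / \<epsilon>) *\<^sub>R x)"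
proof -
  interpret perforated P UNIV 2
    by standard (use closed_P T_nonempty T_subset_P P_shift_iff in auto)
  have "AE x in lborel. \<exists>z\<in>int_lattice. (1 / \<epsilon>) *\<^sub>R (x::'a) - z \<in> cube_Y"
    using \<epsilon> by (intro AE_lborel_scale[OF AE_in_cell]) auto
  then have "AE x in lborel. x \<notin> periodize \<epsilon> T \<longrightarrow> c * infdist ((1 / \<epsilon>) *\<^sub>R x) P \<le> \<phi> ((1 / \<epsilon>) *\<^sub>R x)"
  proof eventually_elim
    case (elim x)
    show ?case
    proof
      assume x: "x \<notin> periodize \<epsilon> T"
      obtain z where z: "z \<in> int_lattice" "(1 / \<epsilon>) *\<^sub>R x - z \<in> cube_Y" using elim by blast
      define y where "y = (1 / \<epsilon>) *\<^sub>R x - z"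
      have eq: "(1 / \<epsilon>) *\<^sub>R x = y + z" by (simp add: y_def)
      have yP: "y \<notin> P" using x P_shift_iff[OF z(1), of y] unfolding mem_periodize_iff[OF \<epsilon>] eq by simp
      have "c * infdist (y + z) P = c * infdist y P" using \<delta>_per[OF z(1), of y] by simp
      also have "\<dots> \<le> c * infdist y T"
        using c T_subset_P T_nonempty by (intro mult_left_mono infdist_mono) auto
      also have "\<dots> \<le> \<phi> y" using yP T_subset_P z(2) by (intro low) (auto simp: y_def)
      also have "\<dots> = \<phi> (y + z)" using per[OF z(1), of y] yP by (simp add: P_def)
      finally show "c * infdist ((1 / \<epsilon>) *\<^sub>R x) P \<le> \<phi> ((1 / \<epsilon>) *\<^sub>R x)" unfolding eq .
    qed
  qed
  then show ?thesis by (rule AE_completion)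
qed

end

text \<open>Multiplication by c > 0 is a bijection between the simple minorants, so the inequality
  also covers nonmeasurable \<open>f\<close> and can be applied directly to weighted
  integrands.\<close>

lemma nn_integral_cmult_le:
  assumes c: "c > 0"
  shows "(\<integral>\<^sup>+x. ennreal c * f x \<partial>M) \<le> ennreal c * (\<integral>\<^sup>+x. f x \<partial>M)"
  unfolding nn_integral_def[of M "\<lambda>x. ennreal c * f x"]
proof (rule SUP_least, clarify)
  fix s assume s: "simple_function M s" "s \<le> (\<lambda>x. ennreal c * f x)"
  have cc: "ennreal (1 / c) * (ennreal c * y) = y" "ennreal c * (ennreal (1 / c) * y) = y" for y
    using c by (simp_all add: mult.assoc[symmetric] ennreal_mult[symmetric])
  have s': "simple_function M (\<lambda>x. ennreal (1 / c) * s x)" using s(1) by (intro simple_function_mult) auto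
  have "ennreal (1 / c) * s x \<le> f x" for x
    using mult_left_mono[OF le_funD[OF s(2), of x], of "ennreal (1 / c)"] by (simp add: cc)
  then have "integral\<^sup>S M (\<lambda>x. ennreal (1 / c) * s x) \<le> (\<integral>\<^sup>+x. f x \<partial>M)"
    unfolding nn_integral_eq_simple_integral[OF s', symmetric] by (rule nn_integral_mono)
  moreover have "integral\<^sup>S M s = ennreal c * integral\<^sup>S M (\<lambda>x. ennreal (1 / c) * s x)"
    by (subst simple_integral_mult[symmetric, OF s']) (simp add: cc)
  ultimately show "integral\<^sup>S M s \<le> ennreal c * (\<integral>\<^sup>+x. f x \<partial>M)"
    by (simp add: mult_left_mono)
qed

lemma Lp_pow_weight_mono:
  assumes c: "c > 0" and p: "p > 0" and d: "\<And>x. 0 \<le> d x"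
    and ae: "AE x in lebesgue. x \<in> U \<longrightarrow> c * d x \<le> w x"
  shows "Lp_pow p U (\<lambda>x. d x * f x) \<le> ennreal ((1 / c) powr p) * Lp_pow p U (\<lambda>x. w x * f x)"
proof -
  have "Lp_pow p U (\<lambda>x. d x * f x) \<le>
      (\<integral>\<^sup>+x. ennreal ((1 / c) powr p) * (ennreal (\<bar>w x * f x\<bar> powr p) * indicator U x) \<partial>lebesgue)"
    unfolding Lp_pow_def
  proof (rule nn_integral_mono_AE)
    show "AE x in lebesgue. ennreal (\<bar>d x * f x\<bar> powr p) * indicator U x \<le>
        ennreal ((1 / c) powr p) * (ennreal (\<bar>w x * f x\<bar> powr p) * indicator U x)"
      using ae
    proof eventually_elim
      case (elim x)
      show ?case
      proof (cases "x \<in> U")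
        case True
        then have "d x \<le> 1 / c * w x" using elim c by (simp add: field_simps)
        then have "\<bar>d x\<bar> \<le> 1 / c * \<bar>w x\<bar>" using d[of x] c
          by (smt (verit, best) divide_nonneg_pos mult_left_mono)
        then have "\<bar>d x\<bar> * \<bar>f x\<bar> \<le> 1 / c * \<bar>w x\<bar> * \<bar>f x\<bar>" by (rule mult_right_mono) simp
        then have "\<bar>d x * f x\<bar> powr p \<le> (1 / c * \<bar>w x * f x\<bar>) powr p"
          using p by (intro powr_mono2) (auto simp: abs_mult)
        also have "\<dots> = (1 / c) powr p * \<bar>w x * f x\<bar> powr p" by (rule powr_mult)
        finally show ?thesis using True by (simp add: ennreal_mult[symmetric] ennreal_leI)
      qed simp
    qed
  qed
  also have "\<dots> \<le> ennreal ((1 / c) powr p) * Lp_pow p U (\<lambda>x. w x * f x)"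
    unfolding Lp_pow_def using c by (intro nn_integral_cmult_le) simp
  finally show ?thesis .
qed

theorem theorem2p4:
  fixes \<Omega> :: "'a::euclidean_space set"
    and m :: nat and \<tau> \<tau>' :: "nat \<Rightarrow> 'a set"
    and c0 :: real and \<phi> :: "'a \<Rightarrow> real" and p :: real
  defines "T \<equiv> (\<Union>i<m. closure (\<tau> i))"
    and "T' \<equiv> (\<Union>i<m. closure (\<tau>' i))"
  assumes c0: "c0 > 0"
    and m: "m \<ge> 1"
    and holes: "\<And>i. i < m \<Longrightarrow> open (\<tau> i) \<and> \<tau> i \<noteq> {} \<and> \<tau> i \<subseteq> cube_Y \<and>
                  smooth_boundary (\<tau> i) \<and> connected (frontier (\<tau> i)) \<and>
                  setdist (\<tau> i) (frontier cube_Y) \<ge> c0"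
    and holes_sep: "\<And>i j. i < m \<Longrightarrow> j < m \<Longrightarrow> i \<noteq> j \<Longrightarrow>
                  \<tau> i \<inter> \<tau> j = {} \<and> setdist (\<tau> i) (\<tau> j) \<ge> c0"
    and ext_holes: "\<And>i. i < m \<Longrightarrow> open (\<tau>' i) \<and> smooth_boundary (\<tau>' i) \<and> \<tau> i \<subseteq> \<tau>' i \<and>
                  setdist (\<tau>' i) (frontier cube_Y) \<ge> c0 / 4 \<and>
                  setdist (frontier (\<tau>' i)) (\<tau> i) \<ge> c0 / 4"
    and ext_sep: "\<And>i j. i < m \<Longrightarrow> j < m \<Longrightarrow> i \<noteq> j \<Longrightarrow> setdist (\<tau>' i) (\<tau>' j) \<ge> c0 / 4"
    and phi_pos: "\<And>y. y \<notin> periodize 1 T \<Longrightarrow> \<phi> y > 0"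
    and phi_per: "\<And>y z. z \<in> int_lattice \<Longrightarrow> y \<notin> periodize 1 T \<Longrightarrow> \<phi> (y + z) = \<phi> y"
    and phi_dist: "\<exists>c C. c > 0 \<and> C > 0 \<and>
                  (\<forall>y \<in> cube_Y - T. c * infdist y T \<le> \<phi> y \<and> \<phi> y \<le> C * infdist y T)"
    and phi_reg: "\<exists>\<alpha>. 0 < \<alpha> \<and> \<alpha> < 1 \<and> C1_alpha_on \<alpha> (cube_Y - T) \<phi>"
    and \<Omega>: "bounded \<Omega>" "lipschitz_domain \<Omega>"
    and p: "1 < p"
  shows "\<exists>C>0. \<forall>\<epsilon>. 0 < \<epsilon> \<and> \<epsilon> < 1 \<and>
            setdist (frontier \<Omega>) (frontier (periodize \<epsilon> T)) \<ge> c0 * \<epsilon> \<and>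
            (\<forall>z\<in>int_lattice. (\<lambda>y. \<epsilon> *\<^sub>R (z + y)) ` T' \<inter> frontier \<Omega> = {}) \<longrightarrow>
          (\<forall>u g. wsob0 p (\<lambda>x. \<phi> ((1 / \<epsilon>) *\<^sub>R x)) (\<Omega> - periodize \<epsilon> T) (frontier \<Omega>) u g \<longrightarrow>
             Lp_pow p (\<Omega> - periodize \<epsilon> T) u
               \<le> ennreal (C powr p) *
                 Lp_pow p (\<Omega> - periodize \<epsilon> T) (\<lambda>x. \<phi> ((1 / \<epsilon>) *\<^sub>R x) * norm (g x)))"
proof -
  interpret H: holes \<tau> m c0
    by unfold_locales (use c0 m holes holes_sep in auto)
  have T: "T = H.T" by (simp add: T_def H.T_def)
  have p0: "p > 0" using p by simp
  obtain c where c: "c > 0" "\<And>y. y \<in> cube_Y - H.T \<Longrightarrow> c * infdist y H.T \<le> \<phi> y"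
    using phi_dist unfolding T by blast
  have op\<Omega>: "open \<Omega>" using \<Omega>(2) by (auto simp: lipschitz_domain_def)
  obtain R where R: "\<And>x. x \<in> \<Omega> \<Longrightarrow> norm x \<le> R" using \<Omega>(1) by (auto simp: bounded_iff)
  \<comment> \<open>Larger than the distance of any two points of \<Omega>, so a translation by
    \<open>D\<close> along a basis vector leaves it.\<close>
  define D where "D = 2 * \<bar>R\<bar> + 1"
  have leave: "x + D *\<^sub>R j \<notin> \<Omega>" if "j \<in> Basis" "x \<in> \<Omega>" for x j
  proof
    assume "x + D *\<^sub>R j \<in> \<Omega>"
    then have "norm (D *\<^sub>R j) \<le> 2 * R"
      using R[OF that(2)] R[of "x + D *\<^sub>R j"] norm_triangle_ineq4[of "x + D *\<^sub>R j" x] by simp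
    then show False using that(1) by (simp add: D_def)
  qed
  have "D \<ge> 1" by (simp add: D_def)
  obtain K where K: "K > 0" "\<And>\<epsilon> v k. 0 < \<epsilon> \<Longrightarrow> \<epsilon> < 1 \<Longrightarrow> line_bounded (- periodize \<epsilon> H.T) v k \<Longrightarrow>
    \<forall>x. \<forall>j\<in>Basis. v x = 0 \<or> v (x + D *\<^sub>R j) = 0 \<Longrightarrow>
    Lp_int p (- periodize \<epsilon> H.T) v \<le>
      ennreal K * (\<integral>\<^sup>+x. ennreal ((infdist ((1 / \<epsilon>) *\<^sub>R x) H.P * k x) powr p) \<partial>lborel)"
    by (rule H.scaled_estimate[OF p \<open>D \<ge> 1\<close>]) (rule that)
  \<comment> \<open>The constant of \<open>weighted_limit_estimate\<close> times the price of
    replacing the distance by \<phi>.\<close>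
  define C0 where "C0 = 2 powr p * (K * 2 powr p) * (1 / c) powr p"
  have C0: "C0 > 0" using K(1) c(1) by (simp add: C0_def)
  \<comment> \<open>\<open>Lp_pow\<close> is the p-th power of the norm, whence the root.\<close>
  define C where "C = C0 powr (1 / p)"
  have C: "C > 0" "C powr p = C0" using C0 p by (auto simp: C_def powr_powr)
  show ?thesis
  proof (intro exI[of _ C] conjI allI impI C(1))
    fix \<epsilon> :: real and u :: "'a \<Rightarrow> real" and g :: "'a \<Rightarrow> 'a"
    assume "0 < \<epsilon> \<and> \<epsilon> < 1 \<and> setdist (frontier \<Omega>) (frontier (periodize \<epsilon> T)) \<ge> c0 * \<epsilon> \<and>
            (\<forall>z\<in>int_lattice. (\<lambda>y. \<epsilon> *\<^sub>R (z + y)) ` T' \<inter> frontier \<Omega> = {})"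
      and ws: "wsob0 p (\<lambda>x. \<phi> ((1 / \<epsilon>) *\<^sub>R x)) (\<Omega> - periodize \<epsilon> T) (frontier \<Omega>) u g"
    then have \<epsilon>: "0 < \<epsilon>" "\<epsilon> < 1" by auto
    let ?U = "\<Omega> - periodize \<epsilon> H.T"
    let ?w = "\<lambda>x. \<phi> ((1 / \<epsilon>) *\<^sub>R x)"
    let ?d = "\<lambda>x. infdist ((1 / \<epsilon>) *\<^sub>R x) H.P"
    have cl: "closed (periodize \<epsilon> H.T)"
    proof -
      have "periodize \<epsilon> H.T = (\<lambda>x. (1 / \<epsilon>) *\<^sub>R x) -` H.P" using H.mem_periodize_iff[OF \<epsilon>(1)] by auto
      also have "closed \<dots>" by (intro closed_vimage H.closed_P continuous_intros)
      finally show ?thesis .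
    qed
    have U: "open ?U" using op\<Omega> cl by (rule open_Diff)
    then have Ul: "?U \<in> sets lebesgue" by simp
    obtain vs hs where ug: "wsob p ?w ?U u g"
      and vh: "\<And>n. wsob p ?w ?U (vs n) (hs n)"
        "\<And>n. \<exists>N. open N \<and> frontier \<Omega> \<subseteq> N \<and> (\<forall>x\<in>?U \<inter> N. vs n x = 0)"
      and dv: "(\<lambda>n. Lp_pow p ?U (\<lambda>x. ?w x * (vs n x - u x))) \<longlonglongrightarrow> 0"
      and dh: "(\<lambda>n. Lp_pow p ?U (\<lambda>x. ?w x * norm (hs n x - g x))) \<longlonglongrightarrow> 0"
      using ws unfolding wsob0_def T by blast
    have low: "AE x in lebesgue. x \<notin> periodize \<epsilon> H.T \<longrightarrow> c * ?d x \<le> ?w x"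
      using phi_per unfolding T by (intro H.weight_lower_bound[OF _ c(2) c(1) \<epsilon>(1)]) auto
    then have low: "AE x in lebesgue. x \<in> ?U \<longrightarrow> c * ?d x \<le> ?w x" by eventually_elim auto
    have weight: "Lp_pow p ?U (\<lambda>x. ?d x * f x) \<le> ennreal ((1 / c) powr p) * Lp_pow p ?U (\<lambda>x. ?w x * f x)" for f
      using low by (intro Lp_pow_weight_mono c(1) p0) (auto simp: infdist_nonneg)
    \<comment> \<open>Convergence with weight \<phi> implies convergence with the distance as
      weight, in which the limit is taken.\<close>
    have small: "(\<lambda>n. Lp_pow p ?U (\<lambda>x. ?d x * f n x)) \<longlonglongrightarrow> 0"
      if "(\<lambda>n. Lp_pow p ?U (\<lambda>x. ?w x * f n x)) \<longlonglongrightarrow> 0" for f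
    proof (rule tendsto_sandwich[OF _ _ tendsto_const])
      show "\<forall>\<^sub>F n in sequentially. 0 \<le> Lp_pow p ?U (\<lambda>x. ?d x * f n x)" by simp
      show "\<forall>\<^sub>F n in sequentially. Lp_pow p ?U (\<lambda>x. ?d x * f n x) \<le>
          ennreal ((1 / c) powr p) * Lp_pow p ?U (\<lambda>x. ?w x * f n x)" using weight by simp
      have "(\<lambda>n. ennreal ((1 / c) powr p) * Lp_pow p ?U (\<lambda>x. ?w x * f n x)) \<longlonglongrightarrow> ennreal ((1 / c) powr p) * 0"
        using that by (intro ennreal_tendsto_cmult) auto
      then show "(\<lambda>n. ennreal ((1 / c) powr p) * Lp_pow p ?U (\<lambda>x. ?w x * f n x)) \<longlonglongrightarrow> 0" by simp
    qed
    have meas: "v \<in> borel_measurable (lebesgue_on ?U) \<and> h \<in> borel_measurable (lebesgue_on ?U)"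
      if "wsob p ?w ?U v h" for v h
      using that unfolding wsob_def weak_gradient_def by (auto intro!: loc_integrable_measurable[OF U])
    have est: "Lp_pow p ?U (vs n) \<le> ennreal K * Lp_pow p ?U (\<lambda>x. ?d x * norm (hs n x))" for n
    proof -
      obtain N where N: "open N" "frontier \<Omega> \<subseteq> N" "\<forall>x\<in>?U \<inter> N. vs n x = 0" using vh(2) by blast
      have wg: "weak_gradient ?U (vs n) (hs n)" using vh(1) by (simp add: wsob_def)
      show ?thesis
        by (rule H.wsob_estimate[OF K(2)[OF \<epsilon>] p0 op\<Omega> U leave _ wg N(1,2) N(3)[rule_format]])
          (use cl in auto)
    qed
    \<comment> \<open>The estimate passes from the approximants to u in the distance weight; only
      afterwards does \<phi> return.\<close>
    have "Lp_pow p ?U u \<le> ennreal (2 powr p * (K * 2 powr p)) * Lp_pow p ?U (\<lambda>x. ?d x * norm (g x))"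
      unfolding Lp_pow_lebesgue_on[OF Ul]
    proof (rule weighted_limit_estimate[where vs = vs and hs = hs])
      show "?d \<in> borel_measurable (lebesgue_on ?U)"
        by (intro borel_measurable_infdist measurable_restrict_space1 measurable_completion) measurable
      show "?d x > 0" if "x \<in> space (lebesgue_on ?U)" for x
      proof -
        have "(1 / \<epsilon>) *\<^sub>R x \<notin> H.P" using that H.mem_periodize_iff[OF \<epsilon>(1), of x] by simp
        moreover have "H.P \<noteq> {}" using H.T_nonempty H.T_subset_P by auto
        ultimately show ?thesis using H.closed_P by (intro infdist_pos_not_in_closed)
      qed
      show "(\<integral>\<^sup>+x. ennreal (\<bar>vs n x\<bar> powr p) \<partial>lebesgue_on ?U) \<le>
          ennreal K * (\<integral>\<^sup>+x. ennreal (\<bar>?d x * norm (hs n x)\<bar> powr p) \<partial>lebesgue_on ?U)" for n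
        using est[of n] unfolding Lp_pow_lebesgue_on[OF Ul] .
      show "(\<lambda>n. \<integral>\<^sup>+x. ennreal (\<bar>?d x * (vs n x - u x)\<bar> powr p) \<partial>lebesgue_on ?U) \<longlonglongrightarrow> 0"
        using small[OF dv] unfolding Lp_pow_lebesgue_on[OF Ul] .
      show "(\<lambda>n. \<integral>\<^sup>+x. ennreal (\<bar>?d x * norm (hs n x - g x)\<bar> powr p) \<partial>lebesgue_on ?U) \<longlonglongrightarrow> 0"
        using small[OF dh] unfolding Lp_pow_lebesgue_on[OF Ul] .
    qed (use p0 K(1) meas[OF ug] meas[OF vh(1)] in auto)
    also have "\<dots> \<le> ennreal (2 powr p * (K * 2 powr p)) *
        (ennreal ((1 / c) powr p) * Lp_pow p ?U (\<lambda>x. ?w x * norm (g x)))"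
      by (intro mult_left_mono weight) simp
    also have "\<dots> = ennreal (C powr p) * Lp_pow p ?U (\<lambda>x. ?w x * norm (g x))"
      unfolding C(2) C0_def using K(1) by (simp add: ennreal_mult mult.assoc)
    finally show "Lp_pow p (\<Omega> - periodize \<epsilon> T) u \<le> ennreal (C powr p) *
        Lp_pow p (\<Omega> - periodize \<epsilon> T) (\<lambda>x. \<phi> ((1 / \<epsilon>) *\<^sub>R x) * norm (g x))"
      unfolding T .
  qed
qed

end
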